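(* There is an absolute constant $\mathcal{C}_*>0$ (independent of $u^0$ and $s$) such that the following holds. For all $s\ge \frac{\log 3}{2\log 2}$ and all $u^0\in\dot H^s_{\mathcal M}$, there exists a unique solution $u\in C^1\big([0,T_{max});\dot H^s_{\mathcal M}\big)$ of the Fourier-restricted Euler equation $$\partial_t u+\mathbb P_{\mathcal M}\big((u\cdot\nabla)u\big)=0,\qquad u(\cdot,0)=u^0,$$ where $T_{max}\in(0,+\infty]$ is the maximal time of existence. Moreover $$T_{max}\ge \frac{1}{\mathcal C_*\,\|u^0\|_{\dot H^{\frac{\log 3}{2\log 2}}}},$$ and consequently, if $T_{max}<+\infty$, then for all $0\le t<T_{max}$, $$\|u(\cdot,t)\|_{\dot H^{\frac{\log 3}{2\log 2}}}\ge \frac{1}{\mathcal C_*\,(T_{max}-t)}.$$ Furthermore, for all $0\le t<T_{max}$ the energy equality $\|u(\cdot,t)\|_{L^2}=\|u^0\|_{L^2}$ holds.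
   Context: Function spaces: $\mathbb T^3=\mathbb R^3/\mathbb Z^3$, $\hat u(k)=\int_{\mathbb T^3}u(x)e^{-2\pi i k\cdot x}\,dx$ for $k\in\mathbb Z^3$. For $s\ge0$, $\dot H^s=\dot H^s(\mathbb T^3;\mathbb R^3)$ is the space of mean-zero $L^2$ vector fields with $\|u\|_{\dot H^s}^2=\sum_{k\ne0}(4\pi^2|k|^2)^s|\hat u(k)|^2<\infty$. Frequencies: let $\sigma=(1,1,1)$. For integers $m\ge0$ let $k^m=2^{2m}\sigma+3^m(1,0,-1)$, $h^m=2^{2m+1}\sigma+3^m(1,1,-2)$, $j^m=2^{2m+1}\sigma+3^m(2,-1,-1)$. For $v\in\mathbb R^3$, $\mathcal P[v]$ is the set of all vectors obtained by permuting the entries of $v$. Let $\mathcal M^+_{2m}=\mathcal P[k^m]$, $\mathcal M^+_{2m+1}=\mathcal P[h^m]\cup\mathcal P[j^m]$, $\mathcal M^+=\bigcup_{n\ge0}\mathcal M_n^+$, $\mathcal M=\mathcal M^+\cup(-\mathcal M^+)$. For $k\in\mathcal M$ let $P_k^\perp(\sigma)=\sigma-\frac{k\cdot\sigma}{|k|^2}k$ and $v^k=P_k^\perp(\sigma)/|P_k^\perp(\sigma)|$. Constraint space: $\dot H^s_{\mathcal M}$ is the set of $u\in\dot H^s(\mathbb T^3;\mathbb R^3)$ with $\operatorname{supp}\hat u\subset\mathcal M$ and $\hat u(k)\in\operatorname{span}\{v^k\}$ (complex multiples of $v^k$) for all $k\in\mathcal M$; such fields are divergence free. The projection $\mathbb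 P_{\mathcal M}$ onto the constraint space is given by $\widehat{\mathbb P_{\mathcal M}w}(k)=(v^k\cdot\hat w(k))v^k$ for $k\in\mathcal M$ and $0$ for $k\notin\mathcal M$; $(u\cdot\nabla)u=\nabla\cdot(u\otimes u)$ is understood in the sense of distributions (via its Fourier coefficients). *)

theory Defs
  imports "HOL-Analysis.Analysis"
begin

section \<open>Vector fields on the torus and homogeneous Sobolev spaces\<close>

text \<open>
  A field on the torus is a 1-periodic function on all of \<open>real^3\<close>; integrals are taken over
  the unit cube. Elements of \<open>L\<^sup>2\<close> and of the Sobolev spaces are represented by functions, so
  equality in these spaces is \<open>field_eq\<close> (equality almost everywhere).
\<close>

type_synonym field = "real^3 \<Rightarrow> real^3"

definition rvec :: "int^3 \<Rightarrow> real^3" where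
  "rvec k = (\<chi> i. of_int (k $ i))"

definition cvec :: "real^3 \<Rightarrow> complex^3" where
  "cvec v = (\<chi> i. of_real (v $ i))"

definition torus :: "(real^3) measure" where
  "torus = lebesgue_on (cbox 0 1)"

definition periodic :: "field \<Rightarrow> bool" where
  "periodic u \<longleftrightarrow> (\<forall>x k. u (x + rvec k) = u x)"

definition field_eq :: "field \<Rightarrow> field \<Rightarrow> bool" where
  "field_eq u v \<longleftrightarrow> (AE x in torus. u x = v x)"

definition L2 :: "field set" where
  "L2 = {u. periodic u \<and> u \<in> borel_measurable torus \<and> integrable torus (\<lambda>x. (norm (u x))\<^sup>2)}"

definition L2_norm :: "field \<Rightarrow> real" where
  "L2_norm u = sqrt (LINT x|torus. (norm (u x))\<^sup>2)"

definition fourier_scalar :: "(real^3 \<Rightarrow> real) \<Rightarrow> int^3 \<Rightarrow> complex" where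
  "fourier_scalar f k =
     (LINT x|torus. of_real (f x) * exp (- (2 * of_real pi * \<i> * of_real (rvec k \<bullet> x))))"

definition fourier :: "field \<Rightarrow> int^3 \<Rightarrow> complex^3" where
  "fourier u k = (\<chi> i. fourier_scalar (\<lambda>x. u x $ i) k)"

definition Hdot_weight :: "real \<Rightarrow> field \<Rightarrow> int^3 \<Rightarrow> real" where
  "Hdot_weight s u k = (4 * pi\<^sup>2 * (norm (rvec k))\<^sup>2) powr s * (norm (fourier u k))\<^sup>2"

definition Hdot :: "real \<Rightarrow> field set" where
  "Hdot s = {u \<in> L2. (LINT x|torus. u x) = 0 \<and> Hdot_weight s u summable_on (- {0})}"

text \<open>Meaningful on \<open>Hdot s\<close> only: \<open>infsum\<close> is 0 for a divergent sum.\<close>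

definition Hdot_norm :: "real \<Rightarrow> field \<Rightarrow> real" where
  "Hdot_norm s u = sqrt (\<Sum>\<^sub>\<infinity>k\<in>- {0}. Hdot_weight s u k)"

section \<open>The frequency set and the constraint space\<close>

definition sigma :: "int^3" where
  "sigma = vector [1, 1, 1]"

definition freq_k :: "nat \<Rightarrow> int^3" where
  "freq_k m = 2 ^ (2 * m) *s sigma + 3 ^ m *s vector [1, 0, -1]"

definition freq_h :: "nat \<Rightarrow> int^3" where
  "freq_h m = 2 ^ (2 * m + 1) *s sigma + 3 ^ m *s vector [1, 1, -2]"

definition freq_j :: "nat \<Rightarrow> int^3" where
  "freq_j m = 2 ^ (2 * m + 1) *s sigma + 3 ^ m *s vector [2, -1, -1]"

definition perms :: "'a^3 \<Rightarrow> ('a^3) set" where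
  "perms v = {\<chi> i. v $ p i | p. p permutes (UNIV :: 3 set)}"

definition M_shell :: "nat \<Rightarrow> (int^3) set" where
  "M_shell n = (if even n then perms (freq_k (n div 2))
                else perms (freq_h (n div 2)) \<union> perms (freq_j (n div 2)))"

definition M_plus :: "(int^3) set" where
  "M_plus = (\<Union>n. M_shell n)"

definition M_freq :: "(int^3) set" where
  "M_freq = M_plus \<union> uminus ` M_plus"

definition perp_sigma :: "int^3 \<Rightarrow> real^3" where
  "perp_sigma k =
     rvec sigma - ((rvec k \<bullet> rvec sigma) / (norm (rvec k))\<^sup>2) *\<^sub>R rvec k"

definition v_dir :: "int^3 \<Rightarrow> real^3" where
  "v_dir k = perp_sigma k /\<^sub>R norm (perp_sigma k)"

definition Hdot_M :: "real \<Rightarrow> field set" where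
  "Hdot_M s = {u \<in> Hdot s. (\<forall>k. fourier u k \<noteq> 0 \<longrightarrow> k \<in> M_freq) \<and>
                 (\<forall>k\<in>M_freq. \<exists>c::complex. fourier u k = c *s cvec (v_dir k))}"

section \<open>The Fourier-restricted Euler equation\<close>

text \<open>
  Distributions on the torus are represented by their Fourier coefficients. Testing
  \<open>(u \<cdot> \<nabla>) u = \<nabla> \<cdot> (u \<otimes> u)\<close> against \<open>exp (- 2 \<pi> \<i> k \<cdot> x)\<close> and moving the divergence onto the
  exponential gives the \<open>j\<close>-th component \<open>\<Sum>i. 2 \<pi> \<i> k\<^sub>i F(u\<^sub>i u\<^sub>j)(k)\<close> (\<open>F\<close> the Fourier coefficient); the integrals exist for
  every \<open>u\<close> in \<open>L2\<close>. The dot product in the projection is bilinear (no conjugation).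
\<close>

definition advection_hat :: "field \<Rightarrow> int^3 \<Rightarrow> complex^3" where
  "advection_hat u k =
     (\<chi> j. \<Sum>i\<in>UNIV. 2 * of_real pi * \<i> * of_int (k $ i) * fourier_scalar (\<lambda>x. u x $ i * u x $ j) k)"

definition proj_M_hat :: "(int^3 \<Rightarrow> complex^3) \<Rightarrow> int^3 \<Rightarrow> complex^3" where
  "proj_M_hat w k =
     (if k \<in> M_freq then (\<Sum>i\<in>UNIV. of_real (v_dir k $ i) * w k $ i) *s cvec (v_dir k) else 0)"

definition time_interval :: "ereal \<Rightarrow> real set" where
  "time_interval T = {t. 0 \<le> t \<and> ereal t < T}"

text \<open>\<open>u \<in> C\<^sup>1([0,T); Hdot_M s)\<close> with time derivative \<open>u'\<close>; the derivative at 0 is one-sided.\<close>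

definition C1_Hdot_M :: "real \<Rightarrow> ereal \<Rightarrow> (real \<Rightarrow> field) \<Rightarrow> (real \<Rightarrow> field) \<Rightarrow> bool" where
  "C1_Hdot_M s T u u' \<longleftrightarrow>
     (\<forall>t\<in>time_interval T.
        u t \<in> Hdot_M s \<and> u' t \<in> Hdot_M s \<and>
        ((\<lambda>r. Hdot_norm s (\<lambda>x. (u r x - u t x) /\<^sub>R (r - t) - u' t x)) \<longlongrightarrow> 0)
          (at t within time_interval T) \<and>
        ((\<lambda>r. Hdot_norm s (\<lambda>x. u' r x - u' t x)) \<longlongrightarrow> 0) (at t within time_interval T))"

definition is_solution :: "real \<Rightarrow> field \<Rightarrow> ereal \<Rightarrow> (real \<Rightarrow> field) \<Rightarrow> bool" where
  "is_solution s u0 T u \<longleftrightarrow>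
     0 < T \<and> field_eq (u 0) u0 \<and>
     (\<exists>u'. C1_Hdot_M s T u u' \<and>
        (\<forall>t\<in>time_interval T. \<forall>k. fourier (u' t) k + proj_M_hat (advection_hat (u t)) k = 0))"

definition T_max :: "real \<Rightarrow> field \<Rightarrow> ereal" where
  "T_max s u0 = Sup {T. \<exists>u. is_solution s u0 T u}"

definition s_crit :: real where
  "s_crit = ln 3 / (2 * ln 2)"

end

theory Submission
  imports Defs
begin

text \<open>
  Projecting a resonance \<open>h + j = k\<close> of frequencies onto \<open>sigma\<close> shows that only neighbouring shells
  interact, and \<open>v_dir h\<close> is almost orthogonal to \<open>sigma\<close>, so that \<open>\<bar>rvec k \<bullet> v_dir h\<bar>\<close> is of order
  \<open>3 powr (n / 2)\<close> on the \<open>n\<close>-th shell, which is exactly \<open>s_crit\<close> derivatives. The equation is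
  therefore an ordinary differential equation \<open>x' = B x x\<close> in a Hilbert space of Fourier coefficients,
  with a bounded bilinear \<open>B\<close> obeying the tame estimate
  \<open>norm (B x y) \<le> K * norm (L x) * norm y\<close>, where \<open>norm (L x)\<close> is the norm of order \<open>s_crit\<close>.
  Its power series in time converges for \<open>t < 1 / (K * norm (L x0))\<close>. The constant depends on \<open>s\<close>,
  but at the critical level it is absolute and the series bounds \<open>norm (L x)\<close> up to the time claimed;
  restarting the solution at level \<open>s\<close> shows that it exists at least that long. Since the shells
  grow geometrically, admissible fields have absolutely convergent Fourier series.
\<close>

section \<open>Quadratic differential equations in Hilbert spaces\<close>

text \<open>The energy equality comes from the same bilinear form: \<open>v_dir h\<close> is
  orthogonal to \<open>h\<close>, so the convolution kernel changes sign under
  \<open>k \<mapsto> h - k\<close>, and in the unweighted norm the nonlinearity is orthogonal to its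
  second argument. Passing between fields and coefficients has two halves. Injectivity up to null
  sets is the uniqueness theorem for Fourier coefficients of integrable functions, obtained by
  enlarging the functions to which \<open>f\<close> is orthogonal from characters to indicators of
  boxes. Surjectivity rests on the absolute convergence of the series, which also turns products of
  fields into convolutions; these are finite sums because a frequency has boundedly many neighbours.
  The same count of neighbours, used in both directions, replaces any finer product
  estimate.\<close>

definition quad_sol :: "('a \<Rightarrow> 'a \<Rightarrow> 'a::real_normed_vector) \<Rightarrow> 'a \<Rightarrow> ereal \<Rightarrow> (real \<Rightarrow> 'a) \<Rightarrow> bool" where
  "quad_sol B x0 T x \<longleftrightarrow> 0 < T \<and> x 0 = x0 \<and>
     (\<forall>t\<in>time_interval T. (x has_vector_derivative B (x t) (x t)) (at t within time_interval T))"

lemma time_interval_mono: "T \<le> T' \<Longrightarrow> time_interval T \<subseteq> time_interval T'"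
  by (auto simp: time_interval_def)

lemma atLeastAtMost_subset_time_interval: "t \<in> time_interval T \<Longrightarrow> {0..t} \<subseteq> time_interval T"
  by (auto simp: time_interval_def) (meson ereal_less_eq(3) le_less_trans)

lemma zero_in_time_interval: "0 \<in> time_interval T \<longleftrightarrow> 0 < T"
  by (auto simp: time_interval_def zero_ereal_def)

text \<open>Both intervals start at 0 and extend beyond \<open>t\<close>, so they agree near
  \<open>t\<close>; in particular the one-sided derivative at 0 is the same for both. This is what
  allows solutions to be restricted and glued.\<close>

lemma at_within_time_interval:
  assumes "t \<in> time_interval T" "t \<in> time_interval T'"
  shows "at t within time_interval T = at t within time_interval T'"
proof (rule at_within_nhd)
  show "open {r::real. ereal r < min T T'}"
    by (intro open_Collect_less continuous_intros)
qed (use assms in \<open>auto simp: time_interval_def\<close>)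

lemma quad_sol_restrict:
  assumes "quad_sol B x0 T x" "0 < T'" "T' \<le> T"
  shows "quad_sol B x0 T' x"
proof -
  have *: "time_interval T' \<subseteq> time_interval T"
    using assms time_interval_mono by blast
  then show ?thesis
    using assms at_within_time_interval[of _ T' T] unfolding quad_sol_def by auto
qed

lemma quad_sol_continuous_on:
  assumes "quad_sol B x0 T x" "t \<in> time_interval T"
  shows "continuous_on {0..t} x"
proof -
  have "continuous_on (time_interval T) x"
    using assms unfolding quad_sol_def
    by (meson continuous_on_eq_continuous_within has_vector_derivative_continuous)
  then show ?thesis
    using atLeastAtMost_subset_time_interval[OF assms(2)] continuous_on_subset by blast
qed

lemma quad_sol_DERIV:
  assumes "quad_sol B x0 T x" "t \<in> time_interval T" "0 < s" "s < t"
  shows "(x has_vector_derivative B (x s) (x s)) (at s)"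
proof -
  have s: "s \<in> time_interval T"
    using atLeastAtMost_subset_time_interval[OF assms(2)] assms by auto
  have "{0<..<t} \<subseteq> time_interval T"
    using atLeastAtMost_subset_time_interval[OF assms(2)] by force
  then have "(x has_vector_derivative B (x s) (x s)) (at s within {0<..<t})"
    using assms(1) s has_vector_derivative_within_subset unfolding quad_sol_def by blast
  then show ?thesis
    using assms by (simp add: at_within_open[of s "{0<..<t}"])
qed

text \<open>Gronwall's argument for the squared distance of the two solutions.\<close>

lemma quad_sol_unique:
  fixes x y :: "real \<Rightarrow> 'a::real_inner"
  assumes B: "bounded_bilinear B"
    and x: "quad_sol B x0 T x" and y: "quad_sol B x0 T' y"
    and t: "t \<in> time_interval T" "t \<in> time_interval T'"
  shows "x t = y t"
proof -
  interpret B: bounded_bilinear B by fact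
  obtain K where K: "0 < K" "\<And>a b. norm (B a b) \<le> norm a * norm b * K"
    using B.pos_bounded by blast
  have cx: "continuous_on {0..t} x" and cy: "continuous_on {0..t} y"
    using quad_sol_continuous_on x y t by blast+
  obtain R1 where R1: "\<And>s. s \<in> {0..t} \<Longrightarrow> norm (x s) \<le> R1"
    using compact_imp_bounded[OF compact_continuous_image[OF cx compact_Icc]]
    unfolding bounded_iff by (metis image_eqI)
  obtain R2 where R2: "\<And>s. s \<in> {0..t} \<Longrightarrow> norm (y s) \<le> R2"
    using compact_imp_bounded[OF compact_continuous_image[OF cy compact_Icc]]
    unfolding bounded_iff by (metis image_eqI)
  \<comment> \<open>A Lipschitz constant of \<open>a \<mapsto> B a a\<close> along the two
    trajectories; the weight in \<open>\<phi>\<close> doubles it because the distance is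
    squared.\<close>
  define M where "M = K * (R1 + R2)"
  define z where "z s = x s - y s" for s
  define \<phi> where "\<phi> s = exp (- (2 * M * s)) * (z s \<bullet> z s)" for s
  have t0: "0 \<le> t" using t by (simp add: time_interval_def)
  have "\<phi> 0 \<ge> \<phi> t"
  proof (rule DERIV_nonpos_imp_decreasing_open[OF t0])
    fix s assume s: "0 < s" "s < t"
    let ?d = "B (x s) (x s) - B (y s) (y s)"
    have dz: "(z has_vector_derivative ?d) (at s)"
      unfolding z_def using quad_sol_DERIV[OF x t(1) s] quad_sol_DERIV[OF y t(2) s]
      by (rule has_vector_derivative_diff)
    have "((\<lambda>s. z s \<bullet> z s) has_vector_derivative z s \<bullet> ?d + ?d \<bullet> z s) (at s)"
      by (rule bounded_bilinear.has_vector_derivative[OF bounded_bilinear_inner dz dz])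
    then have di: "((\<lambda>s. z s \<bullet> z s) has_real_derivative 2 * (z s \<bullet> ?d)) (at s)"
      by (simp add: has_real_derivative_iff_has_vector_derivative inner_commute)
    have de: "((\<lambda>s. exp (- (2 * M * s))) has_real_derivative (- (2 * M)) * exp (- (2 * M * s))) (at s)"
      by (auto intro!: derivative_eq_intros)
    have "?d = B (x s) (z s) + B (z s) (y s)"
      by (simp add: z_def B.diff_left B.diff_right)
    then have "norm ?d \<le> norm (B (x s) (z s)) + norm (B (z s) (y s))"
      by (simp add: norm_triangle_ineq)
    also have "\<dots> \<le> norm (x s) * norm (z s) * K + norm (z s) * norm (y s) * K"
      using K by (intro add_mono) auto
    also have "\<dots> = (norm (x s) + norm (y s)) * (norm (z s) * K)"
      by (simp add: algebra_simps)
    also have "\<dots> \<le> (R1 + R2) * (norm (z s) * K)"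
      using R1[of s] R2[of s] s K by (intro mult_right_mono add_mono) auto
    finally have "norm ?d \<le> M * norm (z s)"
      by (simp add: M_def mult_ac)
    then have "z s \<bullet> ?d \<le> norm (z s) * (M * norm (z s))"
      by (meson norm_cauchy_schwarz mult_left_mono norm_ge_zero order_trans)
    then have le: "z s \<bullet> ?d \<le> M * (z s \<bullet> z s)"
      by (simp add: dot_square_norm power2_eq_square mult_ac)
    have "(\<phi> has_real_derivative (- (2 * M)) * exp (- (2 * M * s)) * (z s \<bullet> z s)
             + 2 * (z s \<bullet> ?d) * exp (- (2 * M * s))) (at s)"
      unfolding \<phi>_def by (rule DERIV_mult[OF de di])
    moreover have "(- (2 * M)) * exp (- (2 * M * s)) * (z s \<bullet> z s) + 2 * (z s \<bullet> ?d) * exp (- (2 * M * s))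
        = 2 * exp (- (2 * M * s)) * (z s \<bullet> ?d - M * (z s \<bullet> z s))"
      by (simp add: algebra_simps)
    moreover have "\<dots> \<le> 0"
      using le by (simp add: mult_nonneg_nonpos)
    ultimately show "\<exists>d. (\<phi> has_real_derivative d) (at s) \<and> d \<le> 0" by metis
  next
    show "continuous_on {0..t} \<phi>"
      unfolding \<phi>_def z_def by (intro continuous_intros cx cy)
  qed
  moreover have "\<phi> 0 = 0"
    using x y by (simp add: \<phi>_def z_def quad_sol_def)
  ultimately have "exp (- (2 * M * t)) * (z t \<bullet> z t) \<le> 0"
    by (simp add: \<phi>_def)
  then have "z t \<bullet> z t \<le> 0"
    by (simp add: mult_le_0_iff)
  then have "z t = 0"
    using inner_ge_zero[of "z t"] inner_eq_zero_iff[of "z t"] by linarith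
  then show ?thesis
    by (simp add: z_def)
qed

lemma quad_sol_shift:
  assumes x: "quad_sol B x0 T x" and a: "a \<in> time_interval T"
  shows "quad_sol B (x a) (T - ereal a) (\<lambda>t. x (t + a))"
proof -
  have I: "t \<in> time_interval (T - ereal a) \<Longrightarrow> t + a \<in> time_interval T" for t
    using a by (cases T) (auto simp: time_interval_def)
  have "((\<lambda>t. x (t + a)) has_vector_derivative B (x (t + a)) (x (t + a)))
          (at t within time_interval (T - ereal a))" if t: "t \<in> time_interval (T - ereal a)" for t
  proof -
    have "(x has_vector_derivative B (x (t + a)) (x (t + a)))
            (at (t + a) within (\<lambda>t. t + a) ` time_interval (T - ereal a))"
    proof (rule has_vector_derivative_within_subset)
      show "(x has_vector_derivative B (x (t + a)) (x (t + a))) (at (t + a) within time_interval T)"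
        using x I[OF t] by (simp add: quad_sol_def)
    qed (use I in auto)
    moreover have "((\<lambda>t. t + a) has_vector_derivative 1) (at t within time_interval (T - ereal a))"
      by (auto intro!: derivative_eq_intros)
    ultimately show ?thesis
      using vector_diff_chain_within[of "\<lambda>t. t + a" 1 t _ x] by (simp add: o_def)
  qed
  moreover have "0 < T - ereal a"
    using a by (cases T) (auto simp: time_interval_def)
  ultimately show ?thesis by (simp add: quad_sol_def)
qed

lemma quad_sol_glue:
  fixes x y :: "real \<Rightarrow> 'a::real_inner"
  assumes B: "bounded_bilinear B"
    and x: "quad_sol B x0 T x" and a: "a \<in> time_interval T"
    and y: "quad_sol B (x a) T' y"
  shows "\<exists>z. quad_sol B x0 (ereal a + T') z"
proof (cases "ereal a + T' \<le> T")
  case True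
  have "0 < ereal a + T'"
    using a y by (cases T') (auto simp: time_interval_def quad_sol_def)
  then show ?thesis
    using quad_sol_restrict[OF x _ True] by blast
next
  case False
  \<comment> \<open>The switch happens at \<open>T\<close> rather than at \<open>a\<close>. By
    uniqueness \<open>z\<close> is \<open>y (t - a)\<close> from \<open>a\<close> on, hence on a
    whole neighbourhood of every \<open>t \<ge> T\<close>, and no one-sided derivatives have to be
    matched.\<close>
  define z where "z t = (if ereal t < T then x t else y (t - a))" for t
  have a0: "0 \<le> a" "ereal a < T" using a by (auto simp: time_interval_def)
  have shift: "quad_sol B (x a) (T - ereal a) (\<lambda>t. x (t + a))"
    by (rule quad_sol_shift[OF x a])
  have zx: "z t = x t" if "t \<in> time_interval T" for t
    using that by (simp add: z_def time_interval_def)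
  have zy: "z t = y (t - a)" if "a \<le> t" "t \<in> time_interval (ereal a + T')" for t
  proof (cases "ereal t < T")
    case True
    have "x ((t - a) + a) = y (t - a)"
      using that True a0
      by (intro quad_sol_unique[OF B shift y]; cases T; cases T') (auto simp: time_interval_def)
    then show ?thesis using True by (simp add: z_def)
  qed (simp add: z_def)
  have "(z has_vector_derivative B (z t) (z t)) (at t within time_interval (ereal a + T'))"
    if t: "t \<in> time_interval (ereal a + T')" for t
  proof (cases "ereal t < T")
    case True
    then have tT: "t \<in> time_interval T" using t by (simp add: time_interval_def)
    have "(x has_vector_derivative B (x t) (x t)) (at t within time_interval T)"
      using x tT by (simp add: quad_sol_def)
    then have "(z has_vector_derivative B (x t) (x t)) (at t within time_interval T)"
      by (rule has_vector_derivative_transform[OF tT zx, rotated])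
    then show ?thesis using at_within_time_interval[OF tT t] zx[OF tT] by simp
  next
    case F: False
    then have ta: "a < t" using a0 by (cases T) auto
    define S where "S = time_interval (ereal a + T') \<inter> {a<..}"
    have tS: "t \<in> S" using t ta by (simp add: S_def)
    have sub: "(\<lambda>t. t - a) ` S \<subseteq> time_interval T'"
      by (cases T') (auto simp: S_def time_interval_def)
    then have "t - a \<in> time_interval T'" using tS by auto
    then have "(y has_vector_derivative B (y (t - a)) (y (t - a))) (at (t - a) within (\<lambda>t. t - a) ` S)"
      by (intro has_vector_derivative_within_subset[OF _ sub]) (use y in \<open>simp add: quad_sol_def\<close>)
    moreover have "((\<lambda>t. t - a) has_vector_derivative 1) (at t within S)"
      by (auto intro!: derivative_eq_intros)
    ultimately have "((\<lambda>t. y (t - a)) has_vector_derivative B (y (t - a)) (y (t - a))) (at t within S)"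
      using vector_diff_chain_within[of "\<lambda>t. t - a" 1 t S y] by (simp add: o_def)
    then have "(z has_vector_derivative B (y (t - a)) (y (t - a))) (at t within S)"
      by (rule has_vector_derivative_transform[OF tS, rotated]) (auto simp: S_def intro!: zy)
    moreover have "at t within S = at t within time_interval (ereal a + T')"
      unfolding S_def using ta by (intro at_within_nhd[of t "{a<..}"]) auto
    ultimately show ?thesis using zy[of t] ta t by simp
  qed
  moreover have "0 < ereal a + T'"
    using a0 y by (cases T') (auto simp: quad_sol_def)
  moreover have "z 0 = x0"
    using zx[of 0] x by (auto simp: quad_sol_def zero_in_time_interval)
  ultimately show ?thesis by (auto simp: quad_sol_def)
qed

section \<open>Maximal solutions and conserved quantities\<close>

definition quad_T_max :: "('a \<Rightarrow> 'a \<Rightarrow> 'a::real_normed_vector) \<Rightarrow> 'a \<Rightarrow> ereal" where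
  "quad_T_max B x0 = Sup {T. \<exists>x. quad_sol B x0 T x}"

lemma quad_sol_le_T_max: "quad_sol B x0 T x \<Longrightarrow> T \<le> quad_T_max B x0"
  unfolding quad_T_max_def by (rule Sup_upper) auto

text \<open>Solutions agree where they overlap. Choosing for each time a solution that is still
  alive and evaluating it there, the diagonal \<open>x t t\<close>, gives one solution on the union
  of the intervals, so the supremum is attained.\<close>

lemma quad_sol_maximal:
  fixes B :: "'a \<Rightarrow> 'a \<Rightarrow> 'a::real_inner"
  assumes B: "bounded_bilinear B" and ex: "quad_sol B x0 T0 w"
  shows "\<exists>x. quad_sol B x0 (quad_T_max B x0) x"
proof -
  let ?T = "quad_T_max B x0"
  have pos: "0 < ?T"
    using ex quad_sol_le_T_max[OF ex] by (auto simp: quad_sol_def)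
  have "\<exists>T x. quad_sol B x0 T x \<and> t \<in> time_interval T" if "t \<in> time_interval ?T" for t
    using that unfolding quad_T_max_def time_interval_def by (auto simp: less_Sup_iff)
  then obtain T x where sol: "\<And>t. t \<in> time_interval ?T \<Longrightarrow> quad_sol B x0 (T t) (x t)"
    and mem: "\<And>t. t \<in> time_interval ?T \<Longrightarrow> t \<in> time_interval (T t)"
    by metis
  define u where "u t = x t t" for t
  have u: "u r = x t r" if "t \<in> time_interval ?T" "r \<in> time_interval (T t)" for r t
  proof -
    have "r \<in> time_interval ?T"
      using that quad_sol_le_T_max[OF sol] time_interval_mono by blast
    then show ?thesis
      unfolding u_def using quad_sol_unique[OF B sol sol mem] that by blast
  qed
  have "(u has_vector_derivative B (u t) (u t)) (at t within time_interval ?T)"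
    if t: "t \<in> time_interval ?T" for t
  proof -
    have "(x t has_vector_derivative B (x t t) (x t t)) (at t within time_interval (T t))"
      using sol[OF t] mem[OF t] by (simp add: quad_sol_def)
    then have "(u has_vector_derivative B (x t t) (x t t)) (at t within time_interval (T t))"
      by (rule has_vector_derivative_transform[OF mem[OF t] u[OF t], rotated])
    then show ?thesis
      using at_within_time_interval[OF mem[OF t] t] by (simp add: u_def)
  qed
  moreover have "u 0 = x0"
    using sol[of 0] pos by (simp add: u_def quad_sol_def zero_in_time_interval)
  ultimately show ?thesis
    using pos by (auto simp: quad_sol_def)
qed

text \<open>The derivative of \<open>D x \<bullet> D x\<close> is twice the skew term. With
  \<open>D\<close> the passage to unweighted coefficients this becomes conservation of
  energy.\<close>

lemma quad_sol_conserved: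
  fixes B :: "'a \<Rightarrow> 'a \<Rightarrow> 'a::real_normed_vector" and D :: "'a \<Rightarrow> 'b::real_inner"
  assumes D: "bounded_linear D" and skew: "\<And>a. D a \<bullet> D (B a a) = 0"
    and x: "quad_sol B x0 T x" and t: "t \<in> time_interval T"
  shows "norm (D (x t)) = norm (D x0)"
proof -
  have "(\<lambda>s. D (x s) \<bullet> D (x s)) t = (\<lambda>s. D (x s) \<bullet> D (x s)) 0" if "t \<noteq> 0"
  proof (rule DERIV_isconst_end[where f="\<lambda>s. D (x s) \<bullet> D (x s)" and a=0 and b=t])
    show "0 < t" using t that by (simp add: time_interval_def)
    show "continuous_on {0..t} (\<lambda>s. D (x s) \<bullet> D (x s))"
      by (intro continuous_intros bounded_linear.continuous_on[OF D] quad_sol_continuous_on[OF x t])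
    fix s assume s: "0 < s" "s < t"
    have d: "((\<lambda>s. D (x s)) has_vector_derivative D (B (x s) (x s))) (at s)"
      by (rule bounded_linear.has_vector_derivative[OF D quad_sol_DERIV[OF x t s]])
    show "((\<lambda>s. D (x s) \<bullet> D (x s)) has_real_derivative 0) (at s)"
      using bounded_bilinear.has_vector_derivative[OF bounded_bilinear_inner d d]
      by (simp add: has_real_derivative_iff_has_vector_derivative inner_commute skew)
  qed
  then show ?thesis
    using x by (cases "t = 0") (auto simp: norm_eq_sqrt_inner quad_sol_def)
qed

section \<open>Power series solutions\<close>

lemma bounded_bilinear_Cauchy_product_sums:
  fixes B :: "'a::banach \<Rightarrow> 'b::banach \<Rightarrow> 'c::real_normed_vector"
  assumes B: "bounded_bilinear B"
    and a: "summable (\<lambda>n. norm (a n))" and b: "summable (\<lambda>n. norm (b n))"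
  shows "(\<lambda>n. \<Sum>i\<le>n. B (a i) (b (n - i))) sums B (\<Sum>n. a n) (\<Sum>n. b n)"
proof -
  interpret B: bounded_bilinear B by fact
  obtain K where K: "\<And>a b. norm (B a b) \<le> norm a * norm b * K"
    using B.bounded by blast
  define Sq :: "nat \<Rightarrow> (nat \<times> nat) set" where "Sq N = {..<N} \<times> {..<N}" for N
  define Tr :: "nat \<Rightarrow> (nat \<times> nat) set" where "Tr N = {(i, j). i + j < N}" for N
  have sub: "Tr N \<subseteq> Sq N" and fin: "finite (Sq N)" for N
    by (auto simp: Tr_def Sq_def)
  let ?c = "\<lambda>(i, j). norm (a i) * norm (b j)"
  have sq: "(\<lambda>N. sum ?c (Sq N)) \<longlonglongrightarrow> (\<Sum>n. norm (a n)) * (\<Sum>n. norm (b n))"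
    using tendsto_mult[OF summable_LIMSEQ[OF a] summable_LIMSEQ[OF b]]
    by (simp add: Sq_def sum_product sum.cartesian_product)
  have tr: "(\<lambda>N. sum ?c (Tr N)) \<longlonglongrightarrow> (\<Sum>n. norm (a n)) * (\<Sum>n. norm (b n))"
    using Cauchy_product_sums[of "\<lambda>n. norm (a n)" "\<lambda>n. norm (b n)"] a b
    by (simp add: Tr_def sum.triangle_reindex sums_def)
  have "(\<lambda>N. K * (sum ?c (Sq N) - sum ?c (Tr N))) \<longlonglongrightarrow> 0"
    using tendsto_mult_right_zero[OF tendsto_diff[OF sq tr, simplified]] by blast
  \<comment> \<open>The terms in the square but outside the triangle are dominated by the scalar
    ones, whose square and triangle sums have the same limit by the scalar Cauchy product.\<close>
  moreover have "norm (B (\<Sum>n<N. a n) (\<Sum>n<N. b n) - (\<Sum>n<N. \<Sum>i\<le>n. B (a i) (b (n - i))))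
      \<le> K * (sum ?c (Sq N) - sum ?c (Tr N))" for N
  proof -
    have "B (\<Sum>n<N. a n) (\<Sum>n<N. b n) = (\<Sum>(i, j)\<in>Sq N. B (a i) (b j))"
      by (simp only: B.sum_left, simp only: B.sum_right, simp add: Sq_def sum.cartesian_product)
    moreover have "(\<Sum>n<N. \<Sum>i\<le>n. B (a i) (b (n - i))) = (\<Sum>(i, j)\<in>Tr N. B (a i) (b j))"
      by (simp add: Tr_def sum.triangle_reindex)
    ultimately have "B (\<Sum>n<N. a n) (\<Sum>n<N. b n) - (\<Sum>n<N. \<Sum>i\<le>n. B (a i) (b (n - i)))
        = (\<Sum>(i, j)\<in>Sq N - Tr N. B (a i) (b j))"
      by (simp add: sum_diff[OF fin sub])
    also have "norm \<dots> \<le> (\<Sum>p\<in>Sq N - Tr N. K * ?c p)"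
      by (rule sum_norm_le) (use K in \<open>auto simp: mult_ac\<close>)
    also have "\<dots> = K * (sum ?c (Sq N) - sum ?c (Tr N))"
      by (simp only: sum_distrib_left[symmetric] sum_diff[OF fin sub])
    finally show ?thesis .
  qed
  ultimately have 0: "(\<lambda>N. B (\<Sum>n<N. a n) (\<Sum>n<N. b n) - (\<Sum>n<N. \<Sum>i\<le>n. B (a i) (b (n - i)))) \<longlonglongrightarrow> 0"
    by (rule Lim_null_comparison[OF always_eventually[OF allI], rotated])
  have "(\<lambda>N. B (\<Sum>n<N. a n) (\<Sum>n<N. b n)) \<longlonglongrightarrow> B (\<Sum>n. a n) (\<Sum>n. b n)"
    by (intro B.tendsto summable_LIMSEQ summable_norm_cancel[OF a] summable_norm_cancel[OF b])
  then show ?thesis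
    unfolding sums_def by (rule Lim_transform2[OF _ 0])
qed

text \<open>The recursion obtained by comparing the coefficients of \<open>t ^ n\<close> in
  \<open>x' = B x x\<close>.\<close>

fun quad_coeff :: "('a \<Rightarrow> 'a \<Rightarrow> 'a::real_vector) \<Rightarrow> 'a \<Rightarrow> nat \<Rightarrow> 'a" where
  "quad_coeff B x0 0 = x0"
| "quad_coeff B x0 (Suc n) =
     (1 / real (Suc n)) *\<^sub>R (\<Sum>i\<le>n. B (quad_coeff B x0 i) (quad_coeff B x0 (n - i)))"

definition quad_series :: "('a \<Rightarrow> 'a \<Rightarrow> 'a::real_normed_vector) \<Rightarrow> 'a \<Rightarrow> real \<Rightarrow> 'a" where
  "quad_series B x0 t = (\<Sum>n. t ^ n *\<^sub>R quad_coeff B x0 n)"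

text \<open>The \<open>n + 1\<close> summands cancel the factor \<open>1 / (n + 1)\<close>, so the
  growth stays geometric. Each summand is estimated with \<open>L\<close> on its left factor; hence
  even in the strong norm the rate \<open>q\<close> sees \<open>x0\<close> only through
  \<open>L x0\<close>.\<close>

lemma quad_coeff_bound:
  fixes B :: "'a \<Rightarrow> 'a \<Rightarrow> 'a::real_normed_vector" and L :: "'a \<Rightarrow> 'b::real_normed_vector" and x0 :: 'a
  assumes bd: "\<And>x y. norm (B x y) \<le> K * norm (L x) * norm y"
    and Lbd: "\<And>x y. norm (L (B x y)) \<le> K * norm (L x) * norm (L y)"
    and L: "linear L" and K: "0 \<le> K"
  defines "q \<equiv> K * norm (L x0)"
  shows "norm (L (quad_coeff B x0 n)) \<le> norm (L x0) * q ^ n \<and> norm (quad_coeff B x0 n) \<le> norm x0 * q ^ n"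
proof (induction n rule: less_induct)
  case (less n)
  have q0: "0 \<le> q" using K by (simp add: q_def)
  show ?case
  proof (cases n)
    case (Suc m)
    have step: "norm (\<Sum>i\<le>m. f i) \<le> real (Suc m) * (c * q ^ Suc m)"
      if "\<And>i. i \<le> m \<Longrightarrow> norm (f i) \<le> c * q ^ Suc m" for f :: "nat \<Rightarrow> 'z::real_normed_vector" and c
      using sum_norm_bound[of "{..m}" f "c * q ^ Suc m"] that by simp
    let ?a = "quad_coeff B x0"
    have "norm (B (?a i) (?a (m - i))) \<le> norm x0 * q ^ Suc m"
      and "norm (L (B (?a i) (?a (m - i)))) \<le> norm (L x0) * q ^ Suc m" if "i \<le> m" for i
    proof -
      have IH: "norm (L (?a i)) \<le> norm (L x0) * q ^ i" "norm (?a (m - i)) \<le> norm x0 * q ^ (m - i)"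
          "norm (L (?a (m - i))) \<le> norm (L x0) * q ^ (m - i)"
        using less that Suc by auto
      have pw: "q ^ i * q ^ (m - i) = q ^ m"
        using that by (simp flip: power_add)
      have "K * norm (L (?a i)) * norm (?a (m - i)) \<le> K * (norm (L x0) * q ^ i) * (norm x0 * q ^ (m - i))"
        using IH K q0 by (intro mult_mono mult_left_mono) auto
      also have "\<dots> = norm x0 * (q * (q ^ i * q ^ (m - i)))"
        by (simp add: q_def mult_ac)
      finally show "norm (B (?a i) (?a (m - i))) \<le> norm x0 * q ^ Suc m"
        using bd order_trans by (fastforce simp: pw)
      have "K * norm (L (?a i)) * norm (L (?a (m - i))) \<le> K * (norm (L x0) * q ^ i) * (norm (L x0) * q ^ (m - i))"
        using IH K q0 by (intro mult_mono mult_left_mono) auto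
      also have "\<dots> = norm (L x0) * (q * (q ^ i * q ^ (m - i)))"
        by (simp add: q_def mult_ac)
      finally show "norm (L (B (?a i) (?a (m - i)))) \<le> norm (L x0) * q ^ Suc m"
        using Lbd order_trans by (fastforce simp: pw)
    qed
    note * = step[OF this(1)] step[OF this(2)]
    have "L (?a n) = (1 / real (Suc m)) *\<^sub>R (\<Sum>i\<le>m. L (B (?a i) (?a (m - i))))"
      using L by (simp only: Suc quad_coeff.simps linear_scale linear_sum)
    then show ?thesis
      using * by (simp add: Suc field_simps del: power_Suc of_nat_Suc)
  qed simp
qed

lemma quad_majorant_sums:
  assumes "0 \<le> t" "0 \<le> q" "t * q < (1::real)"
  shows "(\<lambda>n. t ^ n * (c * q ^ n)) sums (c / (1 - t * q))"
  using sums_mult[OF geometric_sums[of "t * q"], of c] assms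
  by (simp add: power_mult_distrib mult_ac)

text \<open>Termwise differentiation and the Cauchy product turn the recursion into the equation.
  For \<open>q = 0\<close> the division in \<open>ereal\<close> yields an infinite time of
  existence.\<close>

lemma quad_series_sol:
  fixes B :: "'a \<Rightarrow> 'a \<Rightarrow> 'a::banach"
  assumes B: "bounded_bilinear B" and q: "0 \<le> q"
    and bd: "\<And>n. norm (quad_coeff B x0 n) \<le> c * q ^ n"
  shows "quad_sol B x0 (1 / ereal q) (quad_series B x0)"
    and "t \<in> time_interval (1 / ereal q) \<Longrightarrow> norm (quad_series B x0 t) \<le> c / (1 - t * q)"
proof -
  let ?a = "quad_coeff B x0" and ?I = "time_interval (1 / ereal q)"
  have I: "t \<in> ?I \<longleftrightarrow> 0 \<le> t \<and> t * q < 1" for t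
    using q by (cases "q = 0") (auto simp: time_interval_def one_ereal_def field_simps)
  have ns: "summable (\<lambda>n. norm (t ^ n *\<^sub>R ?a n))" if "0 \<le> t" "t * q < 1" for t
    by (rule summable_comparison_test'[OF sums_summable[OF quad_majorant_sums[OF that(1) q that(2), of c]]])
      (use that bd in \<open>auto intro!: mult_left_mono\<close>)
  have c0: "0 \<le> c" using order_trans[OF norm_ge_zero bd[of 0]] by simp
  have deriv: "(quad_series B x0 has_vector_derivative B (quad_series B x0 t) (quad_series B x0 t)) (at t within ?I)"
    if t: "t \<in> ?I" for t
  proof -
    \<comment> \<open>A point strictly between \<open>t\<close> and the end of the interval; on
      \<open>{0..r}\<close> the differentiated series has a uniform majorant.\<close>
    obtain r where r: "t < r" "r * q < 1"
    proof (cases "q = 0")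
      case False
      then have "0 < q" and "t < 1 / q"
        using q I[of t] t by (auto simp: pos_less_divide_eq)
      then show ?thesis
        using that dense[of t "1 / q"] by (auto simp: pos_less_divide_eq)
    qed (use that[of "t + 1"] in auto)
    let ?S = "{0..r}"
    have S: "0 \<le> s" "s \<le> r" "s * q < 1" if "s \<in> ?S" for s
      using that r q le_less_trans[OF mult_right_mono[of s r q]] by auto
    define G where "G s = (\<Sum>n. (real n * s ^ (n - 1)) *\<^sub>R ?a n)" for s
    have r0: "0 < r" using r I[of t] t by simp
    have maj: "summable (\<lambda>n. real n * r ^ (n - 1) * (c * q ^ n))"
    proof -
      \<comment> \<open>Room beyond \<open>r\<close>, since \<open>termdiff_converges\<close> gives
        convergence of the differentiated series only strictly inside the radius.\<close>
      obtain r' where r': "r < r'" "r' * q < 1"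
      proof (cases "q = 0")
        case False
        then have "0 < q" and "r < 1 / q"
          using q r by (auto simp: pos_less_divide_eq)
        then show ?thesis
          using that dense[of r "1 / q"] by (auto simp: pos_less_divide_eq)
      qed (use that[of "r + 1"] in auto)
      have "summable (\<lambda>n. diffs (\<lambda>n. c * q ^ n) n * r ^ n)"
      proof (rule termdiff_converges)
        show "norm r < r'" using r' r0 by simp
        show "summable (\<lambda>n. c * q ^ n * x ^ n)" if "norm x < r'" for x
        proof (rule summable_norm_cancel, rule summable_comparison_test')
          show "summable (\<lambda>n. r' ^ n * (c * q ^ n))"
            using quad_majorant_sums[of r' q c] q r' r0 by (intro sums_summable) auto
          show "norm (norm (c * q ^ n * x ^ n)) \<le> r' ^ n * (c * q ^ n)" if "n \<ge> 0" for n
            using \<open>norm x < r'\<close> c0 q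
            by (auto simp: abs_mult power_abs mult_ac intro!: mult_left_mono power_mono)
        qed
      qed
      then have "summable (\<lambda>n. real (Suc n) * r ^ (Suc n - 1) * (c * q ^ Suc n))"
        by (simp add: diffs_def mult_ac)
      then show ?thesis by (subst (asm) summable_Suc_iff)
    qed
    have tm: "norm ((real n * s ^ (n - 1)) *\<^sub>R ?a n) \<le> real n * r ^ (n - 1) * (c * q ^ n)" if "s \<in> ?S" for s n
      using S[OF that] bd[of n] by (auto simp: abs_mult intro!: mult_mono power_mono)
    have ul: "uniform_limit ?S (\<lambda>n s. \<Sum>i<n. (real i * s ^ (i - 1)) *\<^sub>R ?a i) G sequentially"
      unfolding G_def by (rule Weierstrass_m_test[OF tm maj])
    obtain g where g: "\<And>s. s \<in> ?S \<Longrightarrow> (\<lambda>n. s ^ n *\<^sub>R ?a n) sums g s"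
      "\<And>s. s \<in> ?S \<Longrightarrow> (g has_derivative (\<lambda>h. h *\<^sub>R G s)) (at s within ?S)"
    proof -
      have "\<exists>g. \<forall>s\<in>?S. (\<lambda>n. s ^ n *\<^sub>R ?a n) sums g s \<and> (g has_derivative (\<lambda>h. h *\<^sub>R G s)) (at s within ?S)"
      proof (rule has_derivative_series)
        show "((\<lambda>s. s ^ n *\<^sub>R ?a n) has_derivative (\<lambda>h. h *\<^sub>R ((real n * s ^ (n - 1)) *\<^sub>R ?a n))) (at s within ?S)" for n s
          by (auto intro!: derivative_eq_intros simp: mult_ac)
        show "\<forall>\<^sub>F n in sequentially. \<forall>s\<in>?S. \<forall>h.
            norm ((\<Sum>i<n. h *\<^sub>R ((real i * s ^ (i - 1)) *\<^sub>R ?a i)) - h *\<^sub>R G s) \<le> e * norm h" if "e > 0" for e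
          using uniform_limitD[OF ul \<open>e > 0\<close>]
        proof (eventually_elim, intro ballI allI)
          fix n s and h :: real
          assume "\<forall>s\<in>?S. dist (\<Sum>i<n. (real i * s ^ (i - 1)) *\<^sub>R ?a i) (G s) < e" and "s \<in> ?S"
          then have "norm ((\<Sum>i<n. (real i * s ^ (i - 1)) *\<^sub>R ?a i) - G s) < e"
            by (metis dist_norm)
          then have "norm h * norm ((\<Sum>i<n. (real i * s ^ (i - 1)) *\<^sub>R ?a i) - G s) \<le> norm h * e"
            by (intro mult_left_mono) auto
          moreover have "(\<Sum>i<n. h *\<^sub>R ((real i * s ^ (i - 1)) *\<^sub>R ?a i)) - h *\<^sub>R G s
              = h *\<^sub>R ((\<Sum>i<n. (real i * s ^ (i - 1)) *\<^sub>R ?a i) - G s)"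
            by (simp only: scaleR_sum_right scaleR_diff_right)
          ultimately show "norm ((\<Sum>i<n. h *\<^sub>R ((real i * s ^ (i - 1)) *\<^sub>R ?a i)) - h *\<^sub>R G s) \<le> e * norm h"
            by (simp only: norm_scaleR real_norm_def mult.commute[of e])
        qed
        show "0 \<in> ?S" "(\<lambda>n. 0 ^ n *\<^sub>R ?a n) sums (\<Sum>n. 0 ^ n *\<^sub>R ?a n)"
          using r0 summable_sums[OF summable_norm_cancel[OF ns[of 0]]] by auto
      qed auto
      then obtain g where "\<forall>s\<in>?S. (\<lambda>n. s ^ n *\<^sub>R ?a n) sums g s
          \<and> (g has_derivative (\<lambda>h. h *\<^sub>R G s)) (at s within ?S)" ..
      then show ?thesis by (intro that[of g]) simp_all
    qed
    have gq: "g s = quad_series B x0 s" if "s \<in> ?S" for s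
      unfolding quad_series_def by (rule sums_unique[OF g(1)[OF that]])
    have tS: "t \<in> ?S" using r I[of t] t by simp
    have "G t = B (quad_series B x0 t) (quad_series B x0 t)"
    proof -
      have "summable (\<lambda>n. (real n * t ^ (n - 1)) *\<^sub>R ?a n)"
        by (rule summable_comparison_test'[OF maj]) (use tm[OF tS] in auto)
      then have "G t = (\<Sum>n. (real (Suc n) * t ^ (Suc n - 1)) *\<^sub>R ?a (Suc n))"
        unfolding G_def by (subst suminf_split_head) auto
      also have "\<dots> = (\<Sum>n. \<Sum>i\<le>n. B (t ^ i *\<^sub>R ?a i) (t ^ (n - i) *\<^sub>R ?a (n - i)))"
      proof (rule suminf_cong)
        fix n
        have "(real (Suc n) * t ^ (Suc n - 1)) *\<^sub>R ?a (Suc n) = (\<Sum>i\<le>n. t ^ n *\<^sub>R B (?a i) (?a (n - i)))"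
          by (simp add: scaleR_sum_right)
        also have "\<dots> = (\<Sum>i\<le>n. B (t ^ i *\<^sub>R ?a i) (t ^ (n - i) *\<^sub>R ?a (n - i)))"
          by (intro sum.cong) (auto simp: bounded_bilinear.scaleR_left[OF B] bounded_bilinear.scaleR_right[OF B] simp flip: power_add)
        finally show "(real (Suc n) * t ^ (Suc n - 1)) *\<^sub>R ?a (Suc n)
            = (\<Sum>i\<le>n. B (t ^ i *\<^sub>R ?a i) (t ^ (n - i) *\<^sub>R ?a (n - i)))" .
      qed
      also have "\<dots> = B (quad_series B x0 t) (quad_series B x0 t)"
        using bounded_bilinear_Cauchy_product_sums[OF B ns ns, of t t] I[of t] t
        unfolding quad_series_def by (simp add: sums_iff)
      finally show ?thesis .
    qed
    then have "(quad_series B x0 has_vector_derivative B (quad_series B x0 t) (quad_series B x0 t)) (at t within ?S)"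
      using has_derivative_transform[OF tS gq[symmetric] g(2)[OF tS]] by (simp add: has_vector_derivative_def)
    moreover have "at t within ?S = at t within ?I"
    proof (rule at_within_nhd)
      show "?S \<inter> {..<r} - {t} = ?I \<inter> {..<r} - {t}"
        using S(3) by (auto simp: I)
    qed (use r in auto)
    ultimately show ?thesis by simp
  qed
  have "quad_series B x0 0 = x0"
    using suminf_finite[of "{0}" "\<lambda>n. 0 ^ n *\<^sub>R ?a n"] by (simp add: quad_series_def)
  moreover have "0 < 1 / ereal q"
    using I[of 0] by (simp add: time_interval_def zero_ereal_def)
  ultimately show "quad_sol B x0 (1 / ereal q) (quad_series B x0)"
    using deriv by (simp add: quad_sol_def)
  show "norm (quad_series B x0 t) \<le> c / (1 - t * q)" if "t \<in> ?I"
  proof -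
    have tI: "0 \<le> t" "t * q < 1" using that I by auto
    have "norm (quad_series B x0 t) \<le> (\<Sum>n. norm (t ^ n *\<^sub>R ?a n))"
      unfolding quad_series_def by (rule summable_norm[OF ns[OF tI]])
    also have "\<dots> \<le> (\<Sum>n. t ^ n * (c * q ^ n))"
    proof (rule suminf_le)
      show "norm (t ^ n *\<^sub>R ?a n) \<le> t ^ n * (c * q ^ n)" for n
        using tI bd[of n] by (auto intro!: mult_left_mono)
    qed (use ns[OF tI] sums_summable[OF quad_majorant_sums[OF tI(1) q tI(2)]] in auto)
    also have "\<dots> = c / (1 - t * q)"
      by (rule sums_unique[OF quad_majorant_sums[OF tI(1) q tI(2)], symmetric])
    finally show ?thesis .
  qed
qed

text \<open>The factor \<open>L x\<close> measures \<open>x\<close> in a weaker norm in which the equation is well posed as well.\<close>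

locale tame_quadratic =
  fixes B :: "'a \<Rightarrow> 'a \<Rightarrow> 'a::{real_inner,banach}"
    and B' :: "'b \<Rightarrow> 'b \<Rightarrow> 'b::{real_inner,banach}"
    and L :: "'a \<Rightarrow> 'b" and K K' :: real
  assumes B: "bounded_bilinear B" and B': "bounded_bilinear B'" and L: "bounded_linear L"
    and K: "0 \<le> K" and K': "0 < K'"
    and B_bound: "\<And>x y. norm (B x y) \<le> K * norm (L x) * norm y"
    and B'_bound: "\<And>x y. norm (B' x y) \<le> K' * norm x * norm y"
    and L_B: "\<And>x y. L (B x y) = B' (L x) (L y)"
begin

text \<open>\<open>quad_coeff_bound\<close> works with one constant for both estimates, hence the
  maximum.\<close>

lemma local_solution: "\<exists>x. quad_sol B x0 (1 / ereal (max K K' * norm (L x0))) x"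
proof -
  have le: "norm (B x y) \<le> max K K' * norm (L x) * norm y"
    "norm (L (B x y)) \<le> max K K' * norm (L x) * norm (L y)" for x y
    by (auto simp: L_B intro!: mult_right_mono order_trans[OF B_bound] order_trans[OF B'_bound])
  have "norm (quad_coeff B x0 n) \<le> norm x0 * (max K K' * norm (L x0)) ^ n" for n
    using quad_coeff_bound[of B "max K K'" L x0 n, OF le] bounded_linear.linear[OF L] K by simp
  then show ?thesis
    using quad_series_sol(1)[OF B, of "max K K' * norm (L x0)" x0 "norm x0"] K K' by auto
qed

text \<open>\<open>L x\<close> solves the equation of \<open>B'\<close>, and uniqueness identifies
  it with the power series there, whose majorant involves \<open>K'\<close> alone. The bound may
  thus reach past the times where the series of \<open>x\<close> itself is controlled.\<close>

lemma weak_norm_bound: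
  assumes x: "quad_sol B x0 T x" and t: "t \<in> time_interval T" "t \<in> time_interval (1 / ereal (K' * norm (L x0)))"
  shows "norm (L (x t)) \<le> norm (L x0) / (1 - t * (K' * norm (L x0)))"
proof -
  let ?q = "K' * norm (L x0)"
  have "quad_sol B' (L x0) T (\<lambda>t. L (x t))"
    using x bounded_linear.has_vector_derivative[OF L] unfolding quad_sol_def by (auto simp: L_B[symmetric])
  moreover have cb: "norm (quad_coeff B' (L x0) n) \<le> norm (L x0) * ?q ^ n" for n
    using quad_coeff_bound[of B' K' "\<lambda>x. x" "L x0" n] B'_bound K' by (simp add: linear_id[unfolded id_def])
  ultimately have "L (x t) = quad_series B' (L x0) t"
    using quad_sol_unique[OF B' _ quad_series_sol(1)[OF B' _ cb] t] K' by simp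
  then show ?thesis
    using quad_series_sol(2)[OF B' _ cb t(2)] K' by simp
qed

lemma maximal_solution: "\<exists>x. quad_sol B x0 (quad_T_max B x0) x"
  using local_solution quad_sol_maximal[OF B] by blast

text \<open>As long as \<open>L x\<close> stays bounded, restarting advances the solution by a fixed time step.\<close>

theorem T_max_ge: "1 / ereal (K' * norm (L x0)) \<le> quad_T_max B x0"
proof (rule ccontr)
  let ?T = "quad_T_max B x0" and ?q = "K' * norm (L x0)"
  assume "\<not> 1 / ereal ?q \<le> ?T"
  then have lt: "?T < 1 / ereal ?q" by simp
  obtain x where x: "quad_sol B x0 ?T x" using maximal_solution by blast
  then have pos: "0 < ?T" by (simp add: quad_sol_def)
  then obtain T where T: "?T = ereal T" "0 < T"
    using lt by (cases ?T) auto
  have q0: "0 \<le> ?q" using K' by simp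
  have Tq: "T * ?q < 1"
  proof (cases "?q = 0")
    case False
    then have "0 < ?q" using q0 by linarith
    moreover have "T < 1 / ?q" using lt T False by (simp add: one_ereal_def)
    ultimately show ?thesis by (simp only: pos_less_divide_eq)
  qed (simp only: mult_zero_right zero_less_one)
  \<comment> \<open>\<open>R\<close> bounds the weak norm up to \<open>T\<close>. The summand 1 in
    the next definition keeps the time step \<open>1 / r\<close> finite when
    \<open>L x0 = 0\<close>.\<close>
  define R where "R = norm (L x0) / (1 - T * ?q)"
  define r where "r = max K K' * (R + 1)"
  have R0: "0 \<le> R" using Tq by (simp add: R_def)
  have r0: "0 < r" using R0 K K' by (auto simp: r_def intro!: mult_pos_pos)
  \<comment> \<open>At most half a step before \<open>T\<close>, so that one further step of length
    \<open>1 / r\<close> passes \<open>T\<close>.\<close>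
  define t where "t = max 0 (T - 1 / (2 * r))"
  have t: "0 \<le> t" "t < T" "T < t + 1 / r"
    using T r0 by (auto simp: t_def max_def field_simps)
  have tI: "t \<in> time_interval ?T" using t T by (simp add: time_interval_def)
  have tI': "t \<in> time_interval (1 / ereal ?q)"
    using tI lt by (auto simp: time_interval_def)
  have "norm (L (x t)) \<le> norm (L x0) / (1 - t * ?q)"
    by (rule weak_norm_bound[OF x tI tI'])
  also have "\<dots> \<le> R"
  proof -
    have "t * ?q \<le> T * ?q" using t q0 by (intro mult_right_mono) auto
    then show ?thesis
      unfolding R_def using Tq by (intro divide_left_mono mult_pos_pos) auto
  qed
  finally have "max K K' * norm (L (x t)) \<le> r"
    unfolding r_def using K by (intro mult_left_mono) auto
  then have "1 / ereal r \<le> 1 / ereal (max K K' * norm (L (x t)))"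
    using r0 K K' by (cases "max K K' * norm (L (x t)) = 0") (auto simp: one_ereal_def frac_le)
  moreover obtain y where y: "quad_sol B (x t) (1 / ereal (max K K' * norm (L (x t)))) y"
    using local_solution by blast
  ultimately have "quad_sol B (x t) (1 / ereal r) y"
    by (intro quad_sol_restrict[OF y]) (use r0 in \<open>auto simp: one_ereal_def\<close>)
  then obtain z where "quad_sol B x0 (ereal t + 1 / ereal r) z"
    using quad_sol_glue[OF B x tI] by blast
  then have "ereal t + 1 / ereal r \<le> ?T" by (rule quad_sol_le_T_max)
  then show False using t T r0 by (simp add: one_ereal_def)
qed

text \<open>The solution restarted at time \<open>t\<close> lives at least
  \<open>1 / (K' * norm (L (x t)))\<close>, and by gluing it cannot outlive the maximal
  solution.\<close>

corollary blowup_rate: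
  assumes x: "quad_sol B x0 (quad_T_max B x0) x" and fin: "quad_T_max B x0 < \<infinity>"
    and t: "t \<in> time_interval (quad_T_max B x0)"
  shows "norm (L (x t)) \<ge> 1 / (K' * (real_of_ereal (quad_T_max B x0) - t))"
proof -
  let ?T = "quad_T_max B x0"
  obtain y where "quad_sol B (x t) (quad_T_max B (x t)) y"
    using maximal_solution by blast
  then obtain z where "quad_sol B x0 (ereal t + quad_T_max B (x t)) z"
    using quad_sol_glue[OF B x t] by blast
  then have "ereal t + quad_T_max B (x t) \<le> ?T" by (rule quad_sol_le_T_max)
  then have le: "ereal t + 1 / ereal (K' * norm (L (x t))) \<le> ?T"
    using T_max_ge[of "x t"] by (meson add_left_mono order_trans)
  obtain T where T: "?T = ereal T" "t < T"
    using fin t by (cases ?T) (auto simp: time_interval_def)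
  \<comment> \<open>Otherwise the quotient in \<open>ereal\<close> would be infinite, and with it
    the maximal time.\<close>
  have "L (x t) \<noteq> 0"
    using le T by (auto simp flip: zero_ereal_def simp: divide_ereal_def)
  then show ?thesis
    using le T K' by (simp add: one_ereal_def field_simps)
qed

end

section \<open>Geometry of the frequency set\<close>

definition shell_pm :: "nat \<Rightarrow> (int^3) set" where
  "shell_pm n = M_shell n \<union> uminus ` M_shell n"

text \<open>On the \<open>n\<close>-th shell \<open>\<bar>rvec k \<bullet> rvec sigma\<bar>\<close>
  is \<open>3 * 2 ^ n\<close>, so for \<open>k\<close> in \<open>M_freq\<close> there is only one
  choice; elsewhere the value is arbitrary.\<close>

definition lev :: "int^3 \<Rightarrow> nat" where
  "lev k = (SOME n. k \<in> shell_pm n)"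

lemma rvec_add: "rvec (h + j) = rvec h + rvec j"
  and rvec_uminus: "rvec (- h) = - rvec h"
  and rvec_diff: "rvec (h - j) = rvec h - rvec j"
  and rvec_zero: "rvec 0 = 0"
  by (auto simp: rvec_def vec_eq_iff)

lemma M_freq_Union: "M_freq = (\<Union>n. shell_pm n)"
  by (auto simp: M_freq_def M_plus_def shell_pm_def)

lemma mem_shell_lev: "k \<in> M_freq \<Longrightarrow> k \<in> shell_pm (lev k)"
  unfolding M_freq_Union lev_def by (auto intro: someI)

lemma M_freq_uminus [simp]: "- k \<in> M_freq \<longleftrightarrow> k \<in> M_freq"
  by (force simp: M_freq_def image_iff)

lemma perms_finite_card:
  fixes v :: "'a^3"
  shows "finite (perms v) \<and> card (perms v) \<le> 6"
proof -
  have *: "perms v = (\<lambda>p. \<chi> i. v $ p i) ` {p. p permutes (UNIV :: 3 set)}"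
    by (auto simp: perms_def)
  have fin: "finite {p. p permutes (UNIV :: 3 set)}"
    by (simp add: finite_permutations)
  have "card {p. p permutes (UNIV :: 3 set)} = fact 3"
    by (rule card_permutations) auto
  then show ?thesis
    unfolding * using card_image_le[OF fin] fin by (simp add: fact_numeral)
qed

text \<open>24 counts two signs, at most two generating vectors and six permutations of
  each.\<close>

lemma shell_finite_card: "finite (shell_pm n) \<and> card (shell_pm n) \<le> 24"
proof -
  have "finite (M_shell n) \<and> card (M_shell n) \<le> 12"
  proof (cases "even n")
    case False
    have "card (perms (freq_h (n div 2)) \<union> perms (freq_j (n div 2))) \<le> 6 + 6"
      by (rule order_trans[OF card_Un_le add_mono]) (simp_all add: perms_finite_card)
    then show ?thesis using False by (simp add: M_shell_def perms_finite_card)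
  qed (use perms_finite_card[of "freq_k (n div 2)"] in \<open>simp add: M_shell_def\<close>)
  moreover from this have "card (uminus ` M_shell n) \<le> 12"
    using card_image_le[of "M_shell n" uminus] by simp
  ultimately show ?thesis
    unfolding shell_pm_def using card_Un_le[of "M_shell n" "uminus ` M_shell n"] by auto
qed

section \<open>Projections and lengths of the frequencies\<close>

lemma perms_rvec:
  assumes "k \<in> perms v"
  shows "rvec k \<bullet> rvec sigma = rvec v \<bullet> rvec sigma" and "rvec k \<bullet> rvec k = rvec v \<bullet> rvec v"
proof -
  obtain p where p: "p permutes (UNIV :: 3 set)" "k = (\<chi> i. v $ p i)"
    using assms by (auto simp: perms_def)
  have s: "rvec sigma $ i = 1" for i
    using exhaust_3[of i] by (auto simp: rvec_def sigma_def)
  show "rvec k \<bullet> rvec sigma = rvec v \<bullet> rvec sigma"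
    using sum.permute[OF p(1), of "\<lambda>i. real_of_int (v $ i)"]
    by (simp add: inner_vec_def s) (simp add: rvec_def p(2) o_def)
  show "rvec k \<bullet> rvec k = rvec v \<bullet> rvec v"
    using sum.permute[OF p(1), of "\<lambda>i. real_of_int (v $ i) * real_of_int (v $ i)"]
    by (simp add: inner_vec_def rvec_def p(2) o_def)
qed

lemma freq_rvec:
  "rvec (freq_k m) \<bullet> rvec sigma = 3 * 2 ^ (2 * m)"
  "rvec (freq_k m) \<bullet> rvec (freq_k m) = 3 * 4 ^ (2 * m) + 2 * 3 ^ (2 * m)"
  "rvec (freq_h m) \<bullet> rvec sigma = 3 * 2 ^ (2 * m + 1)"
  "rvec (freq_h m) \<bullet> rvec (freq_h m) = 3 * 4 ^ (2 * m + 1) + 2 * 3 ^ (2 * m + 1)"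
  "rvec (freq_j m) \<bullet> rvec sigma = 3 * 2 ^ (2 * m + 1)"
  "rvec (freq_j m) \<bullet> rvec (freq_j m) = 3 * 4 ^ (2 * m + 1) + 2 * 3 ^ (2 * m + 1)"
proof -
  have e: "(4::real) ^ (2 * m) = 2 ^ (2 * m) * 2 ^ (2 * m)" "(3::real) ^ (2 * m) = 3 ^ m * 3 ^ m"
    by (simp_all add: power_mult flip: power_mult_distrib power_add mult_2)
  show "rvec (freq_k m) \<bullet> rvec sigma = 3 * 2 ^ (2 * m)"
    "rvec (freq_h m) \<bullet> rvec sigma = 3 * 2 ^ (2 * m + 1)"
    "rvec (freq_j m) \<bullet> rvec sigma = 3 * 2 ^ (2 * m + 1)"
    by (simp_all add: inner_vec_def rvec_def sum_3 freq_k_def freq_h_def freq_j_def sigma_def)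
  show "rvec (freq_k m) \<bullet> rvec (freq_k m) = 3 * 4 ^ (2 * m) + 2 * 3 ^ (2 * m)"
    unfolding e by (simp add: inner_vec_def rvec_def sum_3 freq_k_def sigma_def algebra_simps)
  show "rvec (freq_h m) \<bullet> rvec (freq_h m) = 3 * 4 ^ (2 * m + 1) + 2 * 3 ^ (2 * m + 1)"
    "rvec (freq_j m) \<bullet> rvec (freq_j m) = 3 * 4 ^ (2 * m + 1) + 2 * 3 ^ (2 * m + 1)"
    unfolding power_add e by (simp_all add: inner_vec_def rvec_def sum_3 freq_h_def freq_j_def sigma_def algebra_simps)
qed

text \<open>The part orthogonal to \<open>sigma\<close> is \<open>3 ^ m\<close> times a vector of
  squared length 2 at even and 6 at odd levels. Both parities give \<open>2 * 3 ^ n\<close>, while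
  the part along \<open>sigma\<close> contributes \<open>3 * 4 ^ n\<close>.\<close>

lemma M_shell_rvec:
  assumes "k \<in> M_shell n"
  shows "rvec k \<bullet> rvec sigma = 3 * 2 ^ n" "rvec k \<bullet> rvec k = 3 * 4 ^ n + 2 * 3 ^ n"
proof -
  have "rvec k \<bullet> rvec sigma = 3 * 2 ^ n \<and> rvec k \<bullet> rvec k = 3 * 4 ^ n + 2 * 3 ^ n"
  proof (cases "even n")
    case True
    then obtain m where "n = 2 * m" by blast
    then show ?thesis
      using assms by (auto simp: M_shell_def perms_rvec freq_rvec)
  next
    case False
    then obtain m where "n = 2 * m + 1" by (elim oddE)
    then show ?thesis
      using assms freq_rvec[of m] by (auto simp: M_shell_def perms_rvec)
  qed
  then show "rvec k \<bullet> rvec sigma = 3 * 2 ^ n" "rvec k \<bullet> rvec k = 3 * 4 ^ n + 2 * 3 ^ n"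
    by auto
qed

lemma abs_rvec_sigma: "k \<in> M_freq \<Longrightarrow> \<bar>rvec k \<bullet> rvec sigma\<bar> = 3 * 2 ^ lev k"
  using mem_shell_lev[of k] by (auto simp: shell_pm_def M_shell_rvec rvec_uminus)

lemma norm_rvec_sq: "k \<in> M_freq \<Longrightarrow> (norm (rvec k))\<^sup>2 = 3 * 4 ^ lev k + 2 * 3 ^ lev k"
  using mem_shell_lev[of k] by (auto simp: shell_pm_def M_shell_rvec rvec_uminus power2_norm_eq_inner)

lemma norm_rvec_pos: "k \<in> M_freq \<Longrightarrow> 0 < norm (rvec k)"
proof -
  assume "k \<in> M_freq"
  then have "0 < (norm (rvec k))\<^sup>2"
    by (simp add: norm_rvec_sq add_pos_pos)
  then show ?thesis by simp
qed

lemma zero_notin_M_freq: "0 \<notin> M_freq"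
  using norm_rvec_pos[of 0] by (auto simp: rvec_zero)

text \<open>For \<open>a < b\<close> the sum lies strictly between \<open>2 ^ b\<close> and
  \<open>2 ^ Suc b\<close>, where there is no power of two.\<close>

lemma two_power_add_eq: "(2::real) ^ a + 2 ^ b = 2 ^ c \<Longrightarrow> a = b \<and> c = Suc b"
proof (induction a b rule: linorder_wlog)
  case (le a b)
  show ?case
  proof (cases "a = b")
    case True
    then have "(2::real) ^ Suc b = 2 ^ c" using le by simp
    then show ?thesis using True by (subst (asm) power_inject_exp) auto
  next
    case False
    then have "(2::real) ^ a < 2 ^ b" using le by simp
    then have "(2::real) ^ b < 2 ^ c" "(2::real) ^ c < 2 ^ Suc b"
      using le.prems zero_less_power[of "2::real" a] unfolding power_Suc by linarith+
    then have "b < c" "c < Suc b"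
      using power_less_imp_less_exp[of "2::real" b c] power_less_imp_less_exp[of "2::real" c "Suc b"]
      by (simp_all del: power_Suc)
    then show ?thesis by simp
  qed
qed (auto simp: add.commute)

text \<open>Projecting \<open>h + j = k\<close> onto \<open>sigma\<close> gives \<open>\<plusminus> 2 ^ a \<plusminus> 2 ^ b = \<plusminus> 2 ^ c\<close>, so only neighbouring shells interact.\<close>

lemma lev_triad:
  assumes "h \<in> M_freq" "j \<in> M_freq" "h + j \<in> M_freq"
  shows "lev h \<le> Suc (lev (h + j))" "lev (h + j) \<le> Suc (lev h)" "lev (h + j) \<le> Suc (lev j)"
proof -
  have *: "rvec (h + j) \<bullet> rvec sigma = rvec h \<bullet> rvec sigma + rvec j \<bullet> rvec sigma"
    by (simp add: rvec_add inner_add_left)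
  have "(2::real) ^ lev h + 2 ^ lev j = 2 ^ lev (h + j) \<or> (2::real) ^ lev h + 2 ^ lev (h + j) = 2 ^ lev j
      \<or> (2::real) ^ lev j + 2 ^ lev (h + j) = 2 ^ lev h"
    using assms[THEN abs_rvec_sigma] * by linarith
  then show "lev h \<le> Suc (lev (h + j))" "lev (h + j) \<le> Suc (lev h)" "lev (h + j) \<le> Suc (lev j)"
    by (auto dest!: two_power_add_eq)
qed

section \<open>Interacting frequencies\<close>

definition nbr :: "int^3 \<Rightarrow> (int^3) set" where
  "nbr k = {h \<in> M_freq. k - h \<in> M_freq}"

text \<open>A relaxation of \<open>nbr\<close> that is symmetric on \<open>M_freq\<close>: one count
  bounds both the \<open>h\<close> that feed a given \<open>k\<close> and the \<open>k\<close> that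
  are fed by a given \<open>h\<close>.\<close>

definition near :: "int^3 \<Rightarrow> (int^3) set" where
  "near k = {h \<in> M_freq. lev h \<le> Suc (lev k) \<and> lev k \<le> Suc (lev h)}"

text \<open>Three levels with at most 24 frequencies each. At level 0 the natural subtraction
  \<open>lev k - 1\<close> merely repeats a level.\<close>

lemma near_finite_card: "finite (near k) \<and> card (near k) \<le> 72"
proof -
  have sub: "near k \<subseteq> (\<Union>n\<in>{lev k - 1, lev k, Suc (lev k)}. shell_pm n)"
  proof
    fix h assume h: "h \<in> near k"
    then have "lev h \<in> {lev k - 1, lev k, Suc (lev k)}" by (auto simp: near_def)
    then show "h \<in> (\<Union>n\<in>{lev k - 1, lev k, Suc (lev k)}. shell_pm n)"
      using h mem_shell_lev[of h] unfolding near_def by blast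
  qed
  have fin: "finite (\<Union>n\<in>{lev k - 1, lev k, Suc (lev k)}. shell_pm n)"
    using shell_finite_card by blast
  have "card (\<Union>n\<in>{lev k - 1, lev k, Suc (lev k)}. shell_pm n)
      \<le> (\<Sum>n\<in>{lev k - 1, lev k, Suc (lev k)}. card (shell_pm n))"
    by (rule card_UN_le) auto
  also have "\<dots> \<le> (\<Sum>n\<in>{lev k - 1, lev k, Suc (lev k)}. 24)"
    by (rule sum_mono) (use shell_finite_card in auto)
  also have "\<dots> \<le> 72"
    by (simp add: card_insert_if)
  finally show ?thesis
    using finite_subset[OF sub fin] card_mono[OF fin sub] by linarith
qed

lemma nbr_subset_near: "k \<in> M_freq \<Longrightarrow> nbr k \<subseteq> near k"
proof
  fix h assume "k \<in> M_freq" "h \<in> nbr k"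
  then show "h \<in> near k"
    using lev_triad[of h "k - h"] by (simp add: nbr_def near_def)
qed

lemma nbr_imp_near: "k \<in> M_freq \<Longrightarrow> h \<in> nbr k \<Longrightarrow> k \<in> near h"
  using nbr_subset_near[of k] by (auto simp: near_def)

lemma nbr_finite_card: "k \<in> M_freq \<Longrightarrow> finite (nbr k) \<and> card (nbr k) \<le> 72"
  using finite_subset[OF nbr_subset_near] card_mono[OF _ nbr_subset_near] near_finite_card
  by (meson order_trans)

lemma nbr_minus: "h \<in> nbr k \<longleftrightarrow> k - h \<in> nbr k"
  by (auto simp: nbr_def)

lemma nbr_uminus: "nbr (- k) = uminus ` nbr k"
proof -
  have "h \<in> nbr (- k) \<longleftrightarrow> - h \<in> nbr k" for h
    using M_freq_uminus[of h] M_freq_uminus[of "- k - h"] by (simp add: nbr_def add.commute)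
  then show ?thesis by (force simp: image_iff)
qed

section \<open>The directions \<open>v_dir\<close>\<close>

lemma perp_sigma_inner:
  assumes "k \<in> M_freq"
  shows "perp_sigma k \<bullet> rvec k = 0"
    and "perp_sigma k \<bullet> rvec sigma = (norm (perp_sigma k))\<^sup>2"
    and "(norm (perp_sigma k))\<^sup>2 = 6 * 3 ^ lev k / (3 * 4 ^ lev k + 2 * 3 ^ lev k)"
proof -
  let ?N = "3 * 4 ^ lev k + 2 * 3 ^ lev k :: real"
  have N: "rvec k \<bullet> rvec k = ?N" "0 < ?N"
    using norm_rvec_sq[OF assms] by (auto simp: power2_norm_eq_inner add_pos_pos)
  have s: "rvec sigma \<bullet> rvec sigma = 3"
    by (simp add: inner_vec_def rvec_def sum_3 sigma_def)
  let ?q = "(rvec k \<bullet> rvec sigma) / (norm (rvec k))\<^sup>2"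
  show o: "perp_sigma k \<bullet> rvec k = 0"
    using norm_rvec_pos[OF assms]
    by (simp add: perp_sigma_def inner_diff_left dot_square_norm inner_commute[of "rvec sigma"])
  have "perp_sigma k \<bullet> perp_sigma k = perp_sigma k \<bullet> rvec sigma - ?q * (perp_sigma k \<bullet> rvec k)"
    by (subst (2) perp_sigma_def) (simp add: inner_diff_right)
  then show e: "perp_sigma k \<bullet> rvec sigma = (norm (perp_sigma k))\<^sup>2"
    by (simp add: o power2_norm_eq_inner)
  have "perp_sigma k \<bullet> rvec sigma = 3 - (rvec k \<bullet> rvec sigma)\<^sup>2 / ?N"
    by (simp add: perp_sigma_def inner_diff_left s norm_rvec_sq[OF assms] power2_eq_square[of "rvec k \<bullet> rvec sigma"])
  also have "(rvec k \<bullet> rvec sigma)\<^sup>2 = (3 * 2 ^ lev k)\<^sup>2"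
    using abs_rvec_sigma[OF assms] by (metis power2_abs)
  also have "\<dots> = 9 * 4 ^ lev k"
    by (simp add: power_mult_distrib) (simp add: power2_eq_square flip: power_mult_distrib)
  \<comment> \<open>The terms of order \<open>4 ^ lev k\<close> in the numerator cancel. This makes
    the squared length of \<open>perp_sigma k\<close> of order
    \<open>(3 / 4) ^ lev k\<close>.\<close>
  also have "3 - 9 * 4 ^ lev k / ?N = 6 * 3 ^ lev k / ?N"
    using N(2) by (simp add: field_simps)
  finally show "(norm (perp_sigma k))\<^sup>2 = 6 * 3 ^ lev k / ?N"
    using e by simp
qed

lemma perp_sigma_nonzero: "k \<in> M_freq \<Longrightarrow> 0 < norm (perp_sigma k)"
proof -
  assume k: "k \<in> M_freq"
  have "0 < (norm (perp_sigma k))\<^sup>2"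
    unfolding perp_sigma_inner(3)[OF k] by (intro divide_pos_pos mult_pos_pos add_pos_pos) auto
  then show ?thesis by simp
qed

lemma norm_v_dir: "k \<in> M_freq \<Longrightarrow> norm (v_dir k) = 1"
  using perp_sigma_nonzero[of k] by (simp add: v_dir_def)

lemma v_dir_uminus [simp]: "v_dir (- k) = v_dir k"
  by (simp add: v_dir_def perp_sigma_def rvec_uminus)

lemma v_dir_orthogonal: "k \<in> M_freq \<Longrightarrow> v_dir k \<bullet> rvec k = 0"
  by (simp add: v_dir_def perp_sigma_inner)

text \<open>The inner product is the length of \<open>perp_sigma k\<close>; dropping
  \<open>2 * 3 ^ lev k\<close> from the denominator of its square leaves
  \<open>2 * (3 / 4) ^ lev k\<close>.\<close>

lemma v_dir_sigma:
  assumes "k \<in> M_freq"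
  shows "\<bar>v_dir k \<bullet> rvec sigma\<bar> * 2 ^ lev k \<le> sqrt 2 * sqrt (3 ^ lev k)"
proof -
  have "v_dir k \<bullet> rvec sigma = norm (perp_sigma k)"
    using perp_sigma_nonzero[OF assms] by (simp add: v_dir_def perp_sigma_inner(2)[OF assms] power2_eq_square)
  moreover have "(norm (perp_sigma k) * 2 ^ lev k)\<^sup>2 \<le> (sqrt 2 * sqrt (3 ^ lev k))\<^sup>2"
  proof -
    have "(norm (perp_sigma k))\<^sup>2 \<le> 6 * 3 ^ lev k / (3 * 4 ^ lev k)"
      unfolding perp_sigma_inner(3)[OF assms] by (intro divide_left_mono mult_pos_pos add_pos_pos) auto
    then have "(norm (perp_sigma k))\<^sup>2 * 4 ^ lev k \<le> 2 * 3 ^ lev k"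
      by (simp add: field_simps)
    moreover have "((2::real) ^ lev k)\<^sup>2 = 4 ^ lev k"
      by (simp add: power2_eq_square flip: power_mult_distrib)
    ultimately show ?thesis by (simp add: power_mult_distrib)
  qed
  ultimately show ?thesis
    using power2_le_imp_le[of "norm (perp_sigma k) * 2 ^ lev k" "sqrt 2 * sqrt (3 ^ lev k)"] by simp
qed

text \<open>The gain over the trivial bound \<open>norm (rvec k)\<close>, which is of order \<open>2 ^ lev h\<close>, comes from
  \<open>v_dir h\<close> being almost orthogonal to \<open>sigma\<close>, the direction in which \<open>k\<close> is large.\<close>

lemma v_dir_advection_bound:
  assumes k: "k \<in> M_freq" and h: "h \<in> nbr k"
  shows "\<bar>v_dir h \<bullet> rvec k\<bar> \<le> 6 * sqrt (3 ^ lev h)"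
proof -
  have hM: "h \<in> M_freq" using h by (simp add: nbr_def)
  have lv: "lev k \<le> Suc (lev h)" using nbr_subset_near[OF k] h by (auto simp: near_def)
  \<comment> \<open>The component of \<open>k\<close> orthogonal to \<open>sigma\<close>. It meets
    \<open>v_dir h\<close> without any gain, but its squared length is only
    \<open>2 * 3 ^ lev k\<close>.\<close>
  define y where "y = rvec k - ((rvec k \<bullet> rvec sigma) / 3) *\<^sub>R rvec sigma"
  have s: "rvec sigma \<bullet> rvec sigma = 3"
    by (simp add: inner_vec_def rvec_def sum_3 sigma_def)
  have "y \<bullet> y = rvec k \<bullet> rvec k - (rvec k \<bullet> rvec sigma)\<^sup>2 / 3"
    by (simp add: y_def inner_diff_left inner_diff_right s inner_commute power2_eq_square field_simps)
  also have "(rvec k \<bullet> rvec sigma)\<^sup>2 = (3 * 2 ^ lev k)\<^sup>2"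
    using abs_rvec_sigma[OF k] by (metis power2_abs)
  also have "\<dots> = 9 * 4 ^ lev k"
    by (simp add: power_mult_distrib) (simp add: power2_eq_square flip: power_mult_distrib)
  finally have "(norm y)\<^sup>2 = 2 * 3 ^ lev k"
    using norm_rvec_sq[OF k] by (simp add: power2_norm_eq_inner)
  then have ny: "norm y = sqrt (2 * 3 ^ lev k)"
    using real_sqrt_unique[of "norm y"] by simp
  have dec: "rvec k = ((rvec k \<bullet> rvec sigma) / 3) *\<^sub>R rvec sigma + y" by (simp add: y_def)
  have "v_dir h \<bullet> rvec k = ((rvec k \<bullet> rvec sigma) / 3) * (v_dir h \<bullet> rvec sigma) + v_dir h \<bullet> y"
    by (subst dec) (simp add: inner_add_right)
  also have "\<bar>\<dots>\<bar> \<le> \<bar>(rvec k \<bullet> rvec sigma) / 3\<bar> * \<bar>v_dir h \<bullet> rvec sigma\<bar> + \<bar>v_dir h \<bullet> y\<bar>"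
    by (metis abs_mult abs_triangle_ineq)
  also have "\<dots> \<le> 2 ^ Suc (lev h) * \<bar>v_dir h \<bullet> rvec sigma\<bar> + sqrt (2 * 3 ^ Suc (lev h))"
  proof (intro add_mono mult_right_mono)
    have "\<bar>(rvec k \<bullet> rvec sigma) / 3\<bar> = 2 ^ lev k" using abs_rvec_sigma[OF k] by simp
    also have "\<dots> \<le> (2::real) ^ Suc (lev h)" using lv by (intro power_increasing) auto
    finally show "\<bar>(rvec k \<bullet> rvec sigma) / 3\<bar> \<le> 2 ^ Suc (lev h)" .
    have "\<bar>v_dir h \<bullet> y\<bar> \<le> norm y"
      using Cauchy_Schwarz_ineq2[of "v_dir h" y] norm_v_dir[OF hM] by simp
    also have "(3::real) ^ lev k \<le> 3 ^ Suc (lev h)" using lv by (intro power_increasing) auto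
    then have "norm y \<le> sqrt (2 * 3 ^ Suc (lev h))" unfolding ny by simp
    finally show "\<bar>v_dir h \<bullet> y\<bar> \<le> sqrt (2 * 3 ^ Suc (lev h))" .
  qed auto
  also have "\<dots> \<le> 2 * (sqrt 2 * sqrt (3 ^ lev h)) + sqrt 6 * sqrt (3 ^ lev h)"
    using v_dir_sigma[OF hM] by (simp add: real_sqrt_mult[symmetric] mult_ac)
  also have "\<dots> \<le> 6 * sqrt (3 ^ lev h)"
  proof -
    have "2 * sqrt 2 + sqrt 6 \<le> (6::real)"
      using real_le_lsqrt[of "3 / 2" 2] real_le_lsqrt[of 3 6] by (simp add: power2_eq_square)
    then show ?thesis
      using mult_right_mono[of "2 * sqrt 2 + sqrt 6" 6 "sqrt (3 ^ lev h)"] by (simp add: algebra_simps)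
  qed
  finally show ?thesis .
qed

section \<open>Sobolev weights\<close>

text \<open>\<open>Hdot_weight s u k\<close> is \<open>wt s k\<close> times a squared norm, so the
  coefficients themselves are scaled by \<open>wt (s / 2)\<close>. As \<open>0 powr s = 0\<close>
  even for \<open>s = 0\<close>, \<open>wt 0\<close> is 1 only away from the zero frequency.\<close>

definition wt :: "real \<Rightarrow> int^3 \<Rightarrow> real" where
  "wt s k = (4 * pi\<^sup>2 * (norm (rvec k))\<^sup>2) powr s"

lemma wt_uminus [simp]: "wt s (- k) = wt s k"
  by (simp add: wt_def rvec_uminus)

lemma wt_add: "wt s k * wt r k = wt (s + r) k"
  by (simp add: wt_def powr_add)

lemma wt_nonneg: "0 \<le> wt s k" by (simp add: wt_def)

lemma wt_base_ge: "k \<in> M_freq \<Longrightarrow> 4 ^ lev k \<le> 4 * pi\<^sup>2 * (norm (rvec k))\<^sup>2"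
proof -
  assume k: "k \<in> M_freq"
  have "1 \<le> pi\<^sup>2" using pi_ge_two by (simp add: one_le_power)
  then have "1 * (4 ^ lev k) \<le> (4 * pi\<^sup>2) * (norm (rvec k))\<^sup>2"
    unfolding norm_rvec_sq[OF k] by (intro mult_mono) auto
  then show ?thesis by simp
qed

lemma wt_pos: "k \<in> M_freq \<Longrightarrow> 0 < wt s k"
  using norm_rvec_pos by (simp add: wt_def)

lemma wt_0: "k \<in> M_freq \<Longrightarrow> wt 0 k = 1"
  using norm_rvec_pos by (simp add: wt_def)

lemma wt_mono: "k \<in> M_freq \<Longrightarrow> s \<le> r \<Longrightarrow> wt s k \<le> wt r k"
  unfolding wt_def by (intro powr_mono order_trans[OF one_le_power wt_base_ge]) auto

lemma s_crit_pos: "0 < s_crit"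
  by (simp add: s_crit_def)

text \<open>\<open>s_crit\<close> is the logarithm of 3 to base 4, so raising
  \<open>wt_base_ge\<close> to this power turns \<open>4 ^ lev k\<close> into
  \<open>3 ^ lev k\<close>.\<close>

lemma wt_crit_ge: "k \<in> M_freq \<Longrightarrow> 3 ^ lev k \<le> wt s_crit k"
proof -
  assume k: "k \<in> M_freq"
  have "ln (4::real) = 2 * ln 2" using ln_realpow[of "2::real" 2] by simp
  then have "(4::real) powr s_crit = 3"
    by (simp add: powr_def s_crit_def)
  then have "(4 ^ lev k :: real) powr s_crit = 3 ^ lev k"
    by (metis powr_powr powr_realpow mult.commute zero_less_numeral)
  then show ?thesis
    using powr_mono2[of s_crit "4 ^ lev k"] wt_base_ge[OF k] s_crit_pos by (simp add: wt_def)
qed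

lemma wt_crit_half_ge: "k \<in> M_freq \<Longrightarrow> sqrt (3 ^ lev k) \<le> wt (s_crit / 2) k"
proof -
  assume k: "k \<in> M_freq"
  have "wt (s_crit / 2) k ^ 2 = wt s_crit k" by (simp add: power2_eq_square wt_add)
  then show ?thesis
    using wt_crit_ge[OF k] wt_nonneg by (metis real_sqrt_le_iff real_sqrt_unique)
qed

text \<open>The level of \<open>k\<close> exceeds that of its neighbour \<open>h\<close> by at most
  one, so its squared length exceeds by a factor of at most 4.\<close>

lemma wt_ratio:
  assumes k: "k \<in> M_freq" and h: "h \<in> nbr k" and s: "0 \<le> s"
  shows "wt s k \<le> 4 powr s * wt s h"
proof -
  have hM: "h \<in> M_freq" and lv: "lev k \<le> Suc (lev h)"
    using nbr_subset_near[OF k] h by (auto simp: near_def nbr_def)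
  have "(4::real) ^ lev k \<le> 4 * 4 ^ lev h"
    using power_increasing[OF lv, of "4::real"] by simp
  moreover have "(3::real) ^ lev k \<le> 4 * 3 ^ lev h"
    using power_increasing[OF lv, of "3::real"] zero_le_power[of "3::real" "lev h"]
    by (simp only: power_Suc) linarith
  ultimately have "(norm (rvec k))\<^sup>2 \<le> 4 * (norm (rvec h))\<^sup>2"
    by (simp add: norm_rvec_sq k hM)
  then have "4 * pi\<^sup>2 * (norm (rvec k))\<^sup>2 \<le> 4 * (4 * pi\<^sup>2 * (norm (rvec h))\<^sup>2)"
    by simp
  then have "wt s k \<le> (4 * (4 * pi\<^sup>2 * (norm (rvec h))\<^sup>2)) powr s"
    unfolding wt_def using s by (intro powr_mono2) auto
  also have "\<dots> = 4 powr s * wt s h"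
    unfolding wt_def by (rule powr_mult)
  finally show ?thesis .
qed

text \<open>A level contributes at most 24 terms of size at most \<open>(1 / 3) ^ n\<close>, which
  leaves a geometric series. Combined with square summability this gives absolutely convergent
  Fourier series from order \<open>s_crit\<close> on.\<close>

lemma wt_neg_summable: "wt (- s_crit) summable_on M_freq"
proof (rule nonneg_bdd_above_summable_on)
  show "bdd_above (sum (wt (- s_crit)) ` {F. F \<subseteq> M_freq \<and> finite F})"
  proof (rule bdd_aboveI, safe)
    fix F assume F: "F \<subseteq> M_freq" "finite F"
    have le: "wt (- s_crit) k \<le> (1 / 3) ^ lev k" if "k \<in> F" for k
    proof -
      have "k \<in> M_freq" using that F by auto
      then have "1 / wt s_crit k \<le> 1 / 3 ^ lev k"
        using wt_crit_ge by (intro divide_left_mono mult_pos_pos) (auto simp: wt_pos)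
      then show ?thesis by (simp add: wt_def powr_minus_divide power_divide)
    qed
    have "sum (wt (- s_crit)) F \<le> (\<Sum>k\<in>F. (1 / 3) ^ lev k)"
      by (rule sum_mono[OF le])
    also have "\<dots> = (\<Sum>n\<in>lev ` F. \<Sum>k\<in>{k \<in> F. lev k = n}. (1 / 3) ^ lev k)"
      using F by (subst sum.group) auto
    also have "\<dots> \<le> (\<Sum>n\<in>lev ` F. 24 * (1 / 3) ^ n)"
    proof (rule sum_mono)
      fix n
      have "{k \<in> F. lev k = n} \<subseteq> shell_pm n" using F mem_shell_lev by auto
      then have "card {k \<in> F. lev k = n} \<le> 24"
        using shell_finite_card card_mono order_trans by blast
      then show "(\<Sum>k\<in>{k \<in> F. lev k = n}. (1 / 3) ^ lev k) \<le> 24 * (1 / 3 :: real) ^ n"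
        by (simp add: mult_right_mono)
    qed
    also have "\<dots> \<le> (\<Sum>n. 24 * (1 / 3) ^ n)"
      using F by (intro sum_le_suminf summable_mult summable_geometric) auto
    finally show "sum (wt (- s_crit)) F \<le> (\<Sum>n. 24 * (1 / 3) ^ n)" .
  qed
qed (simp add: wt_nonneg)

section \<open>The Hilbert space of admissible Fourier coefficients\<close>

text \<open>The Fourier coefficient of an admissible field at \<open>k\<close> is a multiple \<open>a k\<close> of \<open>v_dir k\<close>;
  the field is real if and only if \<open>a (- k) = cnj (a k)\<close>.\<close>

definition coeff_set :: "(int^3 \<Rightarrow> complex) set" where
  "coeff_set = {a. (\<forall>k. a (- k) = cnj (a k)) \<and> (\<forall>k. k \<notin> M_freq \<longrightarrow> a k = 0) \<and>
                   (\<lambda>k. (cmod (a k))\<^sup>2) summable_on UNIV}"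

lemma coeff_setI:
  assumes "\<And>k. a (- k) = cnj (a k)" and "\<And>k. k \<notin> M_freq \<Longrightarrow> a k = 0"
    and "\<And>F. finite F \<Longrightarrow> F \<subseteq> M_freq \<Longrightarrow> (\<Sum>k\<in>F. (cmod (a k))\<^sup>2) \<le> C"
  shows "a \<in> coeff_set"
proof -
  have "(\<lambda>k. (cmod (a k))\<^sup>2) summable_on M_freq"
    by (rule nonneg_bdd_above_summable_on) (use assms(3) in \<open>auto intro!: bdd_aboveI[of _ C]\<close>)
  then have "(\<lambda>k. (cmod (a k))\<^sup>2) summable_on UNIV"
    by (rule summable_on_cong_neutral[THEN iffD1, rotated -1]) (use assms(2) in auto)
  then show ?thesis using assms(1,2) by (simp add: coeff_set_def)
qed

text \<open>A type, so that the theory of quadratic equations in Hilbert spaces applies, and the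
  same type for every order \<open>s\<close>: the Sobolev weight is moved into the
  coefficients.\<close>

typedef coeffs = coeff_set morphisms cf Abs_coeffs
  by (rule exI[of _ "\<lambda>_. 0"]) (simp add: coeff_set_def)

lemma cf_uminus_freq: "cf a (- k) = cnj (cf a k)"
  and cf_outside: "k \<notin> M_freq \<Longrightarrow> cf a k = 0"
  and cf_summable: "(\<lambda>k. (cmod (cf a k))\<^sup>2) summable_on UNIV"
  using cf[of a] by (auto simp: coeff_set_def)

lemma coeffs_eqI: "(\<And>k. k \<in> M_freq \<Longrightarrow> cf a k = cf b k) \<Longrightarrow> a = b"
proof -
  assume *: "\<And>k. k \<in> M_freq \<Longrightarrow> cf a k = cf b k"
  have "cf a k = cf b k" for k
    by (cases "k \<in> M_freq") (simp_all add: * cf_outside)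
  then show ?thesis by (simp add: cf_inject[symmetric] fun_eq_iff)
qed

lemma square_summable_add:
  fixes f g :: "'a \<Rightarrow> 'b::real_normed_vector"
  assumes "(\<lambda>k. (norm (f k))\<^sup>2) summable_on A" "(\<lambda>k. (norm (g k))\<^sup>2) summable_on A"
  shows "(\<lambda>k. (norm (f k + g k))\<^sup>2) summable_on A"
proof (rule summable_on_comparison_test)
  show "(\<lambda>k. 2 * (norm (f k))\<^sup>2 + 2 * (norm (g k))\<^sup>2) summable_on A"
    by (intro summable_on_add summable_on_cmult_right assms)
  fix k
  have "(norm (f k + g k))\<^sup>2 \<le> (norm (f k) + norm (g k))\<^sup>2"
    by (intro power_mono norm_triangle_ineq) auto
  also have "\<dots> \<le> 2 * (norm (f k))\<^sup>2 + 2 * (norm (g k))\<^sup>2"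
    using sum_squares_bound[of "norm (f k)" "norm (g k)"] by (simp add: power2_sum)
  finally show "(norm (f k + g k))\<^sup>2 \<le> 2 * (norm (f k))\<^sup>2 + 2 * (norm (g k))\<^sup>2" .
qed auto

lemma mult_le_sum_squares: "x * y \<le> x\<^sup>2 + y\<^sup>2" for x y :: real
  using sum_squares_bound[of x y] sum_power2_ge_zero[of x y] by linarith

lemma cf_inner_summable: "(\<lambda>k. cf a k \<bullet> cf b k) summable_on UNIV"
proof (rule abs_summable_summable, rule summable_on_comparison_test)
  show "(\<lambda>k. (cmod (cf a k))\<^sup>2 + (cmod (cf b k))\<^sup>2) summable_on UNIV"
    by (intro summable_on_add cf_summable)
  fix k
  have "\<bar>cf a k \<bullet> cf b k\<bar> \<le> cmod (cf a k) * cmod (cf b k)"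
    by (rule Cauchy_Schwarz_ineq2)
  also have "\<dots> \<le> (cmod (cf a k))\<^sup>2 + (cmod (cf b k))\<^sup>2"
    by (rule mult_le_sum_squares)
  finally show "norm (cf a k \<bullet> cf b k) \<le> (cmod (cf a k))\<^sup>2 + (cmod (cf b k))\<^sup>2"
    by simp
qed auto

text \<open>Only a real Hilbert space: complex multiples destroy the condition
  \<open>a (- k) = cnj (a k)\<close>. The inner product of two coefficients is that of the plane,
  \<open>Re (z * cnj w)\<close>.\<close>

instantiation coeffs :: real_inner
begin

definition zero_coeffs :: coeffs where "zero_coeffs = Abs_coeffs (\<lambda>_. 0)"
definition plus_coeffs :: "coeffs \<Rightarrow> coeffs \<Rightarrow> coeffs" where
  "plus_coeffs a b = Abs_coeffs (\<lambda>k. cf a k + cf b k)"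
definition uminus_coeffs :: "coeffs \<Rightarrow> coeffs" where
  "uminus_coeffs a = Abs_coeffs (\<lambda>k. - cf a k)"
definition minus_coeffs :: "coeffs \<Rightarrow> coeffs \<Rightarrow> coeffs" where
  "minus_coeffs a b = Abs_coeffs (\<lambda>k. cf a k - cf b k)"
definition scaleR_coeffs :: "real \<Rightarrow> coeffs \<Rightarrow> coeffs" where
  "scaleR_coeffs r a = Abs_coeffs (\<lambda>k. r *\<^sub>R cf a k)"
definition inner_coeffs :: "coeffs \<Rightarrow> coeffs \<Rightarrow> real" where
  "inner_coeffs a b = (\<Sum>\<^sub>\<infinity>k. cf a k \<bullet> cf b k)"
definition norm_coeffs :: "coeffs \<Rightarrow> real" where
  "norm_coeffs a = sqrt (inner a a)"
definition sgn_coeffs :: "coeffs \<Rightarrow> coeffs" where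
  "sgn_coeffs a = scaleR (inverse (norm a)) a"
definition dist_coeffs :: "coeffs \<Rightarrow> coeffs \<Rightarrow> real" where
  "dist_coeffs a b = norm (a - b)"
definition uniformity_coeffs :: "(coeffs \<times> coeffs) filter" where
  "uniformity_coeffs = (INF e\<in>{0 <..}. principal {(x, y). dist x y < e})"
definition open_coeffs :: "coeffs set \<Rightarrow> bool" where
  "open_coeffs U = (\<forall>x\<in>U. eventually (\<lambda>(x', y). x' = x \<longrightarrow> y \<in> U) uniformity)"

lemma cf_zero [simp]: "cf 0 k = 0"
  unfolding zero_coeffs_def by (subst Abs_coeffs_inverse) (auto simp: coeff_set_def)

lemma cf_add [simp]: "cf (a + b) k = cf a k + cf b k"
  unfolding plus_coeffs_def
  by (subst Abs_coeffs_inverse)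
    (auto simp: coeff_set_def cf_uminus_freq cf_outside intro!: square_summable_add cf_summable)

lemma cf_scaleR [simp]: "cf (r *\<^sub>R a) k = r *\<^sub>R cf a k"
  unfolding scaleR_coeffs_def
  by (subst Abs_coeffs_inverse)
    (auto simp: coeff_set_def cf_uminus_freq cf_outside power_mult_distrib
      intro!: summable_on_cmult_right cf_summable)

lemma cf_uminus [simp]: "cf (- a) k = - cf a k"
  unfolding uminus_coeffs_def
  by (subst Abs_coeffs_inverse) (auto simp: coeff_set_def cf_uminus_freq cf_outside cf_summable)

lemma cf_diff [simp]: "cf (a - b) k = cf a k - cf b k"
proof -
  have "(\<lambda>k. cf a k - cf b k) = cf (a + - b)" by auto
  then show ?thesis unfolding minus_coeffs_def by (simp add: cf_inverse)
qed

instance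
proof
  fix a b c :: coeffs and r s :: real
  show "a + b + c = a + (b + c)" "a + b = b + a" "0 + a = a" "- a + a = 0" "a - b = a + - b"
    by (auto intro!: coeffs_eqI)
  show "r *\<^sub>R (a + b) = r *\<^sub>R a + r *\<^sub>R b" "(r + s) *\<^sub>R a = r *\<^sub>R a + s *\<^sub>R a"
    "r *\<^sub>R s *\<^sub>R a = (r * s) *\<^sub>R a" "1 *\<^sub>R a = a"
    by (auto intro!: coeffs_eqI simp: algebra_simps)
  show "dist a b = norm (a - b)" "sgn a = scaleR (inverse (norm a)) a"
    by (simp_all add: dist_coeffs_def sgn_coeffs_def)
  show "uniformity = (INF e\<in>{0 <..}. principal {(x :: coeffs, y). dist x y < e})"
    by (simp add: uniformity_coeffs_def)
  show "open U = (\<forall>x\<in>U. eventually (\<lambda>(x', y). x' = x \<longrightarrow> y \<in> U) uniformity)" for U :: "coeffs set"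
    by (simp add: open_coeffs_def)
  show "inner a b = inner b a"
    by (simp add: inner_coeffs_def inner_commute)
  show "inner (a + b) c = inner a c + inner b c"
    by (simp add: inner_coeffs_def inner_add_left infsum_add cf_inner_summable)
  show "inner (r *\<^sub>R a) b = r * inner a b"
    by (simp add: inner_coeffs_def infsum_cmult_right')
  show "0 \<le> inner a a"
    by (simp add: inner_coeffs_def infsum_nonneg)
  show "inner a a = 0 \<longleftrightarrow> a = 0"
  proof
    assume "inner a a = 0"
    then have "cf a k \<bullet> cf a k = 0" for k
      by (intro nonneg_infsum_le_0D[of "\<lambda>k. cf a k \<bullet> cf a k" UNIV])
        (auto simp: inner_coeffs_def cf_inner_summable)
    then show "a = 0" by (auto intro!: coeffs_eqI)
  qed (simp add: inner_coeffs_def)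
  show "norm a = sqrt (inner a a)"
    by (simp add: norm_coeffs_def)
qed

end

lemma norm_coeffs_sq: "(norm a)\<^sup>2 = (\<Sum>\<^sub>\<infinity>k. (cmod (cf a k))\<^sup>2)"
  unfolding power2_norm_eq_inner inner_coeffs_def ..

lemma sum_cf_le_norm: "finite F \<Longrightarrow> (\<Sum>k\<in>F. (cmod (cf a k))\<^sup>2) \<le> (norm a)\<^sup>2"
  unfolding norm_coeffs_sq by (intro finite_sum_le_infsum cf_summable) auto

lemma cmod_cf_le_norm: "cmod (cf a k) \<le> norm a"
  using sum_cf_le_norm[of "{k}" a] by (auto intro: power2_le_imp_le)

lemma norm_coeffs_le:
  assumes "0 \<le> C" "\<And>F. finite F \<Longrightarrow> F \<subseteq> M_freq \<Longrightarrow> (\<Sum>k\<in>F. (cmod (cf a k))\<^sup>2) \<le> C\<^sup>2"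
  shows "norm a \<le> C"
proof -
  have "(\<Sum>\<^sub>\<infinity>k. (cmod (cf a k))\<^sup>2) = (\<Sum>\<^sub>\<infinity>k\<in>M_freq. (cmod (cf a k))\<^sup>2)"
    by (rule infsum_cong_neutral) (auto simp: cf_outside)
  also have "\<dots> \<le> C\<^sup>2"
    by (rule infsum_le_finite_sums) (auto intro: assms summable_on_subset_banach[OF cf_summable])
  finally have "(norm a)\<^sup>2 \<le> C\<^sup>2"
    by (simp add: norm_coeffs_sq)
  then show ?thesis
    using assms(1) by (rule power2_le_imp_le)
qed

instance coeffs :: banach
proof
  fix X :: "nat \<Rightarrow> coeffs" assume X: "Cauchy X"
  have "Cauchy (\<lambda>n. cf (X n) k)" for k
  proof (rule metric_CauchyI)
    fix e :: real assume "e > 0"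
    then obtain M where M: "\<And>m n. m \<ge> M \<Longrightarrow> n \<ge> M \<Longrightarrow> dist (X m) (X n) < e"
      using metric_CauchyD[OF X] by blast
    have "dist (cf (X m) k) (cf (X n) k) < e" if "m \<ge> M" "n \<ge> M" for m n
      using cmod_cf_le_norm[of "X m - X n" k] M[OF that] by (simp add: dist_norm)
    then show "\<exists>M. \<forall>m\<ge>M. \<forall>n\<ge>M. dist (cf (X m) k) (cf (X n) k) < e" by blast
  qed
  then have "\<forall>k. \<exists>l. (\<lambda>n. cf (X n) k) \<longlonglongrightarrow> l"
    by (simp add: Cauchy_convergent_iff convergent_def)
  from choice[OF this] obtain l where l: "\<And>k. (\<lambda>n. cf (X n) k) \<longlonglongrightarrow> l k"
    by blast
  have tail: "\<exists>M. \<forall>m\<ge>M. \<forall>F. finite F \<longrightarrow> (\<Sum>k\<in>F. (cmod (l k - cf (X m) k))\<^sup>2) \<le> e\<^sup>2" if e: "e > 0" for e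
  proof -
    obtain M where M: "\<And>m n. m \<ge> M \<Longrightarrow> n \<ge> M \<Longrightarrow> dist (X m) (X n) < e"
      using metric_CauchyD[OF X e] by blast
    have "(\<Sum>k\<in>F. (cmod (l k - cf (X m) k))\<^sup>2) \<le> e\<^sup>2" if "m \<ge> M" "finite F" for m F
    proof (rule LIMSEQ_le_const2)
      show "(\<lambda>n. \<Sum>k\<in>F. (cmod (cf (X n) k - cf (X m) k))\<^sup>2) \<longlonglongrightarrow> (\<Sum>k\<in>F. (cmod (l k - cf (X m) k))\<^sup>2)"
        by (intro tendsto_intros l)
      have "(\<Sum>k\<in>F. (cmod (cf (X n) k - cf (X m) k))\<^sup>2) \<le> e\<^sup>2" if "n \<ge> M" for n
      proof -
        have "(\<Sum>k\<in>F. (cmod (cf (X n) k - cf (X m) k))\<^sup>2) \<le> (norm (X n - X m))\<^sup>2"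
          using sum_cf_le_norm[OF \<open>finite F\<close>, of "X n - X m"] by simp
        also have "\<dots> \<le> e\<^sup>2"
          using M[OF that \<open>m \<ge> M\<close>] by (intro power_mono) (auto simp: dist_norm)
        finally show ?thesis .
      qed
      then show "\<exists>N. \<forall>n\<ge>N. (\<Sum>k\<in>F. (cmod (cf (X n) k - cf (X m) k))\<^sup>2) \<le> e\<^sup>2" by blast
    qed
    then show ?thesis by blast
  qed
  have diff: "(\<lambda>k. l k - cf (X m) k) \<in> coeff_set"
    if "\<forall>F. finite F \<longrightarrow> (\<Sum>k\<in>F. (cmod (l k - cf (X m) k))\<^sup>2) \<le> C" for m C
  proof (rule coeff_setI)
    fix k
    have "(\<lambda>n. cf (X n) (- k)) \<longlonglongrightarrow> cnj (l k)"
      using tendsto_cnj[OF l[of k]] by (simp add: cf_uminus_freq)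
    then show "l (- k) - cf (X m) (- k) = cnj (l k - cf (X m) k)"
      using LIMSEQ_unique[OF l[of "- k"]] by (simp add: cf_uminus_freq)
    show "l k - cf (X m) k = 0" if "k \<notin> M_freq"
      using LIMSEQ_unique[OF l[of k], of 0] that by (simp add: cf_outside)
  qed (use that in auto)
  obtain m where "\<forall>F. finite F \<longrightarrow> (\<Sum>k\<in>F. (cmod (l k - cf (X m) k))\<^sup>2) \<le> 1\<^sup>2"
    using tail[of 1] by auto
  \<comment> \<open>The coordinatewise limit is a member of the sequence plus a remainder with
    bounded square sums, hence itself an element of the type.\<close>
  from diff[OF this] have "l = cf (X m + Abs_coeffs (\<lambda>k. l k - cf (X m) k))"
    by (auto simp: Abs_coeffs_inverse)
  then obtain L where L: "l = cf L" by blast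
  have "X \<longlonglongrightarrow> L"
  proof (rule metric_LIMSEQ_I)
    fix e :: real assume "e > 0"
    then obtain M where M: "\<And>m F. m \<ge> M \<Longrightarrow> finite F \<Longrightarrow> (\<Sum>k\<in>F. (cmod (l k - cf (X m) k))\<^sup>2) \<le> (e / 2)\<^sup>2"
      using tail[of "e / 2"] by auto
    have "dist (X m) L < e" if "m \<ge> M" for m
    proof -
      have "norm (L - X m) \<le> e / 2"
        by (rule norm_coeffs_le) (use M[OF that] \<open>e > 0\<close> in \<open>auto simp: L\<close>)
      then show ?thesis using \<open>e > 0\<close> by (simp add: dist_norm norm_minus_commute)
    qed
    then show "\<exists>no. \<forall>n\<ge>no. dist (X n) L < e" by blast
  qed
  then show "convergent X" by (auto simp: convergent_def)
qed

section \<open>Multipliers and convolutions\<close>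

definition mult :: "(int^3 \<Rightarrow> real) \<Rightarrow> coeffs \<Rightarrow> coeffs" where
  "mult g a = Abs_coeffs (\<lambda>k. of_real (g k) * cf a k)"

text \<open>A real even factor is what preserves the reality condition.\<close>

locale bounded_multiplier =
  fixes g :: "int^3 \<Rightarrow> real" and C :: real
  assumes even: "\<And>k. g (- k) = g k" and bound: "\<And>k. k \<in> M_freq \<Longrightarrow> \<bar>g k\<bar> \<le> C"
begin

lemma sum_le:
  assumes "finite F" "F \<subseteq> M_freq"
  shows "(\<Sum>k\<in>F. (cmod (of_real (g k) * cf a k))\<^sup>2) \<le> (C * norm a)\<^sup>2"
proof -
  have "(\<Sum>k\<in>F. (cmod (of_real (g k) * cf a k))\<^sup>2) \<le> (\<Sum>k\<in>F. C\<^sup>2 * (cmod (cf a k))\<^sup>2)"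
    unfolding norm_mult power_mult_distrib
  proof (intro sum_mono mult_right_mono)
    fix k assume "k \<in> F"
    then have "\<bar>g k\<bar> \<le> C" using assms bound by blast
    then show "(cmod (of_real (g k)))\<^sup>2 \<le> C\<^sup>2"
      using power_mono[of "\<bar>g k\<bar>" C 2] by simp
  qed auto
  also have "\<dots> \<le> C\<^sup>2 * (norm a)\<^sup>2"
    unfolding sum_distrib_left[symmetric] using assms by (intro mult_left_mono sum_cf_le_norm) auto
  finally show ?thesis by (simp add: power_mult_distrib)
qed

lemma cf_mult: "cf (mult g a) k = of_real (g k) * cf a k"
proof -
  have "(\<lambda>k. of_real (g k) * cf a k) \<in> coeff_set"
    by (rule coeff_setI) (use sum_le in \<open>auto simp: cf_uminus_freq even cf_outside\<close>)
  then show ?thesis by (simp add: mult_def Abs_coeffs_inverse)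
qed

lemma bounded_linear_mult: "bounded_linear (mult g)"
proof (rule bounded_linear_intro)
  show "mult g (a + b) = mult g a + mult g b" for a b
    by (auto intro!: coeffs_eqI simp: cf_mult algebra_simps)
  show "mult g (r *\<^sub>R a) = r *\<^sub>R mult g a" for r a
    by (auto intro!: coeffs_eqI simp: cf_mult)
  show "norm (mult g a) \<le> norm a * \<bar>C\<bar>" for a
    by (rule norm_coeffs_le) (use sum_le[of _ a] in \<open>auto simp: cf_mult power_mult_distrib mult.commute\<close>)
qed

end

section \<open>Bilinear convolutions with bounded kernels\<close>

definition conv :: "(int^3 \<Rightarrow> int^3 \<Rightarrow> complex) \<Rightarrow> coeffs \<Rightarrow> coeffs \<Rightarrow> coeffs" where
  "conv \<beta> a b = Abs_coeffs (\<lambda>k. if k \<in> M_freq then \<Sum>h\<in>nbr k. \<beta> k h * cf a h * cf b (k - h) else 0)"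

lemma finite_nbr: "k \<in> M_freq \<Longrightarrow> finite (nbr k)"
  and card_nbr: "k \<in> M_freq \<Longrightarrow> real (card (nbr k)) \<le> 72"
  using nbr_finite_card by fastforce+

text \<open>Double counting: after the substitution \<open>h \<mapsto> k - h\<close>, a frequency
  \<open>j\<close> occurs for at most 72 values of \<open>k\<close>, all of them in
  \<open>near j\<close>.\<close>

lemma sum_nbr_le:
  assumes F: "finite F" "F \<subseteq> M_freq"
  shows "(\<Sum>k\<in>F. \<Sum>h\<in>nbr k. (cmod (cf b (k - h)))\<^sup>2) \<le> 72 * (norm b)\<^sup>2"
proof -
  define J where "J = (\<Union>k\<in>F. nbr k)"
  have finJ: "finite J"
    unfolding J_def by (rule finite_UN_I[OF F(1)], rule finite_nbr) (use F in blast)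
  have "(\<Sum>k\<in>F. \<Sum>h\<in>nbr k. (cmod (cf b (k - h)))\<^sup>2) = (\<Sum>k\<in>F. \<Sum>j\<in>nbr k. (cmod (cf b j))\<^sup>2)"
  proof (rule sum.cong[OF refl])
    fix k
    show "(\<Sum>h\<in>nbr k. (cmod (cf b (k - h)))\<^sup>2) = (\<Sum>j\<in>nbr k. (cmod (cf b j))\<^sup>2)"
      by (rule sum.reindex_bij_witness[of _ "\<lambda>j. k - j" "\<lambda>h. k - h"]) (auto simp: nbr_minus[symmetric])
  qed
  also have "\<dots> = (\<Sum>k\<in>F. \<Sum>j\<in>{j \<in> J. j \<in> nbr k}. (cmod (cf b j))\<^sup>2)"
  proof (rule sum.cong[OF refl])
    fix k assume "k \<in> F"
    then have "{j \<in> J. j \<in> nbr k} = nbr k" by (auto simp: J_def)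
    then show "(\<Sum>j\<in>nbr k. (cmod (cf b j))\<^sup>2) = (\<Sum>j\<in>{j \<in> J. j \<in> nbr k}. (cmod (cf b j))\<^sup>2)"
      by simp
  qed
  also have "\<dots> = (\<Sum>j\<in>J. \<Sum>k\<in>{k \<in> F. j \<in> nbr k}. (cmod (cf b j))\<^sup>2)"
    by (rule sum.swap_restrict[OF F(1) finJ])
  also have "\<dots> \<le> (\<Sum>j\<in>J. 72 * (cmod (cf b j))\<^sup>2)"
  proof (rule sum_mono)
    fix j
    have "{k \<in> F. j \<in> nbr k} \<subseteq> near j" using F nbr_imp_near by blast
    then have "card {k \<in> F. j \<in> nbr k} \<le> 72"
      using card_mono[of "near j" "{k \<in> F. j \<in> nbr k}"] near_finite_card[of j] by linarith
    then show "(\<Sum>k\<in>{k \<in> F. j \<in> nbr k}. (cmod (cf b j))\<^sup>2) \<le> 72 * (cmod (cf b j))\<^sup>2"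
      by (simp add: mult_right_mono)
  qed
  also have "\<dots> \<le> 72 * (norm b)\<^sup>2"
    unfolding sum_distrib_left[symmetric] using sum_cf_le_norm[OF finJ] by (intro mult_left_mono) auto
  finally show ?thesis .
qed

locale bounded_kernel =
  fixes \<beta> :: "int^3 \<Rightarrow> int^3 \<Rightarrow> complex" and K :: real
  assumes herm: "\<And>k h. \<beta> (- k) (- h) = cnj (\<beta> k h)"
    and K: "0 \<le> K" and bound: "\<And>k h. k \<in> M_freq \<Longrightarrow> h \<in> nbr k \<Longrightarrow> cmod (\<beta> k h) \<le> K"
begin

text \<open>\<open>a\<close> enters through its supremum and \<open>b\<close> through its square
  sum. Cauchy-Schwarz over the neighbours and the double count each contribute a factor 72 to the
  squared bound.\<close>

lemma sum_le:
  assumes F: "finite F" "F \<subseteq> M_freq"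
  shows "(\<Sum>k\<in>F. (cmod (\<Sum>h\<in>nbr k. \<beta> k h * cf a h * cf b (k - h)))\<^sup>2) \<le> (72 * K * norm a * norm b)\<^sup>2"
proof -
  have "(cmod (\<Sum>h\<in>nbr k. \<beta> k h * cf a h * cf b (k - h)))\<^sup>2
      \<le> 72 * (K * norm a)\<^sup>2 * (\<Sum>h\<in>nbr k. (cmod (cf b (k - h)))\<^sup>2)" if "k \<in> F" for k
  proof -
    have kM: "k \<in> M_freq" using that F by auto
    have "cmod (\<Sum>h\<in>nbr k. \<beta> k h * cf a h * cf b (k - h)) \<le> (\<Sum>h\<in>nbr k. (K * norm a) * cmod (cf b (k - h)))"
    proof (rule sum_norm_le)
      fix h assume "h \<in> nbr k"
      then show "cmod (\<beta> k h * cf a h * cf b (k - h)) \<le> (K * norm a) * cmod (cf b (k - h))"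
        unfolding norm_mult using bound[OF kM] K by (intro mult_right_mono mult_mono cmod_cf_le_norm) auto
    qed
    then have "(cmod (\<Sum>h\<in>nbr k. \<beta> k h * cf a h * cf b (k - h)))\<^sup>2
        \<le> ((K * norm a) * (\<Sum>h\<in>nbr k. cmod (cf b (k - h))))\<^sup>2"
      by (simp add: sum_distrib_left power_mono)
    also have "\<dots> = (K * norm a)\<^sup>2 * (\<Sum>h\<in>nbr k. cmod (cf b (k - h)))\<^sup>2"
      by (rule power_mult_distrib)
    also have "\<dots> \<le> (K * norm a)\<^sup>2 * ((\<Sum>h\<in>nbr k. (cmod (cf b (k - h)))\<^sup>2) * 72)"
    proof (rule mult_left_mono)
      have "(\<Sum>h\<in>nbr k. cmod (cf b (k - h)))\<^sup>2 \<le> (\<Sum>h\<in>nbr k. (cmod (cf b (k - h)))\<^sup>2) * card (nbr k)"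
        by (rule sum_squared_le_sum_of_squares)
      also have "\<dots> \<le> (\<Sum>h\<in>nbr k. (cmod (cf b (k - h)))\<^sup>2) * 72"
        using card_nbr[OF kM] by (intro mult_left_mono sum_nonneg) auto
      finally show "(\<Sum>h\<in>nbr k. cmod (cf b (k - h)))\<^sup>2 \<le> (\<Sum>h\<in>nbr k. (cmod (cf b (k - h)))\<^sup>2) * 72" .
    qed simp
    finally show ?thesis by (simp only: mult_ac)
  qed
  then have "(\<Sum>k\<in>F. (cmod (\<Sum>h\<in>nbr k. \<beta> k h * cf a h * cf b (k - h)))\<^sup>2)
      \<le> (\<Sum>k\<in>F. 72 * (K * norm a)\<^sup>2 * (\<Sum>h\<in>nbr k. (cmod (cf b (k - h)))\<^sup>2))"
    by (rule sum_mono)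
  also have "\<dots> \<le> 72 * (K * norm a)\<^sup>2 * (72 * (norm b)\<^sup>2)"
    unfolding sum_distrib_left[symmetric] by (intro mult_left_mono sum_nbr_le F) auto
  finally show ?thesis by (simp add: power_mult_distrib mult_ac)
qed

lemma cf_conv: "cf (conv \<beta> a b) k = (if k \<in> M_freq then \<Sum>h\<in>nbr k. \<beta> k h * cf a h * cf b (k - h) else 0)"
proof -
  have "(\<lambda>k. if k \<in> M_freq then \<Sum>h\<in>nbr k. \<beta> k h * cf a h * cf b (k - h) else 0) \<in> coeff_set"
  proof (rule coeff_setI)
    fix k
    have "(\<Sum>h\<in>nbr (- k). \<beta> (- k) h * cf a h * cf b (- k - h)) = (\<Sum>h\<in>nbr k. \<beta> (- k) (- h) * cf a (- h) * cf b (- k - - h))"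
      unfolding nbr_uminus by (subst sum.reindex) (auto simp: inj_on_def)
    also have "\<dots> = cnj (\<Sum>h\<in>nbr k. \<beta> k h * cf a h * cf b (k - h))"
      using cf_uminus_freq[of b "k - _"] by (simp add: herm cf_uminus_freq)
    finally show "(if - k \<in> M_freq then \<Sum>h\<in>nbr (- k). \<beta> (- k) h * cf a h * cf b (- k - h) else 0)
      = cnj (if k \<in> M_freq then \<Sum>h\<in>nbr k. \<beta> k h * cf a h * cf b (k - h) else 0)" by simp
  next
    fix F assume F: "finite F" "F \<subseteq> M_freq"
    have "(\<Sum>k\<in>F. (cmod (if k \<in> M_freq then \<Sum>h\<in>nbr k. \<beta> k h * cf a h * cf b (k - h) else 0))\<^sup>2)
      = (\<Sum>k\<in>F. (cmod (\<Sum>h\<in>nbr k. \<beta> k h * cf a h * cf b (k - h)))\<^sup>2)"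
      using F by (intro sum.cong) auto
    then show "(\<Sum>k\<in>F. (cmod (if k \<in> M_freq then \<Sum>h\<in>nbr k. \<beta> k h * cf a h * cf b (k - h) else 0))\<^sup>2)
        \<le> (72 * K * norm a * norm b)\<^sup>2"
      using sum_le[OF F] by simp
  qed auto
  then show ?thesis by (simp add: conv_def Abs_coeffs_inverse)
qed

lemma norm_conv_le: "norm (conv \<beta> a b) \<le> 72 * K * norm a * norm b"
proof (rule norm_coeffs_le)
  fix F assume F: "finite F" "F \<subseteq> M_freq"
  have "(\<Sum>k\<in>F. (cmod (cf (conv \<beta> a b) k))\<^sup>2) = (\<Sum>k\<in>F. (cmod (\<Sum>h\<in>nbr k. \<beta> k h * cf a h * cf b (k - h)))\<^sup>2)"
    using F by (intro sum.cong) (auto simp: cf_conv)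
  then show "(\<Sum>k\<in>F. (cmod (cf (conv \<beta> a b) k))\<^sup>2) \<le> (72 * K * norm a * norm b)\<^sup>2"
    using sum_le[OF F] by simp
qed (use K in auto)

lemma bounded_bilinear_conv: "bounded_bilinear (conv \<beta>)"
proof
  show "conv \<beta> (a + a') b = conv \<beta> a b + conv \<beta> a' b" for a a' b
    by (auto intro!: coeffs_eqI simp: cf_conv sum.distrib algebra_simps)
  show "conv \<beta> a (b + b') = conv \<beta> a b + conv \<beta> a b'" for a b b'
    by (auto intro!: coeffs_eqI simp: cf_conv sum.distrib algebra_simps)
  show "conv \<beta> (r *\<^sub>R a) b = r *\<^sub>R conv \<beta> a b" for r a b
    by (auto intro!: coeffs_eqI simp: cf_conv scaleR_sum_right)
  show "conv \<beta> a (r *\<^sub>R b) = r *\<^sub>R conv \<beta> a b" for r a b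
    by (auto intro!: coeffs_eqI simp: cf_conv scaleR_sum_right)
  show "\<exists>K. \<forall>a b. norm (conv \<beta> a b) \<le> norm a * norm b * K"
    by (rule exI[of _ "72 * K"]) (use norm_conv_le in \<open>simp add: mult_ac\<close>)
qed

text \<open>Absolute summability over pairs licenses the rearrangement in \<open>conv_skew\<close>.
  Again \<open>a\<close> is bounded uniformly, and the two factors from \<open>b\<close> are
  separated into squares.\<close>

lemma trilinear_summable:
  "(\<lambda>(k, h). \<beta> k h * cf a h * cf b (k - h) * cnj (cf b k)) summable_on (SIGMA k:M_freq. nbr k)"
proof (rule abs_summable_summable, rule nonneg_bdd_above_summable_on)
  let ?T = "\<lambda>(k, h). \<beta> k h * cf a h * cf b (k - h) * cnj (cf b k)"
  have T: "cmod (?T (k, h)) \<le> (K * norm a) * ((cmod (cf b (k - h)))\<^sup>2 + (cmod (cf b k))\<^sup>2)"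
    if "k \<in> M_freq" "h \<in> nbr k" for k h
  proof -
    have "cmod (?T (k, h)) \<le> (K * norm a) * (cmod (cf b (k - h)) * cmod (cf b k))"
      unfolding prod.case norm_mult complex_mod_cnj mult.assoc[symmetric]
      using bound[OF that] K by (intro mult_right_mono mult_mono cmod_cf_le_norm) auto
    also have "cmod (cf b (k - h)) * cmod (cf b k) \<le> (cmod (cf b (k - h)))\<^sup>2 + (cmod (cf b k))\<^sup>2"
      by (rule mult_le_sum_squares)
    finally show ?thesis using K by (simp add: mult_left_mono)
  qed
  show "bdd_above (sum (\<lambda>p. norm (?T p)) ` {G. G \<subseteq> (SIGMA k:M_freq. nbr k) \<and> finite G})"
  proof (rule bdd_aboveI, safe)
    fix G assume G: "G \<subseteq> (SIGMA k:M_freq. nbr k)" "finite G"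
    define F where "F = fst ` G"
    have F: "finite F" "F \<subseteq> M_freq" and sub: "G \<subseteq> (SIGMA k:F. nbr k)"
      using G by (force simp: F_def)+
    have fin: "finite (SIGMA k:F. nbr k)"
      using F finite_nbr by (intro finite_SigmaI) blast+
    have "sum (\<lambda>p. norm (?T p)) G \<le> sum (\<lambda>p. norm (?T p)) (SIGMA k:F. nbr k)"
      by (rule sum_mono2[OF fin sub]) auto
    also have "\<dots> \<le> (\<Sum>(k, h)\<in>(SIGMA k:F. nbr k). (K * norm a) * ((cmod (cf b (k - h)))\<^sup>2 + (cmod (cf b k))\<^sup>2))"
      using T F by (intro sum_mono) auto
    also have "\<dots> = (\<Sum>k\<in>F. \<Sum>h\<in>nbr k. (K * norm a) * ((cmod (cf b (k - h)))\<^sup>2 + (cmod (cf b k))\<^sup>2))"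
      using F finite_nbr by (subst sum.Sigma) blast+
    also have "\<dots> = (K * norm a) * ((\<Sum>k\<in>F. \<Sum>h\<in>nbr k. (cmod (cf b (k - h)))\<^sup>2) + (\<Sum>k\<in>F. card (nbr k) * (cmod (cf b k))\<^sup>2))"
      by (simp add: sum.distrib sum_distrib_left distrib_left mult_ac)
    also have "\<dots> \<le> (K * norm a) * (72 * (norm b)\<^sup>2 + 72 * (norm b)\<^sup>2)"
    proof (intro mult_left_mono add_mono sum_nbr_le F)
      have "(\<Sum>k\<in>F. card (nbr k) * (cmod (cf b k))\<^sup>2) \<le> (\<Sum>k\<in>F. 72 * (cmod (cf b k))\<^sup>2)"
        using F card_nbr by (intro sum_mono mult_right_mono) auto
      also have "\<dots> \<le> 72 * (norm b)\<^sup>2"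
        unfolding sum_distrib_left[symmetric] using sum_cf_le_norm[OF F(1)] by (intro mult_left_mono) auto
      finally show "(\<Sum>k\<in>F. card (nbr k) * (cmod (cf b k))\<^sup>2) \<le> 72 * (norm b)\<^sup>2" .
    qed (use K in auto)
    finally show "sum (\<lambda>p. norm (?T p)) G \<le> (K * norm a) * (72 * (norm b)\<^sup>2 + 72 * (norm b)\<^sup>2)" .
  qed
qed auto

text \<open>The involution \<open>(k, h) \<mapsto> (h - k, h)\<close> reverses the sign of every term of the trilinear sum.\<close>

lemma conv_skew:
  assumes skew: "\<And>k h. k \<in> M_freq \<Longrightarrow> h \<in> nbr k \<Longrightarrow> \<beta> (h - k) h = - \<beta> k h"
  shows "conv \<beta> a b \<bullet> b = 0"
proof -
  let ?T = "\<lambda>(k, h). \<beta> k h * cf a h * cf b (k - h) * cnj (cf b k)"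
  let ?S = "SIGMA k:M_freq. nbr k"
  have "infsum ?T ?S = (\<Sum>\<^sub>\<infinity>p\<in>?S. - ?T p)"
  proof (rule infsum_reindex_bij_witness[of _ "\<lambda>(k, h). (h - k, h)" "\<lambda>(k, h). (h - k, h)"])
    have mem: "h - k \<in> M_freq \<and> h \<in> nbr (h - k)" if "k \<in> M_freq" "h \<in> nbr k" for k h
      using that M_freq_uminus[of "k - h"] by (auto simp: nbr_def)
    show "(case p of (k, h) \<Rightarrow> (h - k, h)) \<in> ?S" if "p \<in> ?S" for p
      using that mem by auto
    then show "(case p of (k, h) \<Rightarrow> (h - k, h)) \<in> ?S" if "p \<in> ?S" for p
      using that by blast
    \<comment> \<open>By the reality condition \<open>cf b (h - k - h) = cnj (cf b k)\<close> and
      \<open>cnj (cf b (h - k)) = cf b (k - h)\<close>: the two factors trade places and only the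
      sign of the kernel remains.\<close>
    show "- ?T (case p of (k, h) \<Rightarrow> (h - k, h)) = ?T p" if "p \<in> ?S" for p
      using that skew cf_uminus_freq[of b] cf_uminus_freq[of b "snd p - fst p"] by (auto simp: mult_ac)
  qed auto
  then have zero: "infsum ?T ?S = 0" by (simp add: infsum_uminus)
  have "conv \<beta> a b \<bullet> b = (\<Sum>\<^sub>\<infinity>k. Re (cf (conv \<beta> a b) k * cnj (cf b k)))"
    unfolding inner_coeffs_def by (simp add: inner_complex_def)
  also have "\<dots> = (\<Sum>\<^sub>\<infinity>k\<in>M_freq. Re (cf (conv \<beta> a b) k * cnj (cf b k)))"
    by (rule infsum_cong_neutral) (auto simp: cf_outside)
  also have "\<dots> = (\<Sum>\<^sub>\<infinity>k\<in>M_freq. Re (\<Sum>\<^sub>\<infinity>h\<in>nbr k. ?T (k, h)))"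
    by (intro infsum_cong) (simp add: cf_conv sum_distrib_right finite_nbr)
  also have "\<dots> = Re (\<Sum>\<^sub>\<infinity>k\<in>M_freq. \<Sum>\<^sub>\<infinity>h\<in>nbr k. ?T (k, h))"
    by (rule infsum_Re) (rule summable_on_Sigma_banach[of "\<lambda>k h. ?T (k, h)"], use trilinear_summable in simp)
  also have "(\<Sum>\<^sub>\<infinity>k\<in>M_freq. \<Sum>\<^sub>\<infinity>h\<in>nbr k. ?T (k, h)) = infsum ?T ?S"
    using infsum_Sigma'_banach[of "\<lambda>k h. ?T (k, h)" M_freq nbr] trilinear_summable by simp
  finally show ?thesis by (simp add: zero)
qed

end

section \<open>Fourier coefficients on the torus\<close>

definition expi :: "int^3 \<Rightarrow> real^3 \<Rightarrow> complex" where
  "expi k x = exp (2 * of_real pi * \<i> * of_real (rvec k \<bullet> x))"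

lemma expi_add: "expi (h + k) x = expi h x * expi k x"
  by (simp add: expi_def rvec_add inner_add_left distrib_left exp_add)

lemma expi_zero [simp]: "expi 0 x = 1"
  by (simp add: expi_def rvec_zero)

lemma expi_cis: "expi k x = cis (2 * pi * (rvec k \<bullet> x))"
  by (simp add: expi_def cis_conv_exp mult_ac)

lemma norm_expi [simp]: "cmod (expi k x) = 1"
  by (simp add: expi_cis)

lemma expi_uminus: "expi (- k) x = cnj (expi k x)"
  by (simp add: expi_cis rvec_uminus cis_cnj)

lemma fourier_scalar_expi: "fourier_scalar f k = (LINT x|torus. of_real (f x) * expi (- k) x)"
  by (simp add: fourier_scalar_def expi_def rvec_uminus)

lemma expi_periodic: "expi k (x + rvec j) = expi k x"
proof -
  have "rvec k \<bullet> rvec j = of_int (\<Sum>i\<in>UNIV. k $ i * j $ i)"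
    by (simp add: inner_vec_def rvec_def)
  then have "cis (2 * pi * (rvec k \<bullet> rvec j)) = 1"
    by (simp only: cis_multiple_2pi[OF Ints_of_int])
  then show ?thesis
    by (simp add: expi_cis inner_add_right distrib_left flip: cis_mult)
qed

lemma continuous_on_expi [continuous_intros]: "continuous_on S (expi k)"
  unfolding expi_def by (intro continuous_intros)

lemma finite_measure_torus: "finite_measure torus"
  unfolding torus_def by (intro finite_measure_lebesgue_on lmeasurable_cbox)

lemma borel_measurable_torus: "g \<in> borel_measurable borel \<Longrightarrow> g \<in> borel_measurable torus"
  unfolding torus_def by (intro measurable_restrict_space1 measurable_completion) simp

lemma continuous_measurable_torus:
  fixes g :: "real^3 \<Rightarrow> 'b::{second_countable_topology, topological_space}"
  shows "continuous_on UNIV g \<Longrightarrow> g \<in> borel_measurable torus"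
  by (intro borel_measurable_torus borel_measurable_continuous_onI)

lemma expi_measurable [measurable]: "expi k \<in> borel_measurable torus"
  by (intro continuous_measurable_torus continuous_intros)

text \<open>\<open>torus\<close> carries the completed measure, whereas Fubini is applied to
  \<open>lborel\<close>; for Borel integrands the integrals coincide.\<close>

lemma integral_torus_lborel:
  fixes g :: "real^3 \<Rightarrow> 'b::{banach, second_countable_topology}"
  assumes g: "g \<in> borel_measurable borel"
  shows "integral\<^sup>L torus g = (LINT x|lborel. indicator (cbox 0 1) x *\<^sub>R g x)"
  unfolding torus_def using g by (subst integral_restrict_space) (auto simp: integral_completion)

lemma integral_lborel_prod:
  fixes f :: "'a::euclidean_space \<Rightarrow> real \<Rightarrow> complex"
  assumes f: "\<And>b. b \<in> Basis \<Longrightarrow> integrable lborel (f b)"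
  shows "(LINT x|lborel. (\<Prod>b\<in>Basis. f b (x \<bullet> b))) = (\<Prod>b\<in>Basis. integral\<^sup>L lborel (f b))"
proof -
  interpret product_sigma_finite "\<lambda>_::'a. lborel :: real measure" ..
  have [measurable]: "f b \<in> borel_measurable borel" if "b \<in> Basis" for b
    using f[OF that] by (simp add: borel_measurable_integrable)
  have "(LINT x|lborel. (\<Prod>b\<in>Basis. f b (x \<bullet> b)))
      = (LINT p|(\<Pi>\<^sub>M b\<in>Basis. lborel). (\<Prod>b\<in>Basis. f b ((\<Sum>b\<in>Basis. p b *\<^sub>R b) \<bullet> b)))"
    by (subst lborel_eq, subst integral_distr) (auto simp: measurable_compose[OF _ borel_measurable_integrable[OF f]])
  also have "\<dots> = (LINT p|(\<Pi>\<^sub>M b\<in>Basis. lborel). (\<Prod>b\<in>Basis. f b (p b)))"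
    by (intro Bochner_Integration.integral_cong prod.cong refl) simp
  also have "\<dots> = (\<Prod>b\<in>Basis. integral\<^sup>L lborel (f b))"
    by (rule product_integral_prod) (auto intro: f)
  finally show ?thesis .
qed

lemma integral_exp_unit_interval:
  fixes m :: int
  shows "has_bochner_integral lborel (\<lambda>t. indicator {0..1} t *\<^sub>R exp (2 * of_real pi * \<i> * of_real (of_int m * t)))
           (if m = 0 then 1 else 0 :: complex)"
proof (cases "m = 0")
  case True
  have "has_bochner_integral lborel (\<lambda>t::real. indicator {0..1} t *\<^sub>R (1::complex)) (of_real 1 - of_real 0)"
    by (intro has_bochner_integral_FTC_Icc continuous_intros)
      (auto intro!: derivative_eq_intros)
  then show ?thesis using True by simp
next
  case False
  let ?c = "2 * of_real pi * \<i> * of_int m :: complex"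
  have c: "?c \<noteq> 0" using False by simp
  have "((\<lambda>t::real. exp (?c * of_real t) / ?c) has_vector_derivative exp (?c * of_real t)) (at t within {0..1})" for t
  proof -
    have "((\<lambda>z. exp (?c * z) / ?c) has_field_derivative exp (?c * of_real t)) (at (of_real t))"
      using c by (auto intro!: derivative_eq_intros)
    then show ?thesis
      by (rule has_vector_derivative_real_field[THEN has_vector_derivative_at_within])
  qed
  then have "has_bochner_integral lborel (\<lambda>t. indicator {0..1} t *\<^sub>R exp (?c * of_real t))
      (exp (?c * of_real 1) / ?c - exp (?c * of_real 0) / ?c)"
    by (intro has_bochner_integral_FTC_Icc continuous_intros) auto
  moreover have "exp ?c = 1"
    using exp_integer_2pi[of "of_int m"] by (simp add: mult_ac)
  ultimately show ?thesis using False by (simp add: mult_ac)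
qed

text \<open>Characters and the indicator of the cube factor over the coordinates, and a coordinate
  with \<open>k $ i \<noteq> 0\<close> contributes an integral over full periods.\<close>

lemma integral_expi: "integral\<^sup>L torus (expi k) = (if k = 0 then 1 else 0)"
proof -
  let ?f = "\<lambda>b t. indicator {0..1} t *\<^sub>R exp (2 * of_real pi * \<i> * of_real ((rvec k \<bullet> b) * t)) :: complex"
  have hb: "has_bochner_integral lborel (?f b) (if rvec k \<bullet> b = 0 then 1 else 0)" if "b \<in> Basis" for b
  proof -
    from that obtain i where b: "b = axis i 1" by (auto simp: Basis_vec_def)
    have "rvec k \<bullet> b = of_int (k $ i)" by (simp add: b inner_axis rvec_def)
    then show ?thesis using integral_exp_unit_interval[of "k $ i"] by simp
  qed
  have "integral\<^sup>L torus (expi k) = (LINT x|lborel. indicator (cbox 0 1) x *\<^sub>R expi k x)"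
    by (intro integral_torus_lborel borel_measurable_continuous_onI continuous_intros)
  also have "\<dots> = (LINT x|lborel. (\<Prod>b\<in>Basis. ?f b (x \<bullet> b)))"
  proof (rule Bochner_Integration.integral_cong[OF refl])
    fix x :: "real^3"
    have one: "(1 :: real^3) \<bullet> b = 1" if "b \<in> Basis" for b
      using that by (auto simp: Basis_vec_def inner_axis)
    have "(indicator (cbox 0 1) x :: real) = (\<Prod>b\<in>Basis. indicator {0..1} (x \<bullet> b))"
      by (auto simp: indicator_def mem_box one prod_zero_iff)
    moreover have "expi k x = (\<Prod>b\<in>Basis. exp (2 * of_real pi * \<i> * of_real ((rvec k \<bullet> b) * (x \<bullet> b))))"
      unfolding expi_def by (subst euclidean_inner) (simp add: exp_sum[symmetric] sum_distrib_left)
    ultimately show "indicator (cbox 0 1) x *\<^sub>R expi k x = (\<Prod>b\<in>Basis. ?f b (x \<bullet> b))"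
      by (simp add: scaleR_conv_of_real prod.distrib)
  qed
  also have "\<dots> = (\<Prod>b\<in>Basis. integral\<^sup>L lborel (?f b))"
    by (rule integral_lborel_prod) (use hb has_bochner_integral_iff in blast)
  also have "\<dots> = (\<Prod>b\<in>(Basis :: (real^3) set). if rvec k \<bullet> b = 0 then 1 else 0)"
    by (intro prod.cong refl) (use hb has_bochner_integral_integral_eq in blast)
  also have "\<dots> = (if k = 0 then 1 else 0)"
  proof (cases "k = 0")
    case False
    then obtain i where "k $ i \<noteq> 0" by (auto simp: vec_eq_iff)
    then have "rvec k \<bullet> axis i 1 \<noteq> 0" by (simp add: inner_axis rvec_def)
    moreover have "axis i 1 \<in> (Basis :: (real^3) set)" by (auto simp: Basis_vec_def)
    ultimately show ?thesis using False by (auto simp: prod_zero_iff)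
  qed (simp add: rvec_zero)
  finally show ?thesis .
qed

lemma integrable_mult_bounded:
  fixes f :: "'a \<Rightarrow> real" and g :: "'a \<Rightarrow> complex"
  assumes f: "integrable M f" and g: "g \<in> borel_measurable M" and b: "\<And>x. x \<in> space M \<Longrightarrow> cmod (g x) \<le> C"
  shows "integrable M (\<lambda>x. of_real (f x) * g x)"
proof (rule Bochner_Integration.integrable_bound)
  show "integrable M (\<lambda>x. C * f x)" using f by simp
  show "(\<lambda>x. of_real (f x) * g x) \<in> borel_measurable M"
    using f g by (intro borel_measurable_times borel_measurable_of_real) auto
  show "AE x in M. norm (of_real (f x) * g x) \<le> norm (C * f x)"
  proof (rule AE_I2)
    fix x assume "x \<in> space M"
    then have "\<bar>f x\<bar> * cmod (g x) \<le> \<bar>f x\<bar> * \<bar>C\<bar>"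
      using b[of x] by (intro mult_left_mono) auto
    then show "norm (of_real (f x) * g x) \<le> norm (C * f x)"
      by (simp add: norm_mult abs_mult mult.commute)
  qed
qed

section \<open>Uniqueness of Fourier coefficients\<close>

text \<open>Orthogonality of \<open>f\<close> to \<open>\<phi>\<close> times every character.
  Quantifying over all \<open>k\<close> makes the class of such \<open>\<phi>\<close> stable under
  multiplication by trigonometric polynomials.\<close>

definition annihilates :: "(real^3 \<Rightarrow> real) \<Rightarrow> (real^3 \<Rightarrow> real) \<Rightarrow> bool" where
  "annihilates f \<phi> \<longleftrightarrow> \<phi> \<in> borel_measurable torus \<and> (\<exists>C. \<forall>x. \<bar>\<phi> x\<bar> \<le> C) \<and>
     (\<forall>k. (LINT x|torus. of_real (f x) * (of_real (\<phi> x) * expi k x)) = 0)"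

lemma annihilates_integrable:
  assumes "integrable torus f" "\<phi> \<in> borel_measurable torus" "\<And>x. \<bar>\<phi> x\<bar> \<le> C"
  shows "integrable torus (\<lambda>x. of_real (f x) * (of_real (\<phi> x) * expi k x))"
  using assms by (intro integrable_mult_bounded[where C=C]) (auto simp: norm_mult)

lemma annihilates_add:
  assumes f: "integrable torus f" and "annihilates f \<phi>" "annihilates f \<psi>"
  shows "annihilates f (\<lambda>x. \<phi> x + \<psi> x)"
proof -
  obtain C D where CD: "\<And>x. \<bar>\<phi> x\<bar> \<le> C" "\<And>x. \<bar>\<psi> x\<bar> \<le> D"
    and [measurable]: "\<phi> \<in> borel_measurable torus" "\<psi> \<in> borel_measurable torus"
    using assms(2,3) by (auto simp: annihilates_def)
  have "(LINT x|torus. of_real (f x) * (of_real (\<phi> x + \<psi> x) * expi k x)) = 0" for k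
  proof -
    have "(LINT x|torus. of_real (f x) * (of_real (\<phi> x + \<psi> x) * expi k x)) =
        (LINT x|torus. of_real (f x) * (of_real (\<phi> x) * expi k x) + of_real (f x) * (of_real (\<psi> x) * expi k x))"
      by (simp add: algebra_simps)
    also have "\<dots> = 0"
      using assms(2,3) CD by (subst Bochner_Integration.integral_add)
        (auto simp: annihilates_def intro!: annihilates_integrable[OF f])
    finally show ?thesis .
  qed
  moreover have "\<bar>\<phi> x + \<psi> x\<bar> \<le> C + D" for x
    using CD[of x] by linarith
  ultimately show ?thesis by (auto simp: annihilates_def)
qed

lemma annihilates_cmult:
  assumes "annihilates f \<phi>" shows "annihilates f (\<lambda>x. \<phi> x * c)"
proof -
  obtain C where C: "\<And>x. \<bar>\<phi> x\<bar> \<le> C" and [measurable]: "\<phi> \<in> borel_measurable torus"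
    using assms by (auto simp: annihilates_def)
  have "(LINT x|torus. of_real (f x) * (of_real (\<phi> x * c) * expi k x)) = 0" for k
  proof -
    have "(LINT x|torus. of_real (f x) * (of_real (\<phi> x * c) * expi k x)) =
        (LINT x|torus. of_real c * (of_real (f x) * (of_real (\<phi> x) * expi k x)))"
      by (simp add: mult_ac)
    then show ?thesis using assms by (simp add: annihilates_def)
  qed
  moreover have "\<bar>\<phi> x * c\<bar> \<le> C * \<bar>c\<bar>" for x
    using C[of x] by (simp add: abs_mult mult_right_mono)
  ultimately show ?thesis by (auto simp: annihilates_def)
qed

text \<open>A cosine of period 1 centred at \<open>r\<close>: at suitable heights its superlevel
  sets cut slabs out of the unit cube.\<close>

definition wave :: "3 \<Rightarrow> real \<Rightarrow> real^3 \<Rightarrow> real" where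
  "wave i r x = cos (2 * pi * (x $ i - r))"

lemma wave_measurable [measurable]: "wave i r \<in> borel_measurable torus"
  unfolding wave_def by (intro continuous_measurable_torus continuous_intros)

lemma wave_expi:
  "complex_of_real (wave i r x) = (cis (- (2 * pi * r)) * expi (axis i 1) x + cis (2 * pi * r) * expi (- axis i 1) x) / 2"
proof -
  have "rvec (axis i 1) = axis i 1" by (auto simp: rvec_def axis_def vec_eq_iff)
  then have r: "rvec (axis i 1) \<bullet> x = x $ i" by (simp add: inner_axis inner_commute)
  have e: "expi (axis i 1) x = cis (2 * pi * x $ i)" by (simp add: expi_cis r)
  have "cis (- (2 * pi * r)) * expi (axis i 1) x = cis (2 * pi * (x $ i - r))"
    by (simp add: e cis_mult right_diff_distrib)
  moreover have "cis (2 * pi * r) * expi (- axis i 1) x = cis (- (2 * pi * (x $ i - r)))"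
    by (simp add: expi_uminus e cis_cnj cis_mult right_diff_distrib)
  ultimately show ?thesis
    by (simp only: wave_def) (simp add: complex_eq_iff)
qed

text \<open>By Euler's formula the factor shifts the frequency by a unit vector in either direction,
  and \<open>annihilates\<close> covers all frequencies.\<close>

lemma annihilates_wave:
  assumes f: "integrable torus f" and \<phi>: "annihilates f \<phi>"
  shows "annihilates f (\<lambda>x. \<phi> x * wave i r x)"
proof -
  obtain C where C: "\<And>x. \<bar>\<phi> x\<bar> \<le> C" and m[measurable]: "\<phi> \<in> borel_measurable torus"
    using \<phi> by (auto simp: annihilates_def)
  have "(LINT x|torus. of_real (f x) * (of_real (\<phi> x * wave i r x) * expi k x)) = 0" for k
  proof -
    let ?I = "\<lambda>k x. of_real (f x) * (of_real (\<phi> x) * expi k x)"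
    have "of_real (f x) * (of_real (\<phi> x * wave i r x) * expi k x) =
        cis (- (2 * pi * r)) / 2 * ?I (k + axis i 1) x + cis (2 * pi * r) / 2 * ?I (k + - axis i 1) x" for x
      unfolding of_real_mult wave_expi expi_add by (simp add: algebra_simps add_divide_distrib)
    moreover have "integrable torus (?I k)" for k
      by (rule annihilates_integrable[OF f m C])
    ultimately show ?thesis
      using \<phi> by (simp add: annihilates_def)
  qed
  moreover have "\<bar>\<phi> x * wave i r x\<bar> \<le> C" for x
    using mult_mono[OF C[of x], of "\<bar>wave i r x\<bar>" 1] C[of x] by (auto simp: abs_mult wave_def)
  ultimately show ?thesis by (auto simp: annihilates_def)
qed

text \<open>Induction with \<open>\<phi>\<close> arbitrary: for a product, the hypothesis for the
  second factor is applied with \<open>\<phi>\<close> already multiplied by the first.\<close>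

lemma annihilates_polynomial:
  fixes p :: "real \<Rightarrow> real"
  assumes f: "integrable torus f" and p: "real_polynomial_function p" and \<phi>: "annihilates f \<phi>"
  shows "annihilates f (\<lambda>x. \<phi> x * p (wave i r x))"
  using p \<phi>
proof (induction p arbitrary: \<phi> rule: real_polynomial_function.induct)
  case (linear p)
  then have "p y = y * p 1" for y
    using linear_scale[OF bounded_linear.linear[OF linear(1)], of y 1] by simp
  then have "(\<lambda>x. \<phi> x * p (wave i r x)) = (\<lambda>x. \<phi> x * wave i r x * p 1)"
    by (metis mult.assoc)
  then show ?case
    using annihilates_cmult[OF annihilates_wave[OF f linear(2), of i r], of "p 1"] by simp
next
  case (const c)
  then show ?case by (rule annihilates_cmult)
next
  case (add p q)
  then show ?case
    using annihilates_add[OF f add(3)[OF add(5)] add(4)[OF add(5)]] by (simp add: distrib_left)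
next
  case (mult p q)
  then show ?case
    using mult(4)[OF mult(3)[OF mult(5)]] by (simp add: mult.assoc)
qed

lemma annihilates_limit:
  assumes f: "integrable torus f" and \<phi>: "\<And>n. annihilates f (\<phi> n)"
    and C: "\<And>n x. \<bar>\<phi> n x\<bar> \<le> C" and lim: "\<And>x. (\<lambda>n. \<phi> n x) \<longlonglongrightarrow> \<psi> x"
  shows "annihilates f \<psi>"
proof -
  have m[measurable]: "\<phi> n \<in> borel_measurable torus" for n
    using \<phi> by (simp add: annihilates_def)
  have ms: "\<psi> \<in> borel_measurable torus"
    by (rule borel_measurable_LIMSEQ_metric[OF m lim])
  have C': "\<bar>\<psi> x\<bar> \<le> C" for x
    by (rule LIMSEQ_le_const2[OF tendsto_rabs[OF lim]]) (use C in auto)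
  have "(LINT x|torus. of_real (f x) * (of_real (\<psi> x) * expi k x)) = 0" for k
  proof -
    have "(\<lambda>n. LINT x|torus. of_real (f x) * (of_real (\<phi> n x) * expi k x))
        \<longlonglongrightarrow> (LINT x|torus. of_real (f x) * (of_real (\<psi> x) * expi k x))"
    proof (rule integral_dominated_convergence)
      show "(\<lambda>x. of_real (f x) * (of_real (\<psi> x) * expi k x)) \<in> borel_measurable torus"
        by (rule borel_measurable_integrable[OF annihilates_integrable[OF f ms C']])
      show "(\<lambda>x. of_real (f x) * (of_real (\<phi> n x) * expi k x)) \<in> borel_measurable torus" for n
        by (rule borel_measurable_integrable[OF annihilates_integrable[OF f m C]])
      show "integrable torus (\<lambda>x. C * \<bar>f x\<bar>)" using f by simp
      show "AE x in torus. (\<lambda>n. of_real (f x) * (of_real (\<phi> n x) * expi k x))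
          \<longlonglongrightarrow> of_real (f x) * (of_real (\<psi> x) * expi k x)"
        by (intro AE_I2 tendsto_intros lim)
      show "AE x in torus. norm (of_real (f x) * (of_real (\<phi> n x) * expi k x)) \<le> C * \<bar>f x\<bar>" for n
        by (rule AE_I2) (use mult_right_mono[OF C abs_ge_zero] in \<open>simp add: norm_mult mult.commute\<close>)
    qed
    then show ?thesis
      using \<phi> by (simp add: annihilates_def LIMSEQ_const_iff)
  qed
  then show ?thesis using ms C' by (auto simp: annihilates_def)
qed

text \<open>The indicator of \<open>{d<..}\<close> is a bounded pointwise limit of continuous functions on \<open>{-1..1}\<close>,
  hence, by Weierstrass, of polynomials.\<close>

lemma annihilates_wave_gt:
  assumes f: "integrable torus f" and \<phi>: "annihilates f \<phi>"
  shows "annihilates f (\<lambda>x. \<phi> x * indicator {x. d < wave i r x} x)"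
proof -
  \<comment> \<open>A ramp rising from 0 at \<open>d\<close> to 1 at \<open>d + 1 / n\<close>. Being
    0 at \<open>d\<close> itself, it converges to the indicator of the open half-line.\<close>
  define G where "G n y = min 1 (max 0 (real n * (y - d)))" for n y
  have "\<exists>p. real_polynomial_function p \<and> (\<forall>y\<in>{-1..1}. \<bar>G n y - p y\<bar> < 1 / Suc n)" for n
  proof -
    have "continuous_on {-1..1} (G n)" unfolding G_def by (intro continuous_intros)
    then obtain p where "real_polynomial_function p" "\<And>y. y \<in> {-1..1} \<Longrightarrow> \<bar>G n y - p y\<bar> < 1 / Suc n"
      using Stone_Weierstrass_real_polynomial_function[of "{-1..1::real}" "G n" "1 / Suc n"] by auto
    then show ?thesis by blast
  qed
  then obtain p where p: "\<And>n. real_polynomial_function (p n)"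
    and pG: "\<And>n y. y \<in> {-1..1} \<Longrightarrow> \<bar>G n y - p n y\<bar> < 1 / Suc n"
    by metis
  obtain C where C: "\<And>x. \<bar>\<phi> x\<bar> \<le> C"
    using \<phi> by (auto simp: annihilates_def)
  have C0: "0 \<le> C" using C[of 0] by linarith
  have w: "wave i r x \<in> {-1..1}" for x by (simp add: wave_def)
  have limG: "(\<lambda>n. G n y) \<longlonglongrightarrow> indicator {d<..} y" for y
  proof (cases "d < y")
    case True
    obtain N where N: "1 / (y - d) \<le> real N" using real_arch_simple by blast
    have "G n y = 1" if "n \<ge> N" for n
    proof -
      have "1 / (y - d) \<le> real n" using N that by linarith
      then show ?thesis using True by (simp add: G_def field_simps)
    qed
    then have "eventually (\<lambda>n. G n y = 1) sequentially"
      by (auto simp: eventually_sequentially)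
    then show ?thesis using True tendsto_eventually by force
  next
    case False
    then have "real n * (y - d) \<le> 0" for n by (simp add: mult_nonneg_nonpos)
    then have "G n y = 0" for n by (simp add: G_def max_absorb1)
    then show ?thesis using False by simp
  qed
  show ?thesis
  proof (rule annihilates_limit[OF f annihilates_polynomial[OF f p \<phi>]])
    fix n x
    have "\<bar>p n (wave i r x)\<bar> \<le> 2"
    proof -
      have "1 / real (Suc n) \<le> 1" by simp
      moreover have "0 \<le> G n (wave i r x)" "G n (wave i r x) \<le> 1" by (auto simp: G_def)
      ultimately show ?thesis using pG[OF w, of n x] by linarith
    qed
    then show "\<bar>\<phi> x * p n (wave i r x)\<bar> \<le> C * 2"
      unfolding abs_mult using C C0 by (intro mult_mono) auto
  next
    fix x
    have "(\<lambda>n. p n (wave i r x) - G n (wave i r x)) \<longlonglongrightarrow> 0"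
    proof (rule Lim_null_comparison)
      show "\<forall>\<^sub>F n in sequentially. norm (p n (wave i r x) - G n (wave i r x)) \<le> 1 / Suc n"
        using pG[OF w] by (intro always_eventually allI) (simp add: abs_minus_commute less_imp_le)
      show "(\<lambda>n. 1 / real (Suc n)) \<longlonglongrightarrow> 0" using LIMSEQ_inverse_real_of_nat by (simp add: inverse_eq_divide)
    qed
    from tendsto_add[OF this limG[of "wave i r x"]]
    have "(\<lambda>n. p n (wave i r x)) \<longlonglongrightarrow> indicator {d<..} (wave i r x)" by simp
    then show "(\<lambda>n. \<phi> x * p n (wave i r x)) \<longlonglongrightarrow> \<phi> x * indicator {x. d < wave i r x} x"
      by (intro tendsto_intros) (simp add: indicator_def)
  qed
qed

section \<open>Indicators of slabs, boxes and Borel sets\<close>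

lemma mem_space_torus: "x \<in> space torus \<Longrightarrow> 0 \<le> x $ i \<and> x $ i \<le> 1"
  by (simp add: torus_def space_restrict_space mem_box_cart)

lemma AE_torus_negligible: "negligible N \<Longrightarrow> AE x in torus. x \<notin> N"
  unfolding torus_def negligible_iff_null_sets
  by (subst AE_restrict_space_iff) (auto intro: AE_mp[OF AE_not_in])

lemma AE_torus_coordinate: "AE x in torus. x $ i \<noteq> c"
proof -
  have "negligible {x::real^3. x \<bullet> axis i 1 = c}"
    by (rule negligible_standard_hyperplane) (auto simp: Basis_vec_def)
  then show ?thesis
    using AE_torus_negligible[of "{x::real^3. x \<bullet> axis i 1 = c}"] by (simp add: inner_axis)
qed

lemma annihilates_cong_AE:
  assumes \<phi>: "annihilates f \<phi>" and f: "f \<in> borel_measurable torus"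
    and \<psi>: "\<psi> \<in> borel_measurable torus" "\<And>x. \<bar>\<psi> x\<bar> \<le> C"
    and eq: "AE x in torus. \<phi> x = \<psi> x"
  shows "annihilates f \<psi>"
proof -
  have [measurable]: "\<phi> \<in> borel_measurable torus" "\<psi> \<in> borel_measurable torus" "f \<in> borel_measurable torus"
    using assms by (auto simp: annihilates_def)
  have "(LINT x|torus. of_real (f x) * (of_real (\<psi> x) * expi k x))
      = (LINT x|torus. of_real (f x) * (of_real (\<phi> x) * expi k x))" for k
    by (rule integral_cong_AE) (use eq in \<open>auto elim: eventually_mono\<close>)
  then show ?thesis using \<phi> \<psi> by (auto simp: annihilates_def)
qed

text \<open>The cosine decreases on half a period. For \<open>\<bar>t\<bar> > 1 / 2\<close>,
  reflection at the half period gives \<open>1 - \<bar>t\<bar> \<ge> \<rho>\<close>, and both sides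
  are false.\<close>

lemma cos_2pi_less_iff:
  assumes "0 < \<rho>" "\<rho> \<le> 1 / 2" "\<bar>t\<bar> \<le> 1 - \<rho>"
  shows "cos (2 * pi * \<rho>) < cos (2 * pi * t) \<longleftrightarrow> \<bar>t\<bar> < \<rho>"
proof -
  have c: "cos (2 * pi * t) = cos (2 * pi * \<bar>t\<bar>)"
    by (cases "t \<ge> 0") auto
  have mono: "cos (2 * pi * \<rho>) < cos (2 * pi * s) \<longleftrightarrow> s < \<rho>" if "0 \<le> s" "s \<le> 1 / 2" for s
    using that assms by (subst cos_mono_less_eq) (auto simp: field_simps)
  show ?thesis
  proof (cases "\<bar>t\<bar> \<le> 1 / 2")
    case False
    have "cos (2 * pi * \<bar>t\<bar>) = cos (2 * pi * (1 - \<bar>t\<bar>))"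
      by (simp add: right_diff_distrib cos_diff)
    then show ?thesis
      using mono[of "1 - \<bar>t\<bar>"] False assms by (auto simp: c)
  qed (simp add: c mono)
qed

text \<open>Clipped to the unit interval, \<open>{a<..<b}\<close> has midpoint \<open>r\<close> and
  half-length \<open>\<rho>\<close>, and up to a null set of the cube it is the superlevel set of
  \<open>wave i r\<close> at height \<open>cos (2 * pi * \<rho>)\<close>.\<close>

lemma annihilates_interval:
  assumes f: "integrable torus f" and \<phi>: "annihilates f \<phi>"
  shows "annihilates f (\<lambda>x. \<phi> x * indicator {x. a < x $ i \<and> x $ i < b} x)"
proof -
  define a' b' where "a' = max a 0" and "b' = min b 1"
  have fm: "f \<in> borel_measurable torus" using f by simp
  obtain C where C: "\<And>x. \<bar>\<phi> x\<bar> \<le> C" and [measurable]: "\<phi> \<in> borel_measurable torus"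
    using \<phi> by (auto simp: annihilates_def)
  have ind: "indicator {x::real^3. a < x $ i \<and> x $ i < b} \<in> borel_measurable torus"
    by (intro borel_measurable_torus borel_measurable_indicator borel_open open_Collect_conj
        open_Collect_less continuous_intros)
  have m: "(\<lambda>x. \<phi> x * indicator {x. a < x $ i \<and> x $ i < b} x) \<in> borel_measurable torus"
    using ind by (intro borel_measurable_times) auto
  have bd: "\<bar>\<phi> x * indicator {x. a < x $ i \<and> x $ i < b} x\<bar> \<le> C" for x
    using C[of x] by (auto simp: indicator_def)
  have ae: "AE x in torus. 0 < x $ i \<and> x $ i < 1"
    using AE_torus_coordinate[of i 0] AE_torus_coordinate[of i 1] AE_space
    by eventually_elim (use mem_space_torus in \<open>auto simp: order_less_le\<close>)
  show ?thesis
  proof (cases "a' < b'")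
    case True
    define r \<rho> where "r = (a' + b') / 2" and "\<rho> = (b' - a') / 2"
    have ab: "0 \<le> a'" "b' \<le> 1" by (auto simp: a'_def b'_def)
    show ?thesis
    proof (rule annihilates_cong_AE[OF annihilates_wave_gt[OF f \<phi>, of "cos (2 * pi * \<rho>)" i r] fm m bd])
      show "AE x in torus. \<phi> x * indicator {x. cos (2 * pi * \<rho>) < wave i r x} x
          = \<phi> x * indicator {x. a < x $ i \<and> x $ i < b} x"
        using ae
      proof eventually_elim
        fix x :: "real^3" assume x: "0 < x $ i \<and> x $ i < 1"
        have "cos (2 * pi * \<rho>) < wave i r x \<longleftrightarrow> \<bar>x $ i - r\<bar> < \<rho>"
          unfolding wave_def using True x ab by (intro cos_2pi_less_iff) (auto simp: r_def \<rho>_def field_simps abs_le_iff)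
        also have "\<dots> \<longleftrightarrow> a' < x $ i \<and> x $ i < b'"
          by (auto simp: r_def \<rho>_def field_simps abs_less_iff)
        also have "\<dots> \<longleftrightarrow> a < x $ i \<and> x $ i < b"
          using x by (auto simp: a'_def b'_def)
        finally show "\<phi> x * indicator {x. cos (2 * pi * \<rho>) < wave i r x} x
          = \<phi> x * indicator {x. a < x $ i \<and> x $ i < b} x" by (simp add: indicator_def)
      qed
    qed
  next
    case False
    show ?thesis
    proof (rule annihilates_cong_AE[OF annihilates_cmult[OF \<phi>, of 0] fm m bd])
      show "AE x in torus. \<phi> x * 0 = \<phi> x * indicator {x. a < x $ i \<and> x $ i < b} x"
        using ae by eventually_elim (use False in \<open>auto simp: a'_def b'_def indicator_def\<close>)
    qed
  qed
qed

lemma annihilates_box: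
  assumes f: "integrable torus f" and zero: "\<And>k. fourier_scalar f k = 0"
  shows "annihilates f (indicator (box a b))"
proof -
  have one: "annihilates f (\<lambda>x. 1)"
    using zero[of "- _"] by (auto simp: annihilates_def fourier_scalar_expi)
  have "(indicator (box a b) :: _ \<Rightarrow> real) = (\<lambda>x. 1 * indicator {x. a $ 1 < x $ 1 \<and> x $ 1 < b $ 1} x
      * indicator {x. a $ 2 < x $ 2 \<and> x $ 2 < b $ 2} x * indicator {x. a $ 3 < x $ 3 \<and> x $ 3 < b $ 3} x)"
    by (auto simp: indicator_def mem_box_cart forall_3)
  then show ?thesis
    using annihilates_interval[OF f annihilates_interval[OF f annihilates_interval[OF f one, of "a $ 1" 1 "b $ 1"],
      of "a $ 2" 2 "b $ 2"], of "a $ 3" 3 "b $ 3"] by simp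
qed

text \<open>Boxes are stable under intersection and generate the Borel sets, so Dynkin's argument
  applies. Complements use that the total integral of \<open>f\<close> is its coefficient at
  0.\<close>

lemma set_integral_borel_zero:
  assumes f: "integrable torus f" and zero: "\<And>k. fourier_scalar f k = 0" and A: "A \<in> sets borel"
  shows "(LINT x:A \<inter> cbox 0 1|torus. f x) = 0"
proof -
  have st: "A \<inter> cbox 0 1 \<in> sets torus" if "A \<in> sets borel" for A
    using that by (auto simp: torus_def sets_restrict_space)
  have si: "set_integrable torus (A \<inter> cbox 0 1) f" if "A \<in> sets borel" for A
    using integrable_mult_indicator[OF st[OF that] f] by (simp add: set_integrable_def)
  have sp: "space torus = cbox 0 1"
    by (simp add: torus_def space_restrict_space)
  let ?G = "range (\<lambda>(a, b). box a b :: (real^3) set)"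
  have "Int_stable ?G"
    by (auto simp: Int_stable_def box_Int_box)
  moreover have "?G \<subseteq> Pow UNIV" by simp
  moreover have "A \<in> sigma_sets UNIV ?G"
    using A by (simp add: borel_eq_box)
  ultimately show ?thesis
  proof (induction rule: sigma_sets_induct_disjoint)
    case (basic B)
    then obtain a b where B: "B = box a b" by auto
    have "(LINT x|torus. of_real (f x) * (of_real (indicator B x) * expi 0 x)) = 0"
      using annihilates_box[OF f zero] unfolding annihilates_def B by blast
    then have "complex_of_real (LINT x|torus. f x * indicator B x) = 0"
      by (simp flip: of_real_mult integral_complex_of_real)
    then have "(LINT x|torus. f x * indicator B x) = 0" by simp
    then show "(LINT x:B \<inter> cbox 0 1|torus. f x) = 0"
      unfolding set_lebesgue_integral_def
      by (subst Bochner_Integration.integral_cong[OF refl, of _ _ "\<lambda>x. f x * indicator B x"])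
        (auto simp: sp indicator_def)
  next
    case empty
    show ?case by (simp add: set_lebesgue_integral_def)
  next
    case (compl B)
    note B = compl(1) and IH = compl(2)
    have Bb: "B \<in> sets borel" using B by (simp add: borel_eq_box)
    have tot: "(LINT x|torus. f x) = 0"
      using zero[of 0] by (simp add: fourier_scalar_expi integral_complex_of_real)
    have "(LINT x:(UNIV - B) \<inter> cbox 0 1|torus. f x) = (LINT x|torus. f x - indicator (B \<inter> cbox 0 1) x *\<^sub>R f x)"
      unfolding set_lebesgue_integral_def
      by (rule Bochner_Integration.integral_cong) (auto simp: sp indicator_def)
    also have "\<dots> = 0"
      using f si[OF Bb] tot IH unfolding set_lebesgue_integral_def set_integrable_def
      by (subst Bochner_Integration.integral_diff) auto
    finally show "(LINT x:(UNIV - B) \<inter> cbox 0 1|torus. f x) = 0" .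
  next
    case (union B)
    note disj = union(1) and B = union(2) and IH = union(3)
    have Bb: "B i \<in> sets borel" for i using B by (auto simp: borel_eq_box)
    have U: "(\<Union>i. B i \<inter> cbox 0 1) = (\<Union>i. B i) \<inter> cbox 0 1" by auto
    have "(LINT x:(\<Union>i. B i \<inter> cbox 0 1)|torus. f x) = (\<Sum>i. LINT x:B i \<inter> cbox 0 1|torus. f x)"
    proof (rule lebesgue_integral_countable_add)
      show "set_integrable torus (\<Union>i. B i \<inter> cbox 0 1) f"
        unfolding U using Bb by (intro si) auto
      show "i \<noteq> j \<Longrightarrow> (B i \<inter> cbox 0 1) \<inter> (B j \<inter> cbox 0 1) = {}" for i j
        using disj by (auto simp: disjoint_family_on_def)
    qed (use st Bb in auto)
    then show "(LINT x:(\<Union>i. B i) \<inter> cbox 0 1|torus. f x) = 0"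
      unfolding U by (simp add: IH)
  qed
qed

theorem fourier_scalar_eq_0_imp_AE:
  assumes f: "integrable torus f" and zero: "\<And>k. fourier_scalar f k = 0"
  shows "AE x in torus. f x = 0"
proof (rule sigma_finite_measure.density_zero[OF finite_measure.axioms(1)[OF finite_measure_torus] f])
  fix A assume A: "A \<in> sets torus"
  then obtain S where S: "S \<in> sets lebesgue" "A = S \<inter> cbox 0 1"
    by (auto simp: torus_def sets_restrict_space)
  \<comment> \<open>A Lebesgue set differs from a Borel set by part of a null set, which reduces the
    claim to Borel sets.\<close>
  obtain B N N' where B: "S = B \<union> N" "N \<subseteq> N'" "N' \<in> null_sets lborel" "B \<in> sets lborel"
    using S(1) by (rule sets_completionE)
  have Bb: "B \<in> sets borel" using B by simp
  have "N' \<in> null_sets lebesgue" using B(3) by (rule null_sets_completionI)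
  then have "AE x in torus. x \<notin> N'"
    by (intro AE_torus_negligible) (simp add: negligible_iff_null_sets)
  then have "AE x in torus. indicator A x *\<^sub>R f x = indicator (B \<inter> cbox 0 1) x *\<^sub>R f x"
    by eventually_elim (use B(1,2) S(2) in \<open>auto simp: indicator_def\<close>)
  moreover have "B \<inter> cbox 0 1 \<in> sets torus" using Bb by (auto simp: torus_def sets_restrict_space)
  ultimately have "(LINT x:A|torus. f x) = (LINT x:B \<inter> cbox 0 1|torus. f x)"
    unfolding set_lebesgue_integral_def using A f
    by (intro integral_cong_AE borel_measurable_scaleR borel_measurable_indicator) auto
  then show "(LINT x:A|torus. f x) = 0"
    using set_integral_borel_zero[OF f zero Bb] by simp
qed

section \<open>Absolutely convergent Fourier series\<close>

lemma expi_series_uniform_limit: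
  assumes "(\<lambda>k. cmod (c k)) summable_on UNIV"
  shows "uniform_limit UNIV (\<lambda>F x. \<Sum>k\<in>F. c k * expi k x) (\<lambda>x. \<Sum>\<^sub>\<infinity>k. c k * expi k x) (finite_subsets_at_top UNIV)"
  by (rule Weierstrass_m_test_general[OF _ assms]) (simp add: norm_mult)

lemma continuous_on_expi_series:
  assumes "(\<lambda>k. cmod (c k)) summable_on UNIV"
  shows "continuous_on UNIV (\<lambda>x. \<Sum>\<^sub>\<infinity>k. c k * expi k x)"
  by (rule uniform_limit_theorem[OF _ expi_series_uniform_limit[OF assms]])
    (auto intro!: always_eventually continuous_intros)

lemma cmod_expi_series_le:
  assumes "(\<lambda>k. cmod (c k)) summable_on UNIV"
  shows "cmod (\<Sum>\<^sub>\<infinity>k. c k * expi k x) \<le> (\<Sum>\<^sub>\<infinity>k. cmod (c k))"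
  using norm_infsum_bound[of "\<lambda>k. c k * expi k x" UNIV] assms by (simp add: norm_mult)

lemma integrable_bounded_mult_complex:
  fixes g h :: "'a \<Rightarrow> complex"
  assumes "integrable M g" "h \<in> borel_measurable M" "\<And>x. cmod (h x) \<le> C"
  shows "integrable M (\<lambda>x. h x * g x)"
proof (rule Bochner_Integration.integrable_bound)
  show "integrable M (\<lambda>x. C * norm (g x))" using assms by simp
  show "(\<lambda>x. h x * g x) \<in> borel_measurable M" using assms by auto
  show "AE x in M. norm (h x * g x) \<le> norm (C * norm (g x))"
  proof (rule AE_I2)
    fix x
    have "cmod (h x) * cmod (g x) \<le> \<bar>C\<bar> * cmod (g x)"
      using assms(3)[of x] by (intro mult_right_mono) auto
    then show "norm (h x * g x) \<le> norm (C * norm (g x))"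
      by (simp add: norm_mult abs_mult)
  qed
qed

text \<open>The series converges uniformly along the finite sets of frequencies, so integration
  against an integrable \<open>g\<close> may be done term by term.\<close>

lemma has_sum_integral_expi_series:
  assumes c: "(\<lambda>k. cmod (c k)) summable_on UNIV" and g: "integrable torus g"
  shows "((\<lambda>k. c k * (LINT x|torus. expi k x * g x)) has_sum
           (LINT x|torus. (\<Sum>\<^sub>\<infinity>k. c k * expi k x) * g x)) UNIV"
  unfolding has_sum_def
proof (rule tendstoI)
  fix e :: real assume e: "0 < e"
  let ?S = "\<lambda>x. \<Sum>\<^sub>\<infinity>k. c k * expi k x"
  let ?I = "LINT x|torus. norm (g x)"
  have I0: "0 \<le> ?I" by simp
  have ik: "integrable torus (\<lambda>x. expi k x * g x)" for k
    by (rule integrable_bounded_mult_complex[OF g, where C=1]) auto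
  have iS: "integrable torus (\<lambda>x. ?S x * g x)"
    by (rule integrable_bounded_mult_complex[OF g continuous_measurable_torus[OF continuous_on_expi_series[OF c]]
        cmod_expi_series_le[OF c]])
  \<comment> \<open>The summand 1 avoids division by zero when \<open>g\<close> vanishes almost
    everywhere.\<close>
  have e': "0 < e / (?I + 1)" using e I0 by (intro divide_pos_pos add_nonneg_pos) auto
  show "\<forall>\<^sub>F F in finite_subsets_at_top UNIV.
      dist (\<Sum>k\<in>F. c k * (LINT x|torus. expi k x * g x)) (LINT x|torus. ?S x * g x) < e"
    using uniform_limitD[OF expi_series_uniform_limit[OF c] e']
  proof eventually_elim
    fix F assume F: "\<forall>x\<in>UNIV. dist (\<Sum>k\<in>F. c k * expi k x) (?S x) < e / (?I + 1)"
    have "(\<Sum>k\<in>F. c k * (LINT x|torus. expi k x * g x)) = (LINT x|torus. (\<Sum>k\<in>F. c k * (expi k x * g x)))"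
      using ik by (subst Bochner_Integration.integral_sum) auto
    then have "(\<Sum>k\<in>F. c k * (LINT x|torus. expi k x * g x)) - (LINT x|torus. ?S x * g x)
        = (LINT x|torus. (\<Sum>k\<in>F. c k * (expi k x * g x)) - ?S x * g x)"
      using ik iS by (subst Bochner_Integration.integral_diff) (auto intro!: Bochner_Integration.integrable_sum)
    also have "norm \<dots> \<le> (LINT x|torus. norm ((\<Sum>k\<in>F. c k * (expi k x * g x)) - ?S x * g x))"
      by (rule integral_norm_bound)
    also have "\<dots> \<le> (LINT x|torus. e / (?I + 1) * norm (g x))"
    proof (rule integral_mono)
      show "integrable torus (\<lambda>x. norm ((\<Sum>k\<in>F. c k * (expi k x * g x)) - ?S x * g x))"
        using ik iS by (intro integrable_norm Bochner_Integration.integrable_diff Bochner_Integration.integrable_sum) auto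
      show "integrable torus (\<lambda>x. e / (?I + 1) * norm (g x))" using g by simp
      fix x
      have "(\<Sum>k\<in>F. c k * (expi k x * g x)) - ?S x * g x = ((\<Sum>k\<in>F. c k * expi k x) - ?S x) * g x"
        by (simp add: sum_distrib_right left_diff_distrib mult.assoc)
      moreover have "norm ((\<Sum>k\<in>F. c k * expi k x) - ?S x) \<le> e / (?I + 1)"
        using F by (simp add: dist_norm less_imp_le)
      ultimately show "norm ((\<Sum>k\<in>F. c k * (expi k x * g x)) - ?S x * g x) \<le> e / (?I + 1) * norm (g x)"
        by (simp only: norm_mult) (rule mult_right_mono, auto)
    qed
    also have "\<dots> = e * (?I / (?I + 1))" by simp
    also have "\<dots> < e * 1"
    proof (rule mult_strict_left_mono[OF _ e])
      have "0 < ?I + 1" using I0 by linarith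
      then show "?I / (?I + 1) < 1" by (subst divide_less_eq_1_pos) auto
    qed
    finally show "dist (\<Sum>k\<in>F. c k * (LINT x|torus. expi k x * g x)) (LINT x|torus. ?S x * g x) < e"
      by (simp add: dist_norm)
  qed
qed

text \<open>For hermitian summable coefficients the series is already real, so \<open>Re\<close>
  only changes the type.\<close>

definition synth :: "(int^3 \<Rightarrow> complex) \<Rightarrow> real^3 \<Rightarrow> real" where
  "synth c x = Re (\<Sum>\<^sub>\<infinity>k. c k * expi k x)"

locale summable_hermitian =
  fixes c :: "int^3 \<Rightarrow> complex"
  assumes herm: "\<And>k. c (- k) = cnj (c k)" and summable: "(\<lambda>k. cmod (c k)) summable_on UNIV"
begin

lemma of_real_synth: "of_real (synth c x) = (\<Sum>\<^sub>\<infinity>k. c k * expi k x)"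
proof -
  have "cnj (\<Sum>\<^sub>\<infinity>k. c k * expi k x) = (\<Sum>\<^sub>\<infinity>k. c (- k) * expi (- k) x)"
    unfolding infsum_cnj[symmetric] by (simp add: herm expi_uminus)
  also have "\<dots> = (\<Sum>\<^sub>\<infinity>k. c k * expi k x)"
    by (rule infsum_reindex_bij_witness[of _ uminus uminus]) auto
  finally show ?thesis
    by (simp add: synth_def complex_eq_iff)
qed

lemma synth_continuous: "continuous_on UNIV (synth c)"
  unfolding synth_def by (intro continuous_on_Re continuous_on_expi_series summable)

lemma synth_bounded: "\<bar>synth c x\<bar> \<le> (\<Sum>\<^sub>\<infinity>k. cmod (c k))"
  unfolding synth_def by (rule order_trans[OF abs_Re_le_cmod cmod_expi_series_le[OF summable]])

lemma synth_measurable: "synth c \<in> borel_measurable torus"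
  by (rule continuous_measurable_torus[OF synth_continuous])

lemma synth_periodic: "synth c (x + rvec j) = synth c x"
  by (simp add: synth_def expi_periodic)

lemma synth_integrable: "integrable torus (synth c)"
proof -
  interpret finite_measure torus by (rule finite_measure_torus)
  show ?thesis
    by (rule integrable_const_bound[OF _ synth_measurable]) (use synth_bounded in auto)
qed

lemma synth_integral_has_sum:
  assumes g: "integrable torus g"
  shows "((\<lambda>k. c k * (LINT x|torus. expi k x * g x)) has_sum (LINT x|torus. of_real (synth c x) * g x)) UNIV"
  unfolding of_real_synth by (rule has_sum_integral_expi_series[OF summable g])

lemma fourier_synth: "fourier_scalar (synth c) k = c k"
proof -
  interpret finite_measure torus by (rule finite_measure_torus)
  have "integrable torus (expi (- k))"
    by (rule integrable_const_bound[where B=1]) auto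
  from synth_integral_has_sum[OF this]
  have "((\<lambda>h. c h * (LINT x|torus. expi h x * expi (- k) x)) has_sum fourier_scalar (synth c) k) UNIV"
    by (simp add: fourier_scalar_expi)
  moreover have "c h * (LINT x|torus. expi h x * expi (- k) x) = (if h = k then c k else 0)" for h
    by (simp add: integral_expi flip: expi_add)
  ultimately have "((\<lambda>h. if h = k then c k else 0) has_sum fourier_scalar (synth c) k) UNIV"
    by simp
  moreover have "((\<lambda>h. if h = k then c k else 0) has_sum c k) UNIV"
    by (rule has_sum_finite_neutralI[of "{k}"]) auto
  ultimately show ?thesis by (rule has_sum_unique)
qed

end

section \<open>Fourier coefficients of differences and products\<close>

lemma fourier_scalar_uminus: "fourier_scalar f (- k) = cnj (fourier_scalar f k)"
proof -
  have "cnj (fourier_scalar f k) = (LINT x|torus. cnj (of_real (f x) * expi (- k) x))"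
    unfolding fourier_scalar_expi by (rule Bochner_Integration.integral_cnj[symmetric])
  then show ?thesis
    by (simp only: fourier_scalar_expi complex_cnj_mult complex_cnj_complex_of_real expi_uminus complex_cnj_cnj)
qed

lemma integrable_fourier_scalar: "integrable torus f \<Longrightarrow> integrable torus (\<lambda>x. of_real (f x) * expi k x)"
  by (rule integrable_mult_bounded[where C=1]) auto

lemma fourier_scalar_cmult: "fourier_scalar (\<lambda>x. a * f x) k = of_real a * fourier_scalar f k"
  by (simp add: fourier_scalar_expi mult.assoc)

lemma fourier_scalar_diff:
  assumes "integrable torus f" "integrable torus g"
  shows "fourier_scalar (\<lambda>x. f x - g x) k = fourier_scalar f k - fourier_scalar g k"
  unfolding fourier_scalar_expi of_real_diff left_diff_distrib
  by (intro Bochner_Integration.integral_diff integrable_fourier_scalar assms)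

lemma fourier_scalar_cong_AE:
  assumes "AE x in torus. f x = g x" "f \<in> borel_measurable torus" "g \<in> borel_measurable torus"
  shows "fourier_scalar f k = fourier_scalar g k"
  unfolding fourier_scalar_expi
  by (rule integral_cong_AE) (use assms in \<open>auto elim: eventually_mono intro!: borel_measurable_times borel_measurable_of_real\<close>)

lemma fourier_scalar_eq_imp_AE:
  assumes "integrable torus f" "integrable torus g" "\<And>k. fourier_scalar f k = fourier_scalar g k"
  shows "AE x in torus. f x = g x"
proof -
  have "AE x in torus. f x - g x = 0"
    by (rule fourier_scalar_eq_0_imp_AE) (use assms in \<open>auto simp: fourier_scalar_diff\<close>)
  then show ?thesis by simp
qed

text \<open>By uniqueness \<open>f\<close> equals its absolutely convergent series almost
  everywhere; integrating that series against \<open>g\<close> times a character gives the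
  convolution, with \<open>g\<close> merely integrable.\<close>

lemma fourier_scalar_mult_has_sum:
  assumes f: "integrable torus f" "(\<lambda>k. cmod (fourier_scalar f k)) summable_on UNIV"
    and g: "integrable torus g"
  shows "((\<lambda>h. fourier_scalar f h * fourier_scalar g (k - h)) has_sum fourier_scalar (\<lambda>x. f x * g x) k) UNIV"
proof -
  interpret summable_hermitian "fourier_scalar f"
    by unfold_locales (simp_all add: fourier_scalar_uminus f)
  have ae: "AE x in torus. synth (fourier_scalar f) x = f x"
    by (rule fourier_scalar_eq_imp_AE[OF synth_integrable f(1)]) (simp add: fourier_synth)
  have ig: "integrable torus (\<lambda>x. of_real (g x) * expi (- k) x)"
    by (rule integrable_fourier_scalar[OF g])
  have "expi (- (k - h)) x = expi h x * expi (- k) x" for h x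
    by (simp flip: expi_add)
  then have "(LINT x|torus. expi h x * (of_real (g x) * expi (- k) x)) = fourier_scalar g (k - h)" for h
    unfolding fourier_scalar_expi by (intro Bochner_Integration.integral_cong) (simp_all only: mult_ac)
  moreover have "(LINT x|torus. of_real (synth (fourier_scalar f) x) * (of_real (g x) * expi (- k) x))
      = fourier_scalar (\<lambda>x. f x * g x) k"
    unfolding fourier_scalar_expi[of "\<lambda>x. f x * g x"]
    by (rule integral_cong_AE)
      (use ae f(1) g synth_measurable in \<open>auto elim: eventually_mono intro!: borel_measurable_times borel_measurable_of_real\<close>)
  ultimately show ?thesis
    using synth_integral_has_sum[OF ig] by simp
qed

section \<open>Admissible fields and their coefficients\<close>

lemma L2_component_integrable:
  assumes "u \<in> L2"
  shows "integrable torus (\<lambda>x. u x $ i)" and "integrable torus (\<lambda>x. u x $ i * u x $ i)"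
proof -
  interpret finite_measure torus by (rule finite_measure_torus)
  have m: "u \<in> borel_measurable torus" and i: "integrable torus (\<lambda>x. (norm (u x))\<^sup>2)"
    using assms by (auto simp: L2_def)
  have mi: "(\<lambda>x. u x $ i) \<in> borel_measurable torus"
    using m by (rule measurable_compose) (intro borel_measurable_continuous_onI continuous_intros)
  have le: "\<bar>u x $ i\<bar>\<^sup>2 \<le> (norm (u x))\<^sup>2" for x
    by (intro power_mono component_le_norm_cart) auto
  show "integrable torus (\<lambda>x. u x $ i * u x $ i)"
    by (rule Bochner_Integration.integrable_bound[OF i])
      (use mi le in \<open>auto simp: power2_eq_square abs_mult\<close>)
  show "integrable torus (\<lambda>x. u x $ i)"
  proof (rule Bochner_Integration.integrable_bound)
    show "integrable torus (\<lambda>x. 1 + (norm (u x))\<^sup>2)" using i by simp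
    show "AE x in torus. norm (u x $ i) \<le> norm (1 + (norm (u x))\<^sup>2)"
    proof (rule AE_I2)
      fix x
      have "\<bar>u x $ i\<bar> \<le> 1 + \<bar>u x $ i\<bar>\<^sup>2"
        using mult_le_sum_squares[of 1 "\<bar>u x $ i\<bar>"] by simp
      then show "norm (u x $ i) \<le> norm (1 + (norm (u x))\<^sup>2)"
        using le[of x] by simp
    qed
  qed (rule mi)
qed

text \<open>The pairing of \<open>proj_M_hat\<close>. As \<open>v_dir k\<close> is a real unit
  vector, it returns the scalar factor of an admissible Fourier coefficient.\<close>

definition cofs :: "field \<Rightarrow> int^3 \<Rightarrow> complex" where
  "cofs u k = (if k \<in> M_freq then \<Sum>i\<in>UNIV. of_real (v_dir k $ i) * fourier u k $ i else 0)"

lemma v_dir_sq: "k \<in> M_freq \<Longrightarrow> (\<Sum>i\<in>UNIV. v_dir k $ i * v_dir k $ i) = 1"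
  using norm_v_dir[of k] by (simp add: norm_eq_1 inner_vec_def)

lemma cofs_eqI:
  assumes "\<And>k. fourier u k = d k *s cvec (v_dir k)" "\<And>k. k \<notin> M_freq \<Longrightarrow> d k = 0"
  shows "cofs u k = d k"
proof (cases "k \<in> M_freq")
  case True
  have "cofs u k = (\<Sum>i\<in>UNIV. d k * of_real (v_dir k $ i * v_dir k $ i))"
    using True by (simp add: cofs_def assms(1) cvec_def mult_ac)
  also have "\<dots> = d k * of_real (\<Sum>i\<in>UNIV. v_dir k $ i * v_dir k $ i)"
    by (simp add: sum_distrib_left)
  finally show ?thesis using v_dir_sq[OF True] by simp
qed (simp add: cofs_def assms)

lemma fourier_cofs:
  assumes "u \<in> Hdot_M s"
  shows "fourier u k = cofs u k *s cvec (v_dir k)"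
proof -
  have "\<exists>d. fourier u k = d *s cvec (v_dir k) \<and> (k \<notin> M_freq \<longrightarrow> d = 0)" for k
    using assms by (cases "k \<in> M_freq") (auto simp: Hdot_M_def)
  then obtain d where "\<And>k. fourier u k = d k *s cvec (v_dir k)" "\<And>k. k \<notin> M_freq \<Longrightarrow> d k = 0"
    by metis
  then show ?thesis using cofs_eqI by metis
qed

lemma fourier_component: "fourier u k $ i = fourier_scalar (\<lambda>x. u x $ i) k"
  by (simp add: fourier_def)

lemma fourier_scalar_cofs:
  "u \<in> Hdot_M s \<Longrightarrow> fourier_scalar (\<lambda>x. u x $ i) k = cofs u k * of_real (v_dir k $ i)"
  using fourier_cofs[of u s k] by (simp add: cvec_def flip: fourier_component)

lemma cofs_outside: "k \<notin> M_freq \<Longrightarrow> cofs u k = 0"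
  by (simp add: cofs_def)

lemma cofs_uminus: "cofs u (- k) = cnj (cofs u k)"
  by (simp add: cofs_def fourier_component fourier_scalar_uminus)

lemma norm_smult_cvec: "norm (d *s cvec v) = cmod d * norm v"
  by (simp add: norm_vec_def cvec_def norm_mult L2_set_right_distrib)

text \<open>Formulated through the shape of the coefficients instead of membership in
  \<open>Hdot_M\<close>, so that it applies directly to difference quotients and to orders other
  than that of the space.\<close>

lemma Hdot_norm_eq:
  assumes d: "\<And>k. fourier u k = d k *s cvec (v_dir k)" "\<And>k. k \<notin> M_freq \<Longrightarrow> d k = 0"
    and a: "\<And>k. cf a k = of_real (wt (r / 2) k) * d k"
  shows "Hdot_norm r u = norm a"
proof -
  have "Hdot_weight r u k = (cmod (cf a k))\<^sup>2" for k
  proof -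
    have "norm (fourier u k) = cmod (d k)"
      using norm_v_dir[of k] d[of k] by (cases "k \<in> M_freq") (auto simp: norm_smult_cvec)
    moreover have "wt r k = (wt (r / 2) k)\<^sup>2"
      by (simp add: power2_eq_square wt_add)
    ultimately show ?thesis
      by (simp add: Hdot_weight_def a norm_mult power_mult_distrib flip: wt_def)
  qed
  moreover have "(\<Sum>\<^sub>\<infinity>k\<in>- {0}. (cmod (cf a k))\<^sup>2) = (\<Sum>\<^sub>\<infinity>k. (cmod (cf a k))\<^sup>2)"
    by (rule infsum_cong_neutral) (auto simp: cf_outside zero_notin_M_freq)
  ultimately show ?thesis
    by (simp add: Hdot_norm_def flip: norm_coeffs_sq)
qed

section \<open>The isometry between admissible fields and coefficients\<close>

definition to_coeffs :: "real \<Rightarrow> field \<Rightarrow> coeffs" where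
  "to_coeffs s u = Abs_coeffs (\<lambda>k. of_real (wt (s / 2) k) * cofs u k)"

lemma cf_to_coeffs:
  assumes u: "u \<in> Hdot_M s"
  shows "cf (to_coeffs s u) k = of_real (wt (s / 2) k) * cofs u k"
proof -
  have sq: "(cmod (of_real (wt (s / 2) k) * cofs u k))\<^sup>2 = Hdot_weight s u k" for k
  proof -
    have "norm (fourier u k) = cmod (cofs u k)"
      unfolding fourier_cofs[OF u] using norm_v_dir[of k] cofs_outside[of k u]
      by (cases "k \<in> M_freq") (auto simp: norm_smult_cvec)
    moreover have "wt s k = (wt (s / 2) k)\<^sup>2"
      by (simp add: power2_eq_square wt_add)
    ultimately show ?thesis
      by (simp add: Hdot_weight_def norm_mult power_mult_distrib flip: wt_def)
  qed
  have "Hdot_weight s u summable_on - {0}"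
    using u by (simp add: Hdot_M_def Hdot_def)
  then have "(\<lambda>k. (cmod (of_real (wt (s / 2) k) * cofs u k))\<^sup>2) summable_on UNIV"
    by (rule summable_on_cong_neutral[THEN iffD1, rotated -1])
      (auto simp: sq[symmetric] cofs_outside zero_notin_M_freq)
  then have "(\<lambda>k. of_real (wt (s / 2) k) * cofs u k) \<in> coeff_set"
    by (simp add: coeff_set_def cofs_uminus cofs_outside)
  then show ?thesis by (simp add: to_coeffs_def Abs_coeffs_inverse)
qed

lemma cofs_eq_cf:
  assumes "u \<in> Hdot_M s"
  shows "cofs u k = of_real (wt (- s / 2) k) * cf (to_coeffs s u) k"
proof (cases "k \<in> M_freq")
  case True
  have "of_real (wt (- s / 2) k) * cf (to_coeffs s u) k = of_real (wt (- s / 2) k * wt (s / 2) k) * cofs u k"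
    by (simp add: cf_to_coeffs[OF assms])
  also have "wt (- s / 2) k * wt (s / 2) k = 1"
    using True by (simp add: wt_add wt_0)
  finally show ?thesis by simp
qed (simp add: cofs_outside cf_outside)

text \<open>The product is bounded by a sum of squares: \<open>wt (- s)\<close> is summable from
  order \<open>s_crit\<close> on, and the coefficients are square summable.\<close>

lemma summable_wt_cf:
  assumes "s_crit \<le> s"
  shows "(\<lambda>k. wt (- s / 2) k * cmod (cf a k)) summable_on UNIV"
proof -
  have "(\<lambda>k. wt (- s / 2) k * cmod (cf a k)) summable_on M_freq"
  proof (rule summable_on_comparison_test)
    show "(\<lambda>k. wt (- s_crit) k + (cmod (cf a k))\<^sup>2) summable_on M_freq"
      by (intro summable_on_add wt_neg_summable summable_on_subset_banach[OF cf_summable]) auto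
    fix k assume k: "k \<in> M_freq"
    have "wt (- s / 2) k * cmod (cf a k) \<le> (wt (- s / 2) k)\<^sup>2 + (cmod (cf a k))\<^sup>2"
      by (rule mult_le_sum_squares)
    also have "(wt (- s / 2) k)\<^sup>2 = wt (- s) k" by (simp add: power2_eq_square wt_add)
    also have "\<dots> \<le> wt (- s_crit) k" using assms by (intro wt_mono k) simp
    finally show "wt (- s / 2) k * cmod (cf a k) \<le> wt (- s_crit) k + (cmod (cf a k))\<^sup>2" by simp
  qed (simp add: wt_nonneg)
  then show ?thesis
    by (rule summable_on_cong_neutral[THEN iffD1, rotated -1]) (auto simp: cf_outside)
qed

lemma summable_cofs:
  assumes "u \<in> Hdot_M s" "s_crit \<le> s"
  shows "(\<lambda>k. cmod (cofs u k)) summable_on UNIV"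
  using summable_wt_cf[OF assms(2), of "to_coeffs s u"]
  by (simp add: cofs_eq_cf[OF assms(1)] norm_mult wt_nonneg)

lemma v_dir_component_le: "k \<in> M_freq \<Longrightarrow> \<bar>v_dir k $ i\<bar> \<le> 1"
  using component_le_norm_cart[of "v_dir k" i] norm_v_dir by simp

definition of_coeffs :: "real \<Rightarrow> coeffs \<Rightarrow> field" where
  "of_coeffs s a x = (\<chi> i. synth (\<lambda>k. of_real (wt (- s / 2) k * v_dir k $ i) * cf a k) x)"

lemma of_coeffs_hermitian:
  assumes "s_crit \<le> s"
  shows "summable_hermitian (\<lambda>k. of_real (wt (- s / 2) k * v_dir k $ i) * cf a k)"
proof
  show "of_real (wt (- s / 2) (- k) * v_dir (- k) $ i) * cf a (- k) = cnj (of_real (wt (- s / 2) k * v_dir k $ i) * cf a k)" for k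
    by (simp add: cf_uminus_freq)
  show "(\<lambda>k. cmod (of_real (wt (- s / 2) k * v_dir k $ i) * cf a k)) summable_on UNIV"
  proof (rule summable_on_comparison_test[OF summable_wt_cf[OF assms, of a]])
    fix k
    have "\<bar>v_dir k $ i\<bar> * cmod (cf a k) \<le> 1 * cmod (cf a k)"
      using mult_right_mono[OF v_dir_component_le[of k i] norm_ge_zero[of "cf a k"]]
      by (cases "k \<in> M_freq") (simp_all add: cf_outside)
    then have "wt (- s / 2) k * (\<bar>v_dir k $ i\<bar> * cmod (cf a k)) \<le> wt (- s / 2) k * cmod (cf a k)"
      by (intro mult_left_mono) (auto simp: wt_nonneg)
    then show "cmod (of_real (wt (- s / 2) k * v_dir k $ i) * cf a k) \<le> wt (- s / 2) k * cmod (cf a k)"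
      by (simp add: norm_mult abs_mult wt_nonneg mult.assoc)
  qed auto
qed

lemma fourier_of_coeffs:
  assumes "s_crit \<le> s"
  shows "fourier (of_coeffs s a) k = (of_real (wt (- s / 2) k) * cf a k) *s cvec (v_dir k)"
proof -
  have "fourier_scalar (\<lambda>x. of_coeffs s a x $ i) k = of_real (wt (- s / 2) k * v_dir k $ i) * cf a k" for i
    using summable_hermitian.fourier_synth[OF of_coeffs_hermitian[OF assms]]
    by (simp only: of_coeffs_def vec_lambda_beta)
  then show ?thesis
    by (simp add: vec_eq_iff fourier_component cvec_def)
qed

lemma cofs_of_coeffs:
  "s_crit \<le> s \<Longrightarrow> cofs (of_coeffs s a) k = of_real (wt (- s / 2) k) * cf a k"
  by (rule cofs_eqI[OF fourier_of_coeffs]) (auto simp: cf_outside)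

lemma wt_half_cancel: "k \<in> M_freq \<Longrightarrow> wt (s / 2) k * wt (- s / 2) k = 1"
  by (simp add: wt_add wt_0)

lemma of_coeffs_mem:
  assumes s: "s_crit \<le> s"
  shows "of_coeffs s a \<in> Hdot_M s"
proof -
  interpret finite_measure torus by (rule finite_measure_torus)
  interpret summable_hermitian "\<lambda>k. of_real (wt (- s / 2) k * v_dir k $ i) * cf a k" for i
    by (rule of_coeffs_hermitian[OF s])
  let ?u = "of_coeffs s a"
  have cont: "continuous_on UNIV ?u"
    unfolding of_coeffs_def by (intro continuous_on_vec_lambda) (rule synth_continuous)
  have m: "?u \<in> borel_measurable torus"
    by (rule continuous_measurable_torus[OF cont])
  define C where "C i = (\<Sum>\<^sub>\<infinity>k. cmod (of_real (wt (- s / 2) k * v_dir k $ i) * cf a k))" for i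
  have C: "\<bar>?u x $ i\<bar> \<le> C i" for x i
    unfolding C_def of_coeffs_def vec_lambda_beta by (rule synth_bounded)
  have nb: "norm (?u x) \<le> (\<Sum>i\<in>UNIV. C i)" for x
    by (rule order_trans[OF norm_le_l1_cart sum_mono[OF C]])
  have "integrable torus (\<lambda>x. (norm (?u x))\<^sup>2)"
  proof (rule integrable_const_bound)
    show "AE x in torus. norm ((norm (?u x))\<^sup>2) \<le> (\<Sum>i\<in>UNIV. C i)\<^sup>2"
      by (intro AE_I2) (simp add: power_mono nb)
    show "(\<lambda>x. (norm (?u x))\<^sup>2) \<in> borel_measurable torus" using m by measurable
  qed
  moreover have "periodic ?u"
    unfolding periodic_def of_coeffs_def synth_periodic by simp
  ultimately have L2: "?u \<in> L2" using m by (simp add: L2_def)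
  have iu: "integrable torus ?u"
    by (rule integrable_const_bound[OF _ m]) (use nb in auto)
  have "(LINT x|torus. ?u x) $ i = 0" for i
  proof -
    have "of_real ((LINT x|torus. ?u x) $ i) = fourier ?u 0 $ i"
      using integral_bounded_linear[OF bounded_linear_vec_nth iu, of i]
      by (simp add: fourier_component fourier_scalar_expi integral_complex_of_real)
    also have "\<dots> = 0" by (simp add: fourier_of_coeffs[OF s] cf_outside zero_notin_M_freq)
    finally show ?thesis by simp
  qed
  then have mean: "(LINT x|torus. ?u x) = 0" by (simp add: vec_eq_iff)
  have "Hdot_weight s ?u k = (cmod (cf a k))\<^sup>2" for k
  proof (cases "k \<in> M_freq")
    case True
    have "norm (fourier ?u k) = wt (- s / 2) k * cmod (cf a k)"
      unfolding fourier_of_coeffs[OF s] norm_smult_cvec using norm_v_dir[OF True]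
      by (simp add: norm_mult wt_nonneg)
    moreover have "wt s k * (wt (- s / 2) k)\<^sup>2 = 1"
      using True by (simp add: power2_eq_square wt_add wt_0)
    ultimately show ?thesis
      by (simp add: Hdot_weight_def power_mult_distrib flip: wt_def mult.assoc)
  next
    case False
    then show ?thesis by (simp add: Hdot_weight_def fourier_of_coeffs[OF s] cf_outside)
  qed
  then have "Hdot_weight s ?u = (\<lambda>k. (cmod (cf a k))\<^sup>2)"
    by (rule ext)
  then have "Hdot_weight s ?u summable_on - {0}"
    using summable_on_subset_banach[OF cf_summable[of a], of "- {0}"] by simp
  then have "?u \<in> Hdot s" using L2 mean by (simp add: Hdot_def)
  moreover have "fourier ?u k = 0" if "k \<notin> M_freq" for k
    using that by (simp add: fourier_of_coeffs[OF s] cf_outside)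
  ultimately show ?thesis
    unfolding Hdot_M_def using fourier_of_coeffs[OF s] by blast
qed

lemma to_coeffs_of_coeffs:
  assumes "s_crit \<le> s"
  shows "to_coeffs s (of_coeffs s a) = a"
proof (rule coeffs_eqI)
  fix k assume "k \<in> M_freq"
  then show "cf (to_coeffs s (of_coeffs s a)) k = cf a k"
    using wt_half_cancel[of k s]
    by (simp add: cf_to_coeffs[OF of_coeffs_mem[OF assms]] cofs_of_coeffs[OF assms] flip: of_real_mult mult.assoc)
qed

lemma Hdot_M_L2: "u \<in> Hdot_M s \<Longrightarrow> u \<in> L2"
  by (simp add: Hdot_M_def Hdot_def)

text \<open>Uniqueness of Fourier coefficients, applied to each component, makes
  \<open>to_coeffs\<close> injective modulo \<open>field_eq\<close>.\<close>

lemma field_eq_iff_to_coeffs: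
  assumes u: "u \<in> Hdot_M s" and v: "v \<in> Hdot_M s"
  shows "field_eq u v \<longleftrightarrow> to_coeffs s u = to_coeffs s v"
proof
  assume eq: "field_eq u v"
  have "fourier_scalar (\<lambda>x. u x $ i) k = fourier_scalar (\<lambda>x. v x $ i) k" for i k
    using eq L2_component_integrable(1)[OF Hdot_M_L2[OF u]] L2_component_integrable(1)[OF Hdot_M_L2[OF v]]
    unfolding field_eq_def by (intro fourier_scalar_cong_AE) (auto elim: eventually_mono)
  then have "cofs u = cofs v" by (intro ext) (simp add: cofs_def fourier_component)
  then show "to_coeffs s u = to_coeffs s v" by (simp add: to_coeffs_def)
next
  assume "to_coeffs s u = to_coeffs s v"
  then have "cofs u k = cofs v k" for k by (simp add: cofs_eq_cf[OF u] cofs_eq_cf[OF v])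
  then have "AE x in torus. u x $ i = v x $ i" for i
    using L2_component_integrable(1)[OF Hdot_M_L2[OF u]] L2_component_integrable(1)[OF Hdot_M_L2[OF v]]
    by (intro fourier_scalar_eq_imp_AE) (auto simp: fourier_scalar_cofs[OF u] fourier_scalar_cofs[OF v])
  then have "AE x in torus. \<forall>i\<in>UNIV. u x $ i = v x $ i"
    by (intro AE_finite_allI) auto
  then show "field_eq u v" unfolding field_eq_def by (simp add: vec_eq_iff)
qed

text \<open>Carries the derivative condition of \<open>C1_Hdot_M\<close> over to differentiability
  in \<open>coeffs\<close>. The case \<open>r = 0\<close> is covered because
  \<open>inverse 0 = 0\<close> on both sides.\<close>

lemma Hdot_norm_diff_quotient:
  assumes u: "u \<in> Hdot_M s" and v: "v \<in> Hdot_M s" and w: "w \<in> Hdot_M s"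
  shows "Hdot_norm s (\<lambda>x. (u x - v x) /\<^sub>R r - w x) = norm ((to_coeffs s u - to_coeffs s v) /\<^sub>R r - to_coeffs s w)"
proof (rule Hdot_norm_eq)
  fix k
  show "fourier (\<lambda>x. (u x - v x) /\<^sub>R r - w x) k
      = (of_real (inverse r) * (cofs u k - cofs v k) - cofs w k) *s cvec (v_dir k)"
    by (simp add: vec_eq_iff fourier_component cvec_def fourier_scalar_diff fourier_scalar_cmult
        L2_component_integrable(1)[OF Hdot_M_L2[OF u]] L2_component_integrable(1)[OF Hdot_M_L2[OF v]]
        L2_component_integrable(1)[OF Hdot_M_L2[OF w]] fourier_scalar_cofs[OF u] fourier_scalar_cofs[OF v] fourier_scalar_cofs[OF w])
      (simp add: algebra_simps)
  show "cf ((to_coeffs s u - to_coeffs s v) /\<^sub>R r - to_coeffs s w) k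
      = of_real (wt (s / 2) k) * (of_real (inverse r) * (cofs u k - cofs v k) - cofs w k)"
    by (simp add: cf_to_coeffs u v w scaleR_conv_of_real algebra_simps)
qed (simp add: cofs_outside)

lemma Hdot_norm_diff:
  assumes u: "u \<in> Hdot_M s" and v: "v \<in> Hdot_M s"
  shows "Hdot_norm s (\<lambda>x. u x - v x) = norm (to_coeffs s u - to_coeffs s v)"
proof (rule Hdot_norm_eq)
  fix k
  show "fourier (\<lambda>x. u x - v x) k = (cofs u k - cofs v k) *s cvec (v_dir k)"
    by (simp add: vec_eq_iff fourier_component cvec_def fourier_scalar_diff
        L2_component_integrable(1)[OF Hdot_M_L2[OF u]] L2_component_integrable(1)[OF Hdot_M_L2[OF v]] fourier_scalar_cofs[OF u] fourier_scalar_cofs[OF v] algebra_simps)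
  show "cf (to_coeffs s u - to_coeffs s v) k = of_real (wt (s / 2) k) * (cofs u k - cofs v k)"
    by (simp add: cf_to_coeffs u v algebra_simps)
qed (simp add: cofs_outside)

section \<open>Parseval's identity and the projected nonlinearity\<close>

lemma summable_fourier_component:
  assumes u: "u \<in> Hdot_M s" and s: "s_crit \<le> s"
  shows "(\<lambda>k. cmod (fourier_scalar (\<lambda>x. u x $ i) k)) summable_on UNIV"
proof (rule summable_on_comparison_test[OF summable_cofs[OF u s]])
  fix k show "cmod (fourier_scalar (\<lambda>x. u x $ i) k) \<le> cmod (cofs u k)"
    using v_dir_component_le[of k i] cofs_outside[of k u]
    by (cases "k \<in> M_freq") (auto simp: fourier_scalar_cofs[OF u] norm_mult mult_left_le)
qed auto

text \<open>Parseval: the product formula for a component with itself, read at frequency 0 and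
  summed over the components, where \<open>v_dir\<close> has length 1.\<close>

lemma L2_norm_cofs:
  assumes u: "u \<in> Hdot_M s" and s: "s_crit \<le> s"
  shows "L2_norm u = sqrt (\<Sum>\<^sub>\<infinity>k. (cmod (cofs u k))\<^sup>2)"
proof -
  note i = L2_component_integrable[OF Hdot_M_L2[OF u]]
  have "((\<lambda>h. (cmod (cofs u h))\<^sup>2 * (v_dir h $ i * v_dir h $ i)) has_sum (LINT x|torus. u x $ i * u x $ i)) UNIV" for i
  proof -
    have "((\<lambda>h. complex_of_real ((cmod (cofs u h))\<^sup>2 * (v_dir h $ i * v_dir h $ i))) has_sum
        fourier_scalar (\<lambda>x. u x $ i * u x $ i) 0) UNIV"
    proof (rule has_sum_cong[THEN iffD1, OF _ fourier_scalar_mult_has_sum[OF i(1) summable_fourier_component[OF u s] i(1)]])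
      fix h
      have "cofs u h * cnj (cofs u h) = of_real ((cmod (cofs u h))\<^sup>2)"
        by (rule complex_norm_square[symmetric])
      then show "fourier_scalar (\<lambda>x. u x $ i) h * fourier_scalar (\<lambda>x. u x $ i) (0 - h)
          = complex_of_real ((cmod (cofs u h))\<^sup>2 * (v_dir h $ i * v_dir h $ i))"
        by (simp add: fourier_scalar_cofs[OF u] cofs_uminus mult_ac)
    qed
    moreover have "fourier_scalar (\<lambda>x. u x $ i * u x $ i) 0 = of_real (LINT x|torus. u x $ i * u x $ i)"
      by (simp add: fourier_scalar_expi flip: integral_complex_of_real)
    ultimately show ?thesis by (simp only: has_sum_of_real_iff)
  qed
  then have "((\<lambda>h. \<Sum>i\<in>UNIV. (cmod (cofs u h))\<^sup>2 * (v_dir h $ i * v_dir h $ i)) has_sum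
      (\<Sum>i\<in>UNIV. LINT x|torus. u x $ i * u x $ i)) UNIV"
    unfolding sum_3 by (intro has_sum_add)
  moreover have "(\<Sum>i\<in>UNIV. (cmod (cofs u h))\<^sup>2 * (v_dir h $ i * v_dir h $ i)) = (cmod (cofs u h))\<^sup>2" for h
    using v_dir_sq[of h] cofs_outside[of h u] by (cases "h \<in> M_freq") (auto simp flip: sum_distrib_left)
  moreover have "(\<Sum>i\<in>UNIV. LINT x|torus. u x $ i * u x $ i) = (LINT x|torus. (norm (u x))\<^sup>2)"
    using i(2) by (simp add: power2_norm_eq_inner inner_vec_def Bochner_Integration.integral_sum)
  ultimately have "((\<lambda>h. (cmod (cofs u h))\<^sup>2) has_sum (LINT x|torus. (norm (u x))\<^sup>2)) UNIV"
    by simp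
  then show ?thesis by (simp add: L2_norm_def infsumI)
qed

lemma fourier_scalar_product:
  assumes u: "u \<in> Hdot_M s" and s: "s_crit \<le> s" and k: "k \<in> M_freq"
  shows "fourier_scalar (\<lambda>x. u x $ i * u x $ j) k
    = (\<Sum>h\<in>nbr k. cofs u h * cofs u (k - h) * of_real (v_dir h $ i * v_dir (k - h) $ j))"
proof -
  note i = L2_component_integrable(1)[OF Hdot_M_L2[OF u]]
  have "((\<lambda>h. cofs u h * cofs u (k - h) * of_real (v_dir h $ i * v_dir (k - h) $ j)) has_sum
      fourier_scalar (\<lambda>x. u x $ i * u x $ j) k) UNIV"
    by (rule has_sum_cong[THEN iffD1, OF _ fourier_scalar_mult_has_sum[OF i summable_fourier_component[OF u s] i]])
      (simp add: fourier_scalar_cofs[OF u] mult_ac)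
  moreover have "((\<lambda>h. cofs u h * cofs u (k - h) * of_real (v_dir h $ i * v_dir (k - h) $ j)) has_sum
      (\<Sum>h\<in>nbr k. cofs u h * cofs u (k - h) * of_real (v_dir h $ i * v_dir (k - h) $ j))) UNIV"
    by (rule has_sum_finite_neutralI[OF finite_nbr[OF k]]) (auto simp: nbr_def cofs_outside)
  ultimately show ?thesis by (rule has_sum_unique)
qed

text \<open>The first inner product comes from the divergence, the second from the projection onto
  \<open>v_dir k\<close>. The minus sign of the equation is built in, so that it reads
  \<open>x' = B x x\<close>.\<close>

definition euler_kernel :: "int^3 \<Rightarrow> int^3 \<Rightarrow> complex" where
  "euler_kernel k h = - 2 * of_real pi * \<i> * of_real ((rvec k \<bullet> v_dir h) * (v_dir (k - h) \<bullet> v_dir k))"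

lemma proj_advection:
  assumes u: "u \<in> Hdot_M s" and s: "s_crit \<le> s" and k: "k \<in> M_freq"
  shows "proj_M_hat (advection_hat u) k
    = (- (\<Sum>h\<in>nbr k. euler_kernel k h * cofs u h * cofs u (k - h))) *s cvec (v_dir k)"
proof -
  have "(\<Sum>j\<in>UNIV. of_real (v_dir k $ j) * advection_hat u k $ j)
    = (\<Sum>j\<in>UNIV. \<Sum>i\<in>UNIV. \<Sum>h\<in>nbr k. 2 * of_real pi * \<i> * cofs u h * cofs u (k - h)
         * of_real ((of_int (k $ i) * v_dir h $ i) * (v_dir (k - h) $ j * v_dir k $ j)))"
    by (simp add: advection_hat_def fourier_scalar_product[OF u s k]) (simp add: sum_distrib_left mult_ac)
  also have "\<dots> = (\<Sum>h\<in>nbr k. \<Sum>j\<in>UNIV. \<Sum>i\<in>UNIV. 2 * of_real pi * \<i> * cofs u h * cofs u (k - h)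
         * of_real ((of_int (k $ i) * v_dir h $ i) * (v_dir (k - h) $ j * v_dir k $ j)))"
    by (subst sum.swap[of _ "nbr k"], subst sum.swap[of _ "nbr k"]) (rule refl)
  also have "\<dots> = (\<Sum>h\<in>nbr k. 2 * of_real pi * \<i> * cofs u h * cofs u (k - h)
         * of_real ((rvec k \<bullet> v_dir h) * (v_dir (k - h) \<bullet> v_dir k)))"
  proof (rule sum.cong[OF refl])
    fix h
    have e: "(rvec k \<bullet> v_dir h) * (v_dir (k - h) \<bullet> v_dir k)
        = (\<Sum>j\<in>UNIV. \<Sum>i\<in>UNIV. (of_int (k $ i) * v_dir h $ i) * (v_dir (k - h) $ j * v_dir k $ j))"
      by (subst sum.swap) (simp add: inner_vec_def rvec_def sum_product)
    show "(\<Sum>j\<in>UNIV. \<Sum>i\<in>UNIV. 2 * of_real pi * \<i> * cofs u h * cofs u (k - h)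
         * of_real ((of_int (k $ i) * v_dir h $ i) * (v_dir (k - h) $ j * v_dir k $ j)))
      = 2 * of_real pi * \<i> * cofs u h * cofs u (k - h) * of_real ((rvec k \<bullet> v_dir h) * (v_dir (k - h) \<bullet> v_dir k))"
      unfolding e of_real_sum sum_distrib_left ..
  qed
  also have "\<dots> = - (\<Sum>h\<in>nbr k. euler_kernel k h * cofs u h * cofs u (k - h))"
    by (simp add: euler_kernel_def sum_negf[symmetric] mult_ac)
  finally show ?thesis using k by (simp add: proj_M_hat_def)
qed

section \<open>The restricted Euler equation in coefficient space\<close>

lemma euler_kernel_uminus: "euler_kernel (- k) (- h) = cnj (euler_kernel k h)"
proof -
  have "v_dir (- k - - h) = v_dir (k - h)"
    using v_dir_uminus[of "k - h"] by simp
  then show ?thesis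
    by (simp add: euler_kernel_def rvec_uminus)
qed

text \<open>\<open>v_dir h\<close> is orthogonal to \<open>h\<close>, that is, the advecting field
  is divergence free. Hence \<open>k \<mapsto> h - k\<close> reverses the first factor, while the
  second is symmetric because \<open>v_dir\<close> is even.\<close>

lemma euler_kernel_skew:
  assumes "h \<in> nbr k"
  shows "euler_kernel (h - k) h = - euler_kernel k h"
proof -
  have "rvec (h - k) \<bullet> v_dir h = - (rvec k \<bullet> v_dir h)"
    using v_dir_orthogonal[of h] assms by (simp add: nbr_def rvec_diff inner_diff_right inner_commute[of _ "v_dir h"])
  moreover have "v_dir (h - k) = v_dir (k - h)"
    using v_dir_uminus[of "k - h"] by simp
  ultimately show ?thesis
    by (simp add: euler_kernel_def inner_commute)
qed

lemma euler_kernel_bound: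
  assumes k: "k \<in> M_freq" and h: "h \<in> nbr k"
  shows "cmod (euler_kernel k h) \<le> 12 * pi * sqrt (3 ^ lev h)"
proof -
  have "\<bar>v_dir (k - h) \<bullet> v_dir k\<bar> \<le> 1"
    using Cauchy_Schwarz_ineq2[of "v_dir (k - h)" "v_dir k"] norm_v_dir[of k] norm_v_dir[of "k - h"] k h
    by (simp add: nbr_def)
  then have "\<bar>rvec k \<bullet> v_dir h\<bar> * \<bar>v_dir (k - h) \<bullet> v_dir k\<bar> \<le> (6 * sqrt (3 ^ lev h)) * 1"
    using v_dir_advection_bound[OF k h] by (intro mult_mono) (auto simp: inner_commute)
  then have "(2 * pi) * (\<bar>rvec k \<bullet> v_dir h\<bar> * \<bar>v_dir (k - h) \<bullet> v_dir k\<bar>) \<le> (2 * pi) * (6 * sqrt (3 ^ lev h))"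
    by (intro mult_left_mono) auto
  then show ?thesis
    by (simp add: euler_kernel_def norm_mult abs_mult)
qed

lemma wt_crit_absorb:
  assumes "h \<in> M_freq" "s_crit \<le> s"
  shows "sqrt (3 ^ lev h) * wt (- s / 2) h \<le> 1"
proof -
  have "sqrt (3 ^ lev h) * wt (- s / 2) h \<le> wt (s_crit / 2) h * wt (- s / 2) h"
    using wt_crit_half_ge[OF assms(1)] by (intro mult_right_mono wt_nonneg)
  also have "\<dots> = wt ((s_crit - s) / 2) h" by (simp add: wt_add diff_divide_distrib)
  also have "\<dots> \<le> wt 0 h" using assms by (intro wt_mono) auto
  finally show ?thesis by (simp add: wt_0 assms)
qed

text \<open>Coefficients in \<open>Hdot_M s\<close> are rescaled by \<open>wt (s / 2)\<close>, which turns the Sobolev norm into the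
  norm of \<open>coeffs\<close>. The first argument of the bilinear form enters through its \<open>s_crit\<close> rescaling
  \<open>weaken s x\<close> only; this is the tame estimate.\<close>

definition sob_kernel :: "real \<Rightarrow> int^3 \<Rightarrow> int^3 \<Rightarrow> complex" where
  "sob_kernel s k h = of_real (wt (s / 2) k * wt (- s_crit / 2) h * wt (- s / 2) (k - h)) * euler_kernel k h"

definition weaken :: "real \<Rightarrow> coeffs \<Rightarrow> coeffs" where
  "weaken s = mult (wt ((s_crit - s) / 2))"

definition euler_form :: "real \<Rightarrow> coeffs \<Rightarrow> coeffs \<Rightarrow> coeffs" where
  "euler_form s x y = conv (sob_kernel s) (weaken s x) y"

definition sob_const :: "real \<Rightarrow> real" where
  "sob_const s = 12 * pi * 4 powr (s / 2)"

lemma wt_minus_freq: "wt s (- k - - h) = wt s (k - h)"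
  using wt_uminus[of s "k - h"] by simp

text \<open>The weight at \<open>k\<close> moves to the neighbour \<open>k - h\<close> at the price
  \<open>4 powr (s / 2)\<close>, the source of the dependence on \<open>s\<close>; the growth of the
  kernel is paid for by the critical weight at \<open>h\<close>.\<close>

lemma sob_kernel_bounded:
  assumes s: "s_crit \<le> s"
  shows "bounded_kernel (sob_kernel s) (sob_const s)"
proof
  show "sob_kernel s (- k) (- h) = cnj (sob_kernel s k h)" for k h
    unfolding sob_kernel_def wt_minus_freq by (simp add: euler_kernel_uminus)
  show "0 \<le> sob_const s" by (simp add: sob_const_def)
  fix k h assume k: "k \<in> M_freq" and h: "h \<in> nbr k"
  have hM: "h \<in> M_freq" "k - h \<in> M_freq" "k - h \<in> nbr k"
    using h nbr_minus by (auto simp: nbr_def)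
  have "wt (s / 2) k * wt (- s / 2) (k - h) \<le> (4 powr (s / 2) * wt (s / 2) (k - h)) * wt (- s / 2) (k - h)"
    using wt_ratio[OF k hM(3), of "s / 2"] s s_crit_pos by (intro mult_right_mono wt_nonneg) auto
  also have "\<dots> = 4 powr (s / 2)"
    using wt_half_cancel[OF hM(2), of s] by (simp only: mult.assoc mult_1_right)
  finally have 1: "wt (s / 2) k * wt (- s / 2) (k - h) \<le> 4 powr (s / 2)" .
  have "wt (- s_crit / 2) h * cmod (euler_kernel k h) \<le> wt (- s_crit / 2) h * (12 * pi * sqrt (3 ^ lev h))"
    by (intro mult_left_mono wt_nonneg euler_kernel_bound k h)
  also have "\<dots> = 12 * pi * (sqrt (3 ^ lev h) * wt (- s_crit / 2) h)" by simp
  also have "\<dots> \<le> 12 * pi * 1"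
    by (intro mult_left_mono wt_crit_absorb hM) auto
  finally have 2: "wt (- s_crit / 2) h * cmod (euler_kernel k h) \<le> 12 * pi" by simp
  have "cmod (sob_kernel s k h) = (wt (s / 2) k * wt (- s / 2) (k - h)) * (wt (- s_crit / 2) h * cmod (euler_kernel k h))"
    by (simp add: sob_kernel_def norm_mult wt_nonneg)
  also have "\<dots> \<le> 4 powr (s / 2) * (12 * pi)"
    by (intro mult_mono 1 2) (auto simp: wt_nonneg)
  finally show "cmod (sob_kernel s k h) \<le> sob_const s" by (simp add: sob_const_def mult_ac)
qed

lemma wt_multiplier:
  assumes "r \<le> 0"
  shows "bounded_multiplier (wt r) 1"
proof
  show "\<bar>wt r k\<bar> \<le> 1" if "k \<in> M_freq" for k
    using wt_mono[OF that assms] by (simp add: wt_nonneg wt_0 that)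
qed simp

lemma cf_weaken: "s_crit \<le> s \<Longrightarrow> cf (weaken s x) k = of_real (wt ((s_crit - s) / 2) k) * cf x k"
  unfolding weaken_def by (rule bounded_multiplier.cf_mult[OF wt_multiplier]) simp

lemma wt_crit_shift: "wt (- s_crit / 2) h * wt ((s_crit - s) / 2) h = wt (- s / 2) h"
  unfolding wt_add by (rule arg_cong[where f="\<lambda>r. wt r h"]) (simp add: field_simps)

lemma cf_euler_form:
  assumes s: "s_crit \<le> s" and k: "k \<in> M_freq"
  shows "cf (euler_form s x y) k = of_real (wt (s / 2) k) *
    (\<Sum>h\<in>nbr k. euler_kernel k h * (of_real (wt (- s / 2) h) * cf x h) * (of_real (wt (- s / 2) (k - h)) * cf y (k - h)))"
proof -
  have e: "complex_of_real (wt (- s / 2) h) = of_real (wt (- s_crit / 2) h) * of_real (wt ((s_crit - s) / 2) h)" for h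
    by (simp only: of_real_mult[symmetric] wt_crit_shift)
  have "cf (euler_form s x y) k = (\<Sum>h\<in>nbr k. of_real (wt (s / 2) k * wt (- s_crit / 2) h * wt (- s / 2) (k - h))
      * euler_kernel k h * (of_real (wt ((s_crit - s) / 2) h) * cf x h) * cf y (k - h))"
    using k by (simp only: euler_form_def bounded_kernel.cf_conv[OF sob_kernel_bounded[OF s]] sob_kernel_def cf_weaken[OF s] if_True)
  then show ?thesis
    unfolding sum_distrib_left by (simp only: e[of "_ :: int^3"] of_real_mult mult_ac)
qed

text \<open>The forms of all orders are one unweighted convolution conjugated by weights, so
  \<open>weaken s\<close> intertwines order \<open>s\<close> with order \<open>s_crit\<close>. At
  \<open>s_crit\<close> it is the identity, and the tame bound becomes the plain bilinear
  one.\<close>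

lemma tame_euler_form:
  assumes s: "s_crit \<le> s"
  shows "tame_quadratic (euler_form s) (euler_form s_crit) (weaken s) (72 * sob_const s) (72 * sob_const s_crit)"
proof -
  have w: "bounded_linear (weaken r)" if "s_crit \<le> r" for r
    unfolding weaken_def using that by (intro bounded_multiplier.bounded_linear_mult[OF wt_multiplier]) simp
  have bl: "bounded_bilinear (euler_form r)" if "s_crit \<le> r" for r
    unfolding euler_form_def[abs_def]
    by (rule bounded_bilinear.comp1[OF bounded_kernel.bounded_bilinear_conv[OF sob_kernel_bounded[OF that]] w[OF that]])
  have bound: "norm (euler_form r x y) \<le> 72 * sob_const r * norm (weaken r x) * norm y" if "s_crit \<le> r" for r x y
    unfolding euler_form_def by (rule bounded_kernel.norm_conv_le[OF sob_kernel_bounded[OF that]])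
  have id: "weaken s_crit x = x" for x
    by (rule coeffs_eqI) (simp add: cf_weaken wt_0)
  have "weaken s (euler_form s x y) = euler_form s_crit (weaken s x) (weaken s y)" for x y
  proof (rule coeffs_eqI)
    fix k assume k: "k \<in> M_freq"
    have 1: "of_real (wt ((s_crit - s) / 2) k) * (of_real (wt (s / 2) k) * z) = of_real (wt (s_crit / 2) k) * z" for z :: complex
      by (simp add: wt_add flip: mult.assoc of_real_mult add_divide_distrib)
    have 2: "of_real (wt (- s_crit / 2) h) * (of_real (wt ((s_crit - s) / 2) h) * z) = of_real (wt (- s / 2) h) * z" for h and z :: complex
      by (simp only: mult.assoc[symmetric] of_real_mult[symmetric] wt_crit_shift)
    show "cf (weaken s (euler_form s x y)) k = cf (euler_form s_crit (weaken s x) (weaken s y)) k"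
      unfolding cf_weaken[OF s] cf_euler_form[OF s k] cf_euler_form[OF order_refl k] 1 2 ..
  qed
  then show ?thesis
    using w[OF s] bl[OF s] bl[of s_crit] bound[OF s] bound[of s_crit]
    by (intro tame_quadratic.intro) (simp_all add: id sob_const_def del: mult_le_0_iff)
qed

text \<open>With the output weight removed, the form is a convolution whose second argument is the
  unweighted \<open>x\<close>. Its kernel keeps only a weight at \<open>h\<close>, which the
  involution \<open>k \<mapsto> h - k\<close> does not touch, so \<open>conv_skew\<close>
  applies.\<close>

lemma euler_form_energy:
  assumes s: "s_crit \<le> s"
  shows "mult (wt (- s / 2)) x \<bullet> mult (wt (- s / 2)) (euler_form s x x) = 0"
proof -
  let ?\<gamma> = "\<lambda>k h. of_real (wt (- s / 2) h) * euler_kernel k h"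
  interpret bounded_kernel ?\<gamma> "12 * pi"
  proof
    show "of_real (wt (- s / 2) (- h)) * euler_kernel (- k) (- h) = cnj (of_real (wt (- s / 2) h) * euler_kernel k h)" for k h
      by (simp add: euler_kernel_uminus)
    fix k h assume k: "k \<in> M_freq" and h: "h \<in> nbr k"
    have "wt (- s / 2) h * cmod (euler_kernel k h) \<le> wt (- s / 2) h * (12 * pi * sqrt (3 ^ lev h))"
      by (intro mult_left_mono wt_nonneg euler_kernel_bound k h)
    also have "\<dots> = 12 * pi * (sqrt (3 ^ lev h) * wt (- s / 2) h)" by simp
    also have "\<dots> \<le> 12 * pi * 1"
      using h by (intro mult_left_mono wt_crit_absorb s) (auto simp: nbr_def)
    finally show "cmod (of_real (wt (- s / 2) h) * euler_kernel k h) \<le> 12 * pi"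
      by (simp add: norm_mult wt_nonneg)
  qed simp
  have m: "bounded_multiplier (wt (- s / 2)) 1"
    using s s_crit_pos by (intro wt_multiplier) simp
  have "mult (wt (- s / 2)) (euler_form s x x) = conv ?\<gamma> x (mult (wt (- s / 2)) x)"
  proof (rule coeffs_eqI)
    fix k assume k: "k \<in> M_freq"
    have c: "of_real (wt (- s / 2) k) * (of_real (wt (s / 2) k) * z) = z" for z :: complex
      by (simp only: mult.assoc[symmetric] of_real_mult[symmetric] mult.commute[of "wt (- s / 2) k"]
          wt_half_cancel[OF k] of_real_1 mult_1_left)
    show "cf (mult (wt (- s / 2)) (euler_form s x x)) k = cf (conv ?\<gamma> x (mult (wt (- s / 2)) x)) k"
      using k by (simp only: bounded_multiplier.cf_mult[OF m] cf_euler_form[OF s k] cf_conv if_True c)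
        (simp only: mult_ac)
  qed
  then show ?thesis
    by (subst inner_commute) (simp only:, rule conv_skew, simp add: euler_kernel_skew)
qed

lemma norm_mult_to_coeffs:
  assumes u: "u \<in> Hdot_M s" and s: "s_crit \<le> s"
  shows "norm (mult (wt (- s / 2)) (to_coeffs s u)) = L2_norm u"
proof -
  have m: "bounded_multiplier (wt (- s / 2)) 1"
    using s s_crit_pos by (intro wt_multiplier) simp
  have "(norm (mult (wt (- s / 2)) (to_coeffs s u)))\<^sup>2 = (\<Sum>\<^sub>\<infinity>k. (cmod (cofs u k))\<^sup>2)"
    unfolding norm_coeffs_sq bounded_multiplier.cf_mult[OF m] cofs_eq_cf[OF u] ..
  then show ?thesis
    unfolding L2_norm_cofs[OF u s] by (metis norm_ge_zero real_sqrt_unique)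
qed

lemma norm_weaken_to_coeffs:
  assumes u: "u \<in> Hdot_M s" and s: "s_crit \<le> s"
  shows "norm (weaken s (to_coeffs s u)) = Hdot_norm s_crit u"
proof (rule Hdot_norm_eq[symmetric, OF fourier_cofs[OF u] cofs_outside])
  fix k
  have "wt ((s_crit - s) / 2) k * wt (s / 2) k = wt (s_crit / 2) k"
    by (simp add: wt_add flip: add_divide_distrib)
  then show "cf (weaken s (to_coeffs s u)) k = of_real (wt (s_crit / 2) k) * cofs u k"
    by (simp add: cf_weaken[OF s] cf_to_coeffs[OF u] flip: mult.assoc of_real_mult)
qed

text \<open>Off \<open>M_freq\<close> both terms vanish; on it the nonzero vector
  \<open>cvec (v_dir k)\<close> and the positive weight can be cancelled.\<close>

lemma euler_equation_iff:
  assumes u: "u \<in> Hdot_M s" and w: "w \<in> Hdot_M s" and s: "s_crit \<le> s"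
  shows "(\<forall>k. fourier w k + proj_M_hat (advection_hat u) k = 0)
    \<longleftrightarrow> to_coeffs s w = euler_form s (to_coeffs s u) (to_coeffs s u)"
proof -
  let ?S = "\<lambda>k. \<Sum>h\<in>nbr k. euler_kernel k h * cofs u h * cofs u (k - h)"
  have B: "cf (euler_form s (to_coeffs s u) (to_coeffs s u)) k = of_real (wt (s / 2) k) * ?S k" if "k \<in> M_freq" for k
    unfolding cf_euler_form[OF s that] cofs_eq_cf[OF u] ..
  have iff: "fourier w k + proj_M_hat (advection_hat u) k = 0 \<longleftrightarrow>
      (k \<in> M_freq \<longrightarrow> cf (to_coeffs s w) k = cf (euler_form s (to_coeffs s u) (to_coeffs s u)) k)" for k
  proof (cases "k \<in> M_freq")
    case True
    have "cvec (v_dir k) \<noteq> 0"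
      using norm_smult_cvec[of 1 "v_dir k"] norm_v_dir[OF True] by auto
    moreover have "fourier w k + proj_M_hat (advection_hat u) k = (cofs w k - ?S k) *s cvec (v_dir k)"
      unfolding proj_advection[OF u s True] fourier_cofs[OF w, of k]
      by (simp add: vec_eq_iff algebra_simps)
    ultimately have "fourier w k + proj_M_hat (advection_hat u) k = 0 \<longleftrightarrow> cofs w k = ?S k"
      by (simp add: vector_mul_eq_0)
    then show ?thesis
      using True wt_pos[OF True, of "s / 2"] by (simp add: B cf_to_coeffs[OF w])
  next
    case False
    then show ?thesis
      by (simp add: fourier_cofs[OF w] cofs_outside proj_M_hat_def)
  qed
  show ?thesis
  proof
    assume "\<forall>k. fourier w k + proj_M_hat (advection_hat u) k = 0"
    then show "to_coeffs s w = euler_form s (to_coeffs s u) (to_coeffs s u)"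
      using iff by (intro coeffs_eqI) blast
  qed (simp add: iff)
qed

section \<open>Equivalence of the two notions of solution\<close>

lemma is_solution_imp_quad_sol:
  assumes sol: "is_solution s u0 T u" and s: "s_crit \<le> s" and u0: "u0 \<in> Hdot_M s"
  shows "quad_sol (euler_form s) (to_coeffs s u0) T (\<lambda>t. to_coeffs s (u t))"
    and "t \<in> time_interval T \<Longrightarrow> u t \<in> Hdot_M s"
proof -
  from sol obtain u' where T: "0 < T" and ini: "field_eq (u 0) u0" and C1: "C1_Hdot_M s T u u'"
    and eq: "\<And>t k. t \<in> time_interval T \<Longrightarrow> fourier (u' t) k + proj_M_hat (advection_hat (u t)) k = 0"
    unfolding is_solution_def by blast
  have mem: "u t \<in> Hdot_M s" "u' t \<in> Hdot_M s" if "t \<in> time_interval T" for t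
    using C1 that by (auto simp: C1_Hdot_M_def)
  then show "t \<in> time_interval T \<Longrightarrow> u t \<in> Hdot_M s" by blast
  let ?x = "\<lambda>t. to_coeffs s (u t)"
  have "(?x has_vector_derivative euler_form s (?x t) (?x t)) (at t within time_interval T)"
    if t: "t \<in> time_interval T" for t
  proof -
    have e: "to_coeffs s (u' t) = euler_form s (?x t) (?x t)"
      using euler_equation_iff[OF mem[OF t] s] eq[OF t] by blast
    have "((\<lambda>r. Hdot_norm s (\<lambda>x. (u r x - u t x) /\<^sub>R (r - t) - u' t x)) \<longlongrightarrow> 0) (at t within time_interval T)"
      using C1 t by (simp add: C1_Hdot_M_def)
    then have "((\<lambda>r. norm ((?x r - ?x t) /\<^sub>R (r - t) - to_coeffs s (u' t))) \<longlongrightarrow> 0) (at t within time_interval T)"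
      by (rule Lim_transform_within[OF _ zero_less_one]) (simp add: Hdot_norm_diff_quotient mem t)
    then have "((\<lambda>r. norm (((?x r - ?x t) - (r - t) *\<^sub>R to_coeffs s (u' t))) / norm (r - t)) \<longlongrightarrow> 0) (at t within time_interval T)"
    proof (rule Lim_transform_within[OF _ zero_less_one])
      fix r assume "0 < dist r t"
      then have "(?x r - ?x t) /\<^sub>R (r - t) - to_coeffs s (u' t)
          = ((?x r - ?x t) - (r - t) *\<^sub>R to_coeffs s (u' t)) /\<^sub>R (r - t)"
        by (simp add: scaleR_diff_right)
      then show "norm ((?x r - ?x t) /\<^sub>R (r - t) - to_coeffs s (u' t))
          = norm (((?x r - ?x t) - (r - t) *\<^sub>R to_coeffs s (u' t))) / norm (r - t)"
        by (simp add: divide_inverse mult.commute)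
    qed
    then show ?thesis
      unfolding has_vector_derivative_def has_derivative_iff_norm
      by (simp add: e[symmetric] bounded_linear_scaleR_left divide_inverse)
  qed
  moreover have "?x 0 = to_coeffs s u0"
    using field_eq_iff_to_coeffs[OF _ u0] mem(1)[of 0] ini T by (simp add: zero_in_time_interval)
  ultimately show "quad_sol (euler_form s) (to_coeffs s u0) T ?x"
    using T by (simp add: quad_sol_def)
qed

text \<open>The time derivative is \<open>euler_form\<close> along a continuous curve, which gives
  the continuity demanded by \<open>C1_Hdot_M\<close>.\<close>

lemma quad_sol_imp_is_solution:
  assumes sol: "quad_sol (euler_form s) (to_coeffs s u0) T x" and s: "s_crit \<le> s" and u0: "u0 \<in> Hdot_M s"
  shows "is_solution s u0 T (\<lambda>t. of_coeffs s (x t))"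
proof -
  interpret tame_quadratic "euler_form s" "euler_form s_crit" "weaken s" "72 * sob_const s" "72 * sob_const s_crit"
    by (rule tame_euler_form[OF s])
  have T: "0 < T" and x0: "x 0 = to_coeffs s u0"
    and dx: "\<And>t. t \<in> time_interval T \<Longrightarrow> (x has_vector_derivative euler_form s (x t) (x t)) (at t within time_interval T)"
    using sol by (auto simp: quad_sol_def)
  define u' where "u' t = of_coeffs s (euler_form s (x t) (x t))" for t
  note mem = of_coeffs_mem[OF s] and tc = to_coeffs_of_coeffs[OF s]
  have "((\<lambda>r. Hdot_norm s (\<lambda>y. (of_coeffs s (x r) y - of_coeffs s (x t) y) /\<^sub>R (r - t) - u' t y)) \<longlongrightarrow> 0)
      (at t within time_interval T)" if t: "t \<in> time_interval T" for t
  proof -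
    have "((\<lambda>r. norm (((x r - x t) - (r - t) *\<^sub>R euler_form s (x t) (x t))) / norm (r - t)) \<longlongrightarrow> 0) (at t within time_interval T)"
      using dx[OF t] unfolding has_vector_derivative_def has_derivative_iff_norm by (simp add: divide_inverse)
    then show ?thesis
    proof (rule Lim_transform_within[OF _ zero_less_one])
      fix r assume "0 < dist r t"
      then have "(x r - x t) /\<^sub>R (r - t) - euler_form s (x t) (x t)
          = ((x r - x t) - (r - t) *\<^sub>R euler_form s (x t) (x t)) /\<^sub>R (r - t)"
        by (simp add: scaleR_diff_right)
      then show "norm (((x r - x t) - (r - t) *\<^sub>R euler_form s (x t) (x t))) / norm (r - t)
          = Hdot_norm s (\<lambda>y. (of_coeffs s (x r) y - of_coeffs s (x t) y) /\<^sub>R (r - t) - u' t y)"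
        unfolding u'_def Hdot_norm_diff_quotient[OF mem mem mem] tc by (simp add: divide_inverse mult.commute)
    qed
  qed
  moreover have "((\<lambda>r. Hdot_norm s (\<lambda>y. u' r y - u' t y)) \<longlongrightarrow> 0) (at t within time_interval T)"
    if t: "t \<in> time_interval T" for t
  proof -
    have xt: "(x \<longlongrightarrow> x t) (at t within time_interval T)"
      using has_vector_derivative_continuous[OF dx[OF t]] by (simp add: continuous_within)
    have "((\<lambda>r. norm (euler_form s (x r) (x r) - euler_form s (x t) (x t))) \<longlongrightarrow> 0) (at t within time_interval T)"
      by (intro tendsto_norm_zero Lim_null[THEN iffD1] bounded_bilinear.tendsto[OF B] xt)
    moreover have "Hdot_norm s (\<lambda>y. u' r y - u' t y) = norm (euler_form s (x r) (x r) - euler_form s (x t) (x t))" for r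
      unfolding u'_def Hdot_norm_diff[OF mem mem] tc ..
    ultimately show ?thesis by simp
  qed
  ultimately have "C1_Hdot_M s T (\<lambda>t. of_coeffs s (x t)) u'"
    by (simp add: C1_Hdot_M_def u'_def mem)
  moreover have "\<forall>k. fourier (u' t) k + proj_M_hat (advection_hat (of_coeffs s (x t))) k = 0" for t
    unfolding u'_def euler_equation_iff[OF mem mem s] tc ..
  moreover have "field_eq (of_coeffs s (x 0)) u0"
    unfolding field_eq_iff_to_coeffs[OF mem u0] tc by (rule x0)
  ultimately show ?thesis
    unfolding is_solution_def using T by (intro conjI exI[of _ u']) simp_all
qed

lemma T_max_eq_quad_T_max:
  assumes "s_crit \<le> s" "u0 \<in> Hdot_M s"
  shows "T_max s u0 = quad_T_max (euler_form s) (to_coeffs s u0)"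
proof -
  have "(\<exists>u. is_solution s u0 T u) \<longleftrightarrow> (\<exists>x. quad_sol (euler_form s) (to_coeffs s u0) T x)" for T
  proof (rule iffI; elim exE)
    show "\<exists>x. quad_sol (euler_form s) (to_coeffs s u0) T x" if "is_solution s u0 T u" for u
      by (rule exI) (rule is_solution_imp_quad_sol(1)[OF that assms])
    show "\<exists>u. is_solution s u0 T u" if "quad_sol (euler_form s) (to_coeffs s u0) T x" for x
      by (rule exI) (rule quad_sol_imp_is_solution[OF that assms])
  qed
  then show ?thesis by (simp add: T_max_def quad_T_max_def)
qed

theorem theorem1p7:
  "\<exists>C::real. C > 0 \<and>
     (\<forall>(s::real) (u0::field). s \<ge> s_crit \<longrightarrow> u0 \<in> Hdot_M s \<longrightarrow>
        0 < T_max s u0 \<and>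
        (\<exists>u. is_solution s u0 (T_max s u0) u \<and>
             (\<forall>T v. is_solution s u0 T v \<longrightarrow> (\<forall>t\<in>time_interval T. field_eq (v t) (u t))) \<and>
             T_max s u0 \<ge> 1 / ereal (C * Hdot_norm s_crit u0) \<and>
             (T_max s u0 < \<infinity> \<longrightarrow>
                (\<forall>t\<in>time_interval (T_max s u0).
                   Hdot_norm s_crit (u t) \<ge> 1 / (C * (real_of_ereal (T_max s u0) - t)))) \<and>
             (\<forall>t\<in>time_interval (T_max s u0). L2_norm (u t) = L2_norm u0)))"
\<comment> \<open>72 bounds the number of neighbours, and the kernel bound is taken at the critical
  order. As \<open>4 powr (s_crit / 2) = sqrt 3\<close>, the constant is
  \<open>864 * pi * sqrt 3\<close>.\<close>
proof (intro exI[of _ "72 * sob_const s_crit"] conjI allI impI)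
  show "0 < 72 * sob_const s_crit" by (simp add: sob_const_def)
  fix s :: real and u0 :: field
  assume s: "s_crit \<le> s" and u0: "u0 \<in> Hdot_M s"
  interpret tame_quadratic "euler_form s" "euler_form s_crit" "weaken s" "72 * sob_const s" "72 * sob_const s_crit"
    by (rule tame_euler_form[OF s])
  let ?x0 = "to_coeffs s u0"
  note mem = of_coeffs_mem[OF s] and tc = to_coeffs_of_coeffs[OF s]
  note TM = T_max_eq_quad_T_max[OF s u0]
  obtain x where x: "quad_sol (euler_form s) ?x0 (T_max s u0) x"
    using maximal_solution[of ?x0, folded TM] by (elim exE)
  then show "0 < T_max s u0" by (simp add: quad_sol_def)
  have D: "bounded_linear (mult (wt (- s / 2)))"
    using s s_crit_pos by (intro bounded_multiplier.bounded_linear_mult[OF wt_multiplier]) simp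
  show "\<exists>u. is_solution s u0 (T_max s u0) u \<and>
      (\<forall>T v. is_solution s u0 T v \<longrightarrow> (\<forall>t\<in>time_interval T. field_eq (v t) (u t))) \<and>
      T_max s u0 \<ge> 1 / ereal (72 * sob_const s_crit * Hdot_norm s_crit u0) \<and>
      (T_max s u0 < \<infinity> \<longrightarrow>
        (\<forall>t\<in>time_interval (T_max s u0).
          Hdot_norm s_crit (u t) \<ge> 1 / (72 * sob_const s_crit * (real_of_ereal (T_max s u0) - t)))) \<and>
      (\<forall>t\<in>time_interval (T_max s u0). L2_norm (u t) = L2_norm u0)"
  proof (intro exI[of _ "\<lambda>t. of_coeffs s (x t)"] conjI allI impI ballI)
    show "is_solution s u0 (T_max s u0) (\<lambda>t. of_coeffs s (x t))"
      by (rule quad_sol_imp_is_solution[OF x s u0])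
    show "1 / ereal (72 * sob_const s_crit * Hdot_norm s_crit u0) \<le> T_max s u0"
      using T_max_ge[of ?x0] unfolding TM norm_weaken_to_coeffs[OF u0 s] .
  next
    fix T v t assume v: "is_solution s u0 T v" and t: "t \<in> time_interval T"
    note y = is_solution_imp_quad_sol[OF v s u0]
    have "t \<in> time_interval (T_max s u0)"
      by (rule subsetD[OF time_interval_mono[OF quad_sol_le_T_max[OF y(1), folded TM]] t])
    then have "to_coeffs s (v t) = x t"
      by (rule quad_sol_unique[OF B y(1) x t])
    then show "field_eq (v t) (of_coeffs s (x t))"
      unfolding field_eq_iff_to_coeffs[OF y(2)[OF t] mem] tc .
  next
    fix t assume fin: "T_max s u0 < \<infinity>" and t: "t \<in> time_interval (T_max s u0)"
    have "norm (weaken s (x t)) = Hdot_norm s_crit (of_coeffs s (x t))"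
      using norm_weaken_to_coeffs[OF mem s, of "x t"] unfolding tc .
    then show "1 / (72 * sob_const s_crit * (real_of_ereal (T_max s u0) - t)) \<le> Hdot_norm s_crit (of_coeffs s (x t))"
      using blowup_rate[OF x[unfolded TM] fin[unfolded TM] t[unfolded TM]] by (simp only: TM)
  next
    fix t assume t: "t \<in> time_interval (T_max s u0)"
    have "L2_norm (of_coeffs s (x t)) = norm (mult (wt (- s / 2)) (x t))"
      using norm_mult_to_coeffs[OF mem s, of "x t"] unfolding tc by (rule sym)
    also have "\<dots> = norm (mult (wt (- s / 2)) ?x0)"
      by (rule quad_sol_conserved[where D="mult (wt (- s / 2))" and B="euler_form s", OF D euler_form_energy[OF s] x t])
    also have "\<dots> = L2_norm u0"
      by (rule norm_mult_to_coeffs[OF u0 s])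
    finally show "L2_norm (of_coeffs s (x t)) = L2_norm u0" .
  qed
qed

end
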